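(* Let $n\ge3$, let $M$ be a connected Riemann surface and let $f:M\to S^n$ be a conformal immersion. Suppose that the mean curvature sphere congruence of $f$ has a second envelope $\hat f:M\to S^n$, i.e. an immersion with $\hat f(p)\ne f(p)$ for all $p\in M$ which envelops the mean curvature sphere congruence of $f$, and that $\hat f$ induces the same conformal structure on $M$ as $f$. Then either $f$ is Möbius equivalent to a surface of constant mean curvature 1 in hyperbolic 3-space, or $f$ is S-Willmore.
   Context: **Light-cone model.** $\mathbb R^{n+1,1}$ is Minkowski space with inner product $\langle\cdot,\cdot\rangle$, extended complex bilinearly. Points of $S^n$ are the isotropic lines. Round 2-spheres in $S^n$ correspond to 4-dimensional subspaces of signature $(3,1)$, equivalently to their space-like orthogonal complements of dimension $n-2$; a point lies on the sphere if its isotropic line lies in the 4-dimensional subspace. For a conformal immersion $f:M\to S^n$ and a local complex coordinate $z$, the canonical lift $Y$ is the map into the forward light cone that spans $f$ and satisfies $|dY|^2=|dz|^2$, i.e. $\langle Y_z,Y_z\rangle=0$ and $\langle Y_z,Y_{\bar z}\rangle=\frac12$. Set $V=\mathrm{span}\{Y,dY,Y_{z\bar z}\}$. This is a rank 4 bundle of signature $(3,1)$, independent of the choices made. **Mean curvature spheres and envelopes.** The mean curvature sphere congruence of $f$ assigns to $p$ the round 2-sphere $S(p)$ given by $V_p$. Equivalently, $S(p)$ is tangent to $f$ at $f(p)$ and has there the same mean curvature vector as $f$, with respect to any Euclidean (or space form) metric in the conformal class. An immersion $g:M\to S^n$ envelops a 2-sphere congruence $S$ if $g(p)\in S(p)$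 and $dg(T_pM)=T_{g(p)}S(p)$ for all $p$. **S-Willmore surfaces.** Let $V^\perp$ be the orthogonal complement of $V$ in $M\times\mathbb R^{n+1,1}$, with normal connection $D$ (derivative followed by orthogonal projection to $V^\perp$). The equation $Y_{zz}+\frac s2Y=\kappa$ defines the complex function $s$ (Schwarzian) and the section $\kappa\in\Gamma(V^\perp\otimes\mathbb C)$ (Hopf differential). $f$ is Willmore if $D_{\bar z}D_{\bar z}\kappa+\frac12\bar s\,\kappa=0$. $f$ is S-Willmore if it is Willmore and $\kappa$ and $D_{\bar z}\kappa$ are linearly dependent over $\mathbb C$ at every point. **Möbius equivalence to a cmc-1 surface in hyperbolic 3-space.** This means that $f(M)$ lies in an open round 3-ball $B$ contained in a round 3-sphere in $S^n$, and that $f:M\to B$ has constant mean curvature 1 (for a suitable choice of unit normal) when $B$ is given its conformal complete hyperbolic metric of constant curvature $-1$. *)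

theory Defs
  imports "HOL-Analysis.Analysis"
begin

section \<open>Calculus in one complex variable\<close>

definition dx :: "(complex \<Rightarrow> 'b::real_normed_vector) \<Rightarrow> complex \<Rightarrow> 'b" where
  "dx F w = frechet_derivative F (at w) 1"

definition dy :: "(complex \<Rightarrow> 'b::real_normed_vector) \<Rightarrow> complex \<Rightarrow> 'b" where
  "dy F w = frechet_derivative F (at w) \<i>"

primrec Ck_on :: "nat \<Rightarrow> (complex \<Rightarrow> 'b::real_normed_vector) \<Rightarrow> complex set \<Rightarrow> bool" where
  "Ck_on 0 F \<Omega> \<longleftrightarrow> continuous_on \<Omega> F"
| "Ck_on (Suc k) F \<Omega> \<longleftrightarrow> F differentiable_on \<Omega> \<and> Ck_on k (dx F) \<Omega> \<and> Ck_on k (dy F) \<Omega>"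

text \<open>Only used for open \<open>\<Omega>\<close>, where it is the usual notion of a \<open>C\<close>-infinity map.\<close>

definition Cinf_on :: "(complex \<Rightarrow> 'b::real_normed_vector) \<Rightarrow> complex set \<Rightarrow> bool" where
  "Cinf_on F \<Omega> \<longleftrightarrow> (\<forall>k. Ck_on k F \<Omega>)"

definition dz :: "(complex \<Rightarrow> complex^'m) \<Rightarrow> complex \<Rightarrow> complex^'m" where
  "dz F w = (1/2) *s (dx F w - \<i> *s dy F w)"

definition dzbar :: "(complex \<Rightarrow> complex^'m) \<Rightarrow> complex \<Rightarrow> complex^'m" where
  "dzbar F w = (1/2) *s (dx F w + \<i> *s dy F w)"


section \<open>Riemann surfaces\<close>

text \<open>
  A Riemann surface is a Hausdorff space (a type of class \<open>t2_space\<close>) with a holomorphic atlas.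
  A chart is a pair of its domain and its coordinate function; the values of the latter outside
  the domain are irrelevant. The atlas need not be maximal: all notions below that refer to the
  charts of the atlas are invariant under holomorphic changes of coordinates.
\<close>

type_synonym 'a chart = "'a set \<times> ('a \<Rightarrow> complex)"

definition chart_image :: "'a chart \<Rightarrow> complex set" where
  "chart_image c = snd c ` fst c"

definition chart_inv :: "'a chart \<Rightarrow> complex \<Rightarrow> 'a" where
  "chart_inv c = inv_into (fst c) (snd c)"

definition riemann_surface :: "'a::t2_space chart set \<Rightarrow> bool" where
  "riemann_surface A \<longleftrightarrow>
     (\<Union>c\<in>A. fst c) = UNIV \<and>
     (\<forall>c\<in>A. open (fst c) \<and> open (chart_image c) \<and>
            homeomorphism (fst c) (chart_image c) (snd c) (chart_inv c)) \<and>
     (\<forall>c\<in>A. \<forall>d\<in>A. (snd d \<circ> chart_inv c) holomorphic_on (snd c ` (fst c \<inter> fst d)))"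

definition smooth_map :: "'a chart set \<Rightarrow> ('a \<Rightarrow> 'b::real_normed_vector) \<Rightarrow> bool" where
  "smooth_map A g \<longleftrightarrow> (\<forall>c\<in>A. Cinf_on (g \<circ> chart_inv c) (chart_image c))"

text \<open>
  The \<open>n\<close>-sphere is the unit sphere of \<open>real^'n\<close>, where \<open>CARD('n) = n + 1\<close>.
\<close>

definition immersion :: "'a chart set \<Rightarrow> ('a \<Rightarrow> real^'n) \<Rightarrow> bool" where
  "immersion A g \<longleftrightarrow>
     range g \<subseteq> sphere 0 1 \<and> smooth_map A g \<and>
     (\<forall>c\<in>A. \<forall>w\<in>chart_image c. inj (frechet_derivative (g \<circ> chart_inv c) (at w)))"

definition conformal :: "'a chart set \<Rightarrow> ('a \<Rightarrow> real^'n) \<Rightarrow> bool" where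
  "conformal A g \<longleftrightarrow>
     (\<forall>c\<in>A. \<forall>w\<in>chart_image c.
        norm (dx (g \<circ> chart_inv c) w) = norm (dy (g \<circ> chart_inv c) w) \<and>
        dx (g \<circ> chart_inv c) w \<bullet> dy (g \<circ> chart_inv c) w = 0)"


section \<open>The light-cone model\<close>

text \<open>
  Minkowski space is \<open>real^('n option)\<close> with time coordinate \<open>None\<close>, and its complexification
  is \<open>complex^('n option)\<close>. The same constant \<open>mink\<close> is the inner product on the former and its
  complex bilinear extension on the latter.
\<close>

definition mink :: "'k::comm_ring_1^('n::finite option) \<Rightarrow> 'k^('n option) \<Rightarrow> 'k" where
  "mink v w = (\<Sum>j\<in>UNIV. v $ Some j * w $ Some j) - v $ None * w $ None"

definition cvec :: "real^'m \<Rightarrow> complex^'m" where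
  "cvec v = (\<chi> i. complex_of_real (v $ i))"

text \<open>The isotropic line of a point \<open>x\<close> of the sphere is spanned by \<open>null_vec x\<close>.\<close>

definition null_vec :: "real^'n::finite \<Rightarrow> real^('n option)" where
  "null_vec x = (\<chi> i. case i of None \<Rightarrow> 1 | Some j \<Rightarrow> x $ j)"

definition has_signature :: "(real^('n::finite option)) set \<Rightarrow> nat \<Rightarrow> nat \<Rightarrow> bool" where
  "has_signature W r s \<longleftrightarrow>
     (\<exists>P N. subspace P \<and> subspace N \<and> dim P = r \<and> dim N = s \<and>
        (\<forall>x\<in>P. x \<noteq> 0 \<longrightarrow> mink x x > 0) \<and> (\<forall>y\<in>N. y \<noteq> 0 \<longrightarrow> mink y y < 0) \<and>
        (\<forall>x\<in>P. \<forall>y\<in>N. mink x y = 0) \<and>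
        W = {x + y | x y. x \<in> P \<and> y \<in> N})"

text \<open>
  For \<open>W\<close> of signature \<open>(k + 1, 1)\<close> this is the set of points of the round \<open>k\<close>-sphere given by \<open>W\<close>.
\<close>

definition round_sphere :: "(real^('n::finite option)) set \<Rightarrow> (real^'n) set" where
  "round_sphere W = {x \<in> sphere 0 1. null_vec x \<in> W}"

text \<open>The tangent space at \<open>x\<close> of a submanifold \<open>X\<close>, as the set of velocities of curves in \<open>X\<close>.\<close>

definition tangent_space :: "'b::real_normed_vector set \<Rightarrow> 'b \<Rightarrow> 'b set" where
  "tangent_space X x =
     {v. \<exists>\<gamma>. \<gamma> 0 = x \<and> (\<forall>\<^sub>F t in nhds (0::real). \<gamma> t \<in> X) \<and>
             (\<gamma> has_vector_derivative v) (at 0)}"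


section \<open>Mean curvature spheres and envelopes\<close>

text \<open>The canonical lift of \<open>h\<close> with respect to the coordinate of \<open>\<Omega>\<close>.\<close>

definition canonical_lift ::
    "complex set \<Rightarrow> (complex \<Rightarrow> real^'n::finite) \<Rightarrow> (complex \<Rightarrow> real^('n option)) \<Rightarrow> bool" where
  "canonical_lift \<Omega> h Y \<longleftrightarrow>
     Cinf_on Y \<Omega> \<and>
     (\<forall>w\<in>\<Omega>. Y w $ None > 0 \<and> Y w \<in> span {null_vec (h w)} \<and>
        mink (dz (cvec \<circ> Y) w) (dz (cvec \<circ> Y) w) = 0 \<and>
        mink (dz (cvec \<circ> Y) w) (dzbar (cvec \<circ> Y) w) = 1/2)"

text \<open>The fourth vector below is the second mixed Wirtinger derivative of \<open>Y\<close>.\<close>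

definition V_space :: "(complex \<Rightarrow> real^('n::finite option)) \<Rightarrow> complex \<Rightarrow> (real^('n option)) set" where
  "V_space Y w = span {Y w, dx Y w, dy Y w, (1/4) *\<^sub>R (dx (dx Y) w + dy (dy Y) w)}"

text \<open>
  The space \<open>V_space Y (snd c p)\<close> does not depend on the choice of the chart \<open>c\<close> around \<open>p\<close>
  and of \<open>Y\<close> (which is unique on the image of the chart).
\<close>

definition mean_curvature_space ::
    "'a chart set \<Rightarrow> ('a \<Rightarrow> real^'n::finite) \<Rightarrow> 'a \<Rightarrow> (real^('n option)) set" where
  "mean_curvature_space A f p =
     (THE W. \<exists>c\<in>A. \<exists>Y. p \<in> fst c \<and> canonical_lift (chart_image c) (f \<circ> chart_inv c) Y \<and>
                       W = V_space Y (snd c p))"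

text \<open>A 2-sphere congruence is given by a map \<open>S\<close> to the subspaces of signature \<open>(3, 1)\<close>.\<close>

definition envelops ::
    "'a chart set \<Rightarrow> ('a \<Rightarrow> real^'n::finite) \<Rightarrow> ('a \<Rightarrow> (real^('n option)) set) \<Rightarrow> bool" where
  "envelops A g S \<longleftrightarrow>
     immersion A g \<and>
     (\<forall>p. g p \<in> round_sphere (S p) \<and>
        (\<forall>c\<in>A. p \<in> fst c \<longrightarrow>
           range (frechet_derivative (g \<circ> chart_inv c) (at (snd c p)))
             = tangent_space (round_sphere (S p)) (g p)))"


section \<open>S-Willmore surfaces\<close>

definition complexified :: "(real^'m) set \<Rightarrow> (complex^'m) set" where
  "complexified W = {cvec a + \<i> *s cvec b | a b. a \<in> W \<and> b \<in> W}"

definition complex_perp :: "(real^('n::finite option)) set \<Rightarrow> (complex^('n option)) set" where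
  "complex_perp W = {\<eta>. \<forall>a\<in>W. mink \<eta> (cvec a) = 0}"

definition normal_proj ::
    "(real^('n::finite option)) set \<Rightarrow> complex^('n option) \<Rightarrow> complex^('n option)" where
  "normal_proj W \<psi> = (THE \<eta>. \<eta> \<in> complex_perp W \<and> \<psi> - \<eta> \<in> complexified W)"

text \<open>The normal connection in the direction of the conjugate coordinate.\<close>

definition D_zbar ::
    "(complex \<Rightarrow> real^('n::finite option)) \<Rightarrow> (complex \<Rightarrow> complex^('n option)) \<Rightarrow>
     complex \<Rightarrow> complex^('n option)" where
  "D_zbar Y \<psi> w = normal_proj (V_space Y w) (dzbar \<psi> w)"

text \<open>
  The canonical lift \<open>Y\<close>, the Schwarzian \<open>s\<close> and the Hopf differential \<open>\<kappa>\<close>; they are uniquely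
  determined on \<open>\<Omega>\<close> by \<open>h\<close>.
\<close>

definition invariants ::
    "complex set \<Rightarrow> (complex \<Rightarrow> real^'n::finite) \<Rightarrow> (complex \<Rightarrow> real^('n option)) \<Rightarrow>
     (complex \<Rightarrow> complex) \<Rightarrow> (complex \<Rightarrow> complex^('n option)) \<Rightarrow> bool" where
  "invariants \<Omega> h Y s \<kappa> \<longleftrightarrow>
     canonical_lift \<Omega> h Y \<and>
     (\<forall>w\<in>\<Omega>. \<kappa> w \<in> complex_perp (V_space Y w) \<and>
             dz (dz (cvec \<circ> Y)) w + (s w / 2) *s cvec (Y w) = \<kappa> w)"

definition willmore :: "'a chart set \<Rightarrow> ('a \<Rightarrow> real^'n::finite) \<Rightarrow> bool" where
  "willmore A f \<longleftrightarrow>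
     (\<forall>c\<in>A. \<exists>Y s \<kappa>. invariants (chart_image c) (f \<circ> chart_inv c) Y s \<kappa> \<and>
        (\<forall>w\<in>chart_image c. D_zbar Y (D_zbar Y \<kappa>) w + (cnj (s w) / 2) *s \<kappa> w = 0))"

definition s_willmore :: "'a chart set \<Rightarrow> ('a \<Rightarrow> real^'n::finite) \<Rightarrow> bool" where
  "s_willmore A f \<longleftrightarrow>
     willmore A f \<and>
     (\<forall>c\<in>A. \<exists>Y s \<kappa>. invariants (chart_image c) (f \<circ> chart_inv c) Y s \<kappa> \<and>
        (\<forall>w\<in>chart_image c. \<exists>a b :: complex. (a \<noteq> 0 \<or> b \<noteq> 0) \<and>
           a *s \<kappa> w + b *s D_zbar Y \<kappa> w = 0))"


section \<open>Surfaces of constant mean curvature in hyperbolic 3-space\<close>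

text \<open>
  For \<open>L\<close> of signature \<open>(3, 1)\<close> this is the hyperboloid model of hyperbolic 3-space, of constant
  curvature \<open>-1\<close> in the metric induced by \<open>mink\<close>.
\<close>

definition hyperbolic_space :: "(real^('n::finite option)) set \<Rightarrow> (real^('n option)) set" where
  "hyperbolic_space L = {y \<in> L. mink y y = -1 \<and> y $ None > 0}"

text \<open>
  Half the trace of the second fundamental form with respect to the first one, for a surface
  \<open>k\<close> in a hyperboloid and a unit normal \<open>\<nu>\<close> tangent to the hyperboloid. As \<open>\<nu>\<close> is tangent to the
  hyperboloid, the second derivatives may be taken in the ambient vector space.
\<close>

definition mean_curvature ::
    "(complex \<Rightarrow> real^('n::finite option)) \<Rightarrow> real^('n option) \<Rightarrow> complex \<Rightarrow> real" where
  "mean_curvature k \<nu> w =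
     (let g11 = mink (dx k w) (dx k w); g12 = mink (dx k w) (dy k w); g22 = mink (dy k w) (dy k w);
          b11 = mink (dx (dx k) w) \<nu>; b12 = mink (dx (dy k) w) \<nu>; b22 = mink (dy (dy k) w) \<nu>
      in (g22 * b11 - 2 * g12 * b12 + g11 * b22) / (2 * (g11 * g22 - g12\<^sup>2)))"

definition unit_normal ::
    "'a::topological_space chart set \<Rightarrow> (real^('n::finite option)) set \<Rightarrow> ('a \<Rightarrow> real^('n option)) \<Rightarrow>
     ('a \<Rightarrow> real^('n option)) \<Rightarrow> bool" where
  "unit_normal A L k \<nu> \<longleftrightarrow>
     continuous_on UNIV \<nu> \<and>
     (\<forall>p. \<nu> p \<in> L \<and> mink (\<nu> p) (k p) = 0 \<and> mink (\<nu> p) (\<nu> p) = 1) \<and>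
     (\<forall>c\<in>A. \<forall>p\<in>fst c. mink (\<nu> p) (dx (k \<circ> chart_inv c) (snd c p)) = 0 \<and>
                       mink (\<nu> p) (dy (k \<circ> chart_inv c) (snd c p)) = 0)"

definition cmc1_in_hyperbolic ::
    "'a::topological_space chart set \<Rightarrow> (real^('n::finite option)) set \<Rightarrow> ('a \<Rightarrow> real^('n option)) \<Rightarrow>
     bool" where
  "cmc1_in_hyperbolic A L k \<longleftrightarrow>
     range k \<subseteq> hyperbolic_space L \<and>
     (\<exists>\<nu>. unit_normal A L k \<nu> \<and>
        (\<forall>c\<in>A. \<forall>p\<in>fst c. mean_curvature (k \<circ> chart_inv c) (\<nu> p) (snd c p) = 1))"

text \<open>
  For \<open>W\<close> of signature \<open>(4, 1)\<close>, the open round 3-balls in the round 3-sphere given by \<open>W\<close> are the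
  sets \<open>round_ball W q\<close> with \<open>q \<in> W\<close> and \<open>mink q q = 1\<close>.
\<close>

definition round_ball :: "(real^('n::finite option)) set \<Rightarrow> real^('n option) \<Rightarrow> (real^'n) set" where
  "round_ball W q = {x \<in> round_sphere W. mink (null_vec x) q > 0}"

text \<open>
  The map \<open>to_hyperboloid q\<close> is a bijection of \<open>round_ball W q\<close> onto the hyperboloid in the
  orthogonal complement of \<open>q\<close> in \<open>W\<close>; its inverse takes \<open>y\<close> to the isotropic line of \<open>y + q\<close>.
  The metric of the hyperboloid pulls back to the round metric divided by
  \<open>(mink (null_vec x) q)\<^sup>2\<close>, which is thus the conformal complete metric of curvature \<open>-1\<close> on
  the ball.
\<close>

definition to_hyperboloid :: "real^('n::finite option) \<Rightarrow> real^'n \<Rightarrow> real^('n option)" where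
  "to_hyperboloid q x = (1 / mink (null_vec x) q) *\<^sub>R null_vec x - q"

definition moebius_equivalent_to_hyperbolic_cmc1 ::
    "'a::topological_space chart set \<Rightarrow> ('a \<Rightarrow> real^'n::finite) \<Rightarrow> bool" where
  "moebius_equivalent_to_hyperbolic_cmc1 A f \<longleftrightarrow>
     (\<exists>W q. has_signature W 4 1 \<and> q \<in> W \<and> mink q q = 1 \<and>
        range f \<subseteq> round_ball W q \<and>
        cmc1_in_hyperbolic A {y \<in> W. mink y q = 0} (to_hyperboloid q \<circ> f))"

end

(*
  Let Y be the canonical lift of f and Yh the lift of fhat with <Y, Yh> = -1; as fhat envelops the
  mean curvature spheres, Yh and its first derivatives lie in V. Put mu = 2 <Yh, Y_z> and
  P = Y_z + (mu/2) Y. In the null frame Y, Yh, P, cnj P of V one has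
    Yh_z = (mu/2) Yh + rho P + theta cnj P.
  Conformality of fhat means theta rho = 0, and since fhat is an immersion theta and rho do not
  vanish simultaneously. Enveloping gives D_zbar kappa = - (cnj mu / 2) kappa, and from this the
  Willmore operator applied to kappa is - (cnj theta / 2) kappa. So f is S-Willmore if
  theta kappa = 0 everywhere.

  Otherwise theta kappa <> 0 at some point, and then everywhere: this is a closed condition because
  rho = 0 makes xi = kappa / theta a real normal field whose squared length h satisfies the linear
  equation h_z = - mu h. Moreover the vector Q = - (xi / sqrt h + 2 sqrt h Yh) is constant,
  V + span Q is constant of signature (4, 1), and Q cuts out a ball of the corresponding 3-sphere.
  All mean curvature spheres touch its boundary, i.e. they are horospheres, so f has mean
  curvature 1.
*)
theory Submission
  imports Defs "HOL-Complex_Analysis.Cauchy_Integral_Formula"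
begin

section \<open>Smooth maps of one complex variable\<close>

text \<open>The data are only smooth, so nothing can be continued analytically from one point to the
  surface, and \<open>\<theta>\<close> and \<open>\<kappa>\<close> depend on the coordinate. Both
  obstacles are met by a set attached to each point, \<open>horo_vectors\<close>: it is empty where
  \<open>\<theta>\<close> or \<open>\<kappa>\<close> vanishes and contains just the vector Q
  elsewhere. It is written with the coordinate-free lifts \<open>null_vec (f p)\<close> and
  \<open>null_vec (fhat p)\<close>, its conditions survive holomorphic coordinate changes, and it is
  locally constant; connectedness then makes the pointwise alternative a global one. What replaces
  analyticity is \<open>linear_ode_zero\<close>: a solution of a homogeneous linear first-order
  system that vanishes at a point vanishes nearby. It is applied to \<open>h\<close>, and again to
  show that V + span Q is constant. The latter is phrased through orthogonal vectors: for a fixed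
  real u orthogonal to Q, the products of u with \<open>Y\<close>, \<open>P\<close> and
  \<open>Yh\<close> form a closed linear system, so that being orthogonal to V is a locally constant
  property of the point.\<close>

lemma dx_eq: "(F has_derivative F') (at w) \<Longrightarrow> dx F w = F' 1"
  unfolding dx_def using frechet_derivative_at by metis

lemma dy_eq: "(F has_derivative F') (at w) \<Longrightarrow> dy F w = F' \<i>"
  unfolding dy_def using frechet_derivative_at by metis

text \<open>\<open>frechet_derivative\<close> chooses from the predicate
  \<open>has_derivative\<close>, so functions with the same predicate get the same value,
  differentiable or not.\<close>

lemma frechet_derivative_cong_open:
  assumes "open S" "w \<in> S" "\<And>x. x \<in> S \<Longrightarrow> F x = G x"
  shows "frechet_derivative F (at w) = frechet_derivative G (at w)"
proof -
  have "(F has_derivative f') (at w) \<longleftrightarrow> (G has_derivative f') (at w)" for f'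
    using has_derivative_transform_within_open[OF _ assms(1,2)] assms(3) by metis
  then show ?thesis by (simp add: frechet_derivative_def)
qed

lemma dx_cong: "open S \<Longrightarrow> w \<in> S \<Longrightarrow> (\<And>x. x \<in> S \<Longrightarrow> F x = G x) \<Longrightarrow> dx F w = dx G w"
  unfolding dx_def using frechet_derivative_cong_open by metis

lemma dy_cong: "open S \<Longrightarrow> w \<in> S \<Longrightarrow> (\<And>x. x \<in> S \<Longrightarrow> F x = G x) \<Longrightarrow> dy F w = dy G w"
  unfolding dy_def using frechet_derivative_cong_open by metis

lemma differentiable_on_open:
  "open S \<Longrightarrow> F differentiable_on S \<longleftrightarrow> (\<forall>w\<in>S. F differentiable (at w))"
  by (metis at_within_open differentiable_on_def)

lemma differentiable_on_openI:
  "open S \<Longrightarrow> (\<And>w. w \<in> S \<Longrightarrow> (F has_derivative D w) (at w)) \<Longrightarrow> F differentiable_on S"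
  by (auto simp: differentiable_on_open differentiable_def)

lemma differentiable_on_cong_open:
  assumes "open S" "\<And>x. x \<in> S \<Longrightarrow> F x = G x"
  shows "F differentiable_on S \<longleftrightarrow> G differentiable_on S"
proof -
  have "F differentiable (at w) \<longleftrightarrow> G differentiable (at w)" if "w \<in> S" for w
    unfolding differentiable_def
    using has_derivative_transform_within_open[OF _ assms(1) that] assms(2) by metis
  then show ?thesis by (simp add: differentiable_on_open[OF assms(1)])
qed

lemma Ck_on_cong:
  assumes "open S" "\<And>x. x \<in> S \<Longrightarrow> F x = G x"
  shows "Ck_on k F S \<longleftrightarrow> Ck_on k G S"
  using assms(2)
proof (induction k arbitrary: F G)
  case 0
  then show ?case by (simp cong: continuous_on_cong)
next
  case (Suc k)
  have "Ck_on k (dx F) S = Ck_on k (dx G) S"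
    by (rule Suc.IH) (use dx_cong[OF assms(1)] Suc.prems in metis)
  moreover have "Ck_on k (dy F) S = Ck_on k (dy G) S"
    by (rule Suc.IH) (use dy_cong[OF assms(1)] Suc.prems in metis)
  ultimately show ?case
    using differentiable_on_cong_open[OF assms(1) Suc.prems] by (simp only: Ck_on.simps)
qed

lemma Ck_on_subset: "Ck_on k F S \<Longrightarrow> S' \<subseteq> S \<Longrightarrow> Ck_on k F S'"
  by (induction k arbitrary: F) (auto intro: continuous_on_subset differentiable_on_subset)

lemma Ck_on_Suc: "Ck_on (Suc k) F S \<Longrightarrow> Ck_on k F S"
proof (induction k arbitrary: F)
  case 0
  then show ?case by (simp add: differentiable_imp_continuous_on)
next
  case (Suc k)
  then show ?case by (metis Ck_on.simps(2))
qed

text \<open>The closure lemmas below use this form: a differentiation rule supplies D, and its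
  values at 1 and \<i> are expressions of the same kind, to which the induction hypothesis
  applies.\<close>

lemma Ck_on_SucI:
  assumes "open S" and D: "\<And>w. w \<in> S \<Longrightarrow> (F has_derivative D w) (at w)"
    and "Ck_on k (\<lambda>w. D w 1) S" "Ck_on k (\<lambda>w. D w \<i>) S"
  shows "Ck_on (Suc k) F S"
proof -
  have "Ck_on k (dx F) S" "Ck_on k (dy F) S"
    using Ck_on_cong[OF assms(1), of "dx F" "\<lambda>w. D w 1"] Ck_on_cong[OF assms(1), of "dy F" "\<lambda>w. D w \<i>"]
      dx_eq[OF D] dy_eq[OF D] assms(3,4) by auto
  then show ?thesis using differentiable_on_openI[OF assms(1) D] by simp
qed

lemma Ck_on_SucD:
  assumes "Ck_on (Suc k) F S" "open S"
  shows "w \<in> S \<Longrightarrow> (F has_derivative frechet_derivative F (at w)) (at w)"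
    and "Ck_on k (\<lambda>w. frechet_derivative F (at w) 1) S" "Ck_on k (\<lambda>w. frechet_derivative F (at w) \<i>) S"
  using assms differentiable_on_open[of S F]
  by (simp_all add: frechet_derivative_works dx_def [abs_def] dy_def [abs_def])

lemma Ck_on_const: "Ck_on k (\<lambda>w. c) S"
proof (induction k arbitrary: c)
  case (Suc k)
  have "dx (\<lambda>w. c) = (\<lambda>w. 0)" "dy (\<lambda>w. c) = (\<lambda>w. 0)"
    by (rule ext, rule dx_eq[OF has_derivative_const], rule ext, rule dy_eq[OF has_derivative_const])
  with Suc show ?case by simp
qed simp

lemma Ck_on_linear:
  assumes "open S" "bounded_linear L" "Ck_on k F S"
  shows "Ck_on k (\<lambda>w. L (F w)) S"
  using assms(3)
proof (induction k arbitrary: F)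
  case 0
  then show ?case using assms(2) bounded_linear.continuous_on by auto
next
  case (Suc k)
  note F = Ck_on_SucD[OF Suc.prems assms(1)]
  show ?case
    by (rule Ck_on_SucI[OF assms(1) bounded_linear.has_derivative[OF assms(2) F(1)]])
      (auto intro: Suc.IH F)
qed

lemma Ck_on_add:
  assumes "open S" "Ck_on k F S" "Ck_on k G S"
  shows "Ck_on k (\<lambda>w. F w + G w) S"
  using assms(2,3)
proof (induction k arbitrary: F G)
  case 0
  then show ?case by (auto intro: continuous_intros)
next
  case (Suc k)
  note F = Ck_on_SucD[OF Suc.prems(1) assms(1)] and G = Ck_on_SucD[OF Suc.prems(2) assms(1)]
  show ?case
    by (rule Ck_on_SucI[OF assms(1) has_derivative_add[OF F(1) G(1)]]) (auto intro: Suc.IH F G)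
qed

lemma Ck_on_bilinear:
  assumes "open S" "bounded_bilinear B" "Ck_on k F S" "Ck_on k G S"
  shows "Ck_on k (\<lambda>w. B (F w) (G w)) S"
  using assms(3,4)
proof (induction k arbitrary: F G)
  case 0
  then show ?case using bounded_bilinear.continuous_on[OF assms(2)] by auto
next
  case (Suc k)
  note F = Ck_on_SucD[OF Suc.prems(1) assms(1)] and G = Ck_on_SucD[OF Suc.prems(2) assms(1)]
  show ?case
    by (rule Ck_on_SucI[OF assms(1) bounded_bilinear.FDERIV[OF assms(2) F(1) G(1)]])
      (auto intro!: Ck_on_add[OF assms(1)] Suc.IH F G Ck_on_Suc[OF Suc.prems(1)] Ck_on_Suc[OF Suc.prems(2)])
qed

lemma Ck_on_inverse:
  fixes g :: "complex \<Rightarrow> real"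
  assumes "open S" "Ck_on k g S" "\<And>w. w \<in> S \<Longrightarrow> g w \<noteq> 0"
  shows "Ck_on k (\<lambda>w. inverse (g w)) S"
  using assms(2)
proof (induction k)
  case 0
  then show ?case using assms(3) by (auto intro: continuous_intros)
next
  case (Suc k)
  note g = Ck_on_SucD[OF Suc.prems assms(1)]
  show ?case
    by (rule Ck_on_SucI[OF assms(1) Deriv.has_derivative_inverse[OF assms(3) g(1)]])
      (auto intro!: Ck_on_linear[OF assms(1) bounded_linear_minus[OF bounded_linear_ident]]
        Ck_on_bilinear[OF assms(1) bounded_bilinear_mult] Suc.IH Ck_on_Suc[OF Suc.prems] g)
qed

text \<open>The derivative contains 1 / sqrt g; the induction hypothesis for sqrt g and
  \<open>Ck_on_inverse\<close> control this factor.\<close>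

lemma Ck_on_sqrt:
  fixes g :: "complex \<Rightarrow> real"
  assumes "open S" "Ck_on k g S" "\<And>w. w \<in> S \<Longrightarrow> g w > 0"
  shows "Ck_on k (\<lambda>w. sqrt (g w)) S"
  using assms(2)
proof (induction k)
  case 0
  then show ?case by (auto intro: continuous_intros)
next
  case (Suc k)
  note g = Ck_on_SucD[OF Suc.prems assms(1)]
  have D: "((\<lambda>w. sqrt (g w)) has_derivative
      (\<lambda>h. (inverse (sqrt (g w)) / 2) * frechet_derivative g (at w) h)) (at w)"
    if "w \<in> S" for w
    using has_derivative_compose[OF g(1)[OF that]]
      DERIV_real_sqrt[OF assms(3)[OF that], unfolded has_field_derivative_def] by blast
  have "Ck_on k (\<lambda>w. inverse (sqrt (g w))) S"
    using Suc.IH[OF Ck_on_Suc[OF Suc.prems]] assms(3)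
    by (intro Ck_on_inverse[OF assms(1)]) (auto simp: less_le)
  then have "Ck_on k (\<lambda>w. inverse (sqrt (g w)) / 2) S"
    using Ck_on_linear[OF assms(1), of "\<lambda>x::real. x / 2"] bounded_linear_divide by blast
  then show ?case
    by (intro Ck_on_SucI[OF assms(1) D] Ck_on_bilinear[OF assms(1) bounded_bilinear_mult] g)
qed

lemma Cinf_on_cong: "open S \<Longrightarrow> (\<And>x. x \<in> S \<Longrightarrow> F x = G x) \<Longrightarrow> Cinf_on F S \<longleftrightarrow> Cinf_on G S"
  by (simp add: Cinf_on_def Ck_on_cong[of _ F G])

lemma Cinf_on_subset: "Cinf_on F S \<Longrightarrow> S' \<subseteq> S \<Longrightarrow> Cinf_on F S'"
  by (auto simp: Cinf_on_def intro: Ck_on_subset)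

lemma Cinf_on_const: "Cinf_on (\<lambda>w. c) S"
  by (simp add: Cinf_on_def Ck_on_const)

lemma Cinf_on_linear: "open S \<Longrightarrow> bounded_linear L \<Longrightarrow> Cinf_on F S \<Longrightarrow> Cinf_on (\<lambda>w. L (F w)) S"
  by (simp add: Cinf_on_def Ck_on_linear)

lemma Cinf_on_add: "open S \<Longrightarrow> Cinf_on F S \<Longrightarrow> Cinf_on G S \<Longrightarrow> Cinf_on (\<lambda>w. F w + G w) S"
  by (simp add: Cinf_on_def Ck_on_add)

lemma Cinf_on_bilinear:
  "open S \<Longrightarrow> bounded_bilinear B \<Longrightarrow> Cinf_on F S \<Longrightarrow> Cinf_on G S \<Longrightarrow> Cinf_on (\<lambda>w. B (F w) (G w)) S"
  by (simp add: Cinf_on_def Ck_on_bilinear)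

lemma Cinf_on_inverse:
  "open S \<Longrightarrow> Cinf_on g S \<Longrightarrow> (\<And>w. w \<in> S \<Longrightarrow> g w \<noteq> 0) \<Longrightarrow> Cinf_on (\<lambda>w. inverse (g w :: real)) S"
  by (simp add: Cinf_on_def Ck_on_inverse)

lemma Cinf_on_sqrt:
  "open S \<Longrightarrow> Cinf_on g S \<Longrightarrow> (\<And>w. w \<in> S \<Longrightarrow> g w > 0) \<Longrightarrow> Cinf_on (\<lambda>w. sqrt (g w)) S"
  by (simp add: Cinf_on_def Ck_on_sqrt)

lemma Cinf_on_dx: "Cinf_on F S \<Longrightarrow> Cinf_on (dx F) S"
  unfolding Cinf_on_def by (metis Ck_on.simps(2))

lemma Cinf_on_dy: "Cinf_on F S \<Longrightarrow> Cinf_on (dy F) S"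
  unfolding Cinf_on_def by (metis Ck_on.simps(2))

lemma Cinf_on_differentiable:
  assumes "Cinf_on F S" "open S" "w \<in> S"
  shows "F differentiable (at w)"
proof -
  have "Ck_on (Suc 0) F S" using assms by (simp only: Cinf_on_def)
  then show ?thesis using assms differentiable_on_open by auto
qed

lemma Cinf_on_continuous: "Cinf_on F S \<Longrightarrow> continuous_on S F"
  unfolding Cinf_on_def by (metis Ck_on.simps(1))

section \<open>Symmetry of second derivatives\<close>

lemma DERIV_along_line:
  fixes g :: "complex \<Rightarrow> real"
  assumes "g differentiable (at (a + complex_of_real t * d))"
  shows "((\<lambda>t. g (a + complex_of_real t * d)) has_real_derivative
           frechet_derivative g (at (a + complex_of_real t * d)) d) (at t)"
proof -
  let ?D = "frechet_derivative g (at (a + complex_of_real t * d))"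
  have g: "(g has_derivative ?D) (at (a + complex_of_real t * d))"
    using assms frechet_derivative_works by blast
  have "((\<lambda>t. a + complex_of_real t * d) has_derivative (\<lambda>h. complex_of_real h * d)) (at t)"
    by (auto intro!: derivative_eq_intros)
  from has_derivative_compose[OF this g]
  have "((\<lambda>t. g (a + complex_of_real t * d)) has_derivative (\<lambda>h. ?D (complex_of_real h * d))) (at t)" .
  moreover have "?D (complex_of_real h * d) = ?D d * h" for h
    using linear_cmul[OF has_derivative_linear[OF g], of h d] by (simp add: scaleR_conv_of_real)
  ultimately show ?thesis by (simp add: has_field_derivative_def)
qed

text \<open>Mean value argument: the second difference over a small square is h^2 times either mixed
  derivative at some point of the square, and continuity compares both points with
  \<open>w\<close>.\<close>

lemma dx_dy_commute_real:
  fixes g :: "complex \<Rightarrow> real"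
  assumes "open S" "Cinf_on g S" "w \<in> S"
  shows "dx (dy g) w = dy (dx g) w"
proof (rule ccontr)
  assume ne: "dx (dy g) w \<noteq> dy (dx g) w"
  define e where "e = \<bar>dx (dy g) w - dy (dx g) w\<bar> / 2"
  have e: "e > 0" using ne by (simp add: e_def)
  note diff = Cinf_on_differentiable[OF _ assms(1)]
  have c1: "continuous (at w) (dx (dy g))" and c2: "continuous (at w) (dy (dx g))"
    using Cinf_on_continuous[OF Cinf_on_dx[OF Cinf_on_dy[OF assms(2)]]]
      Cinf_on_continuous[OF Cinf_on_dy[OF Cinf_on_dx[OF assms(2)]]] assms(1,3)
      continuous_on_eq_continuous_at by blast+
  obtain d1 where d1: "d1 > 0" "\<And>x. dist x w < d1 \<Longrightarrow> dist (dx (dy g) x) (dx (dy g) w) < e"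
    using c1 e unfolding continuous_at_eps_delta by blast
  obtain d2 where d2: "d2 > 0" "\<And>x. dist x w < d2 \<Longrightarrow> dist (dy (dx g) x) (dy (dx g) w) < e"
    using c2 e unfolding continuous_at_eps_delta by blast
  obtain d3 where d3: "d3 > 0" "ball w d3 \<subseteq> S" using assms open_contains_ball by blast
  \<comment> \<open>Points of the square of side h have distance at most 2 h from \<open>w\<close>;
    the factor 3 makes the estimate strict.\<close>
  define h where "h = min d1 (min d2 d3) / 3"
  have h: "h > 0" "3 * h \<le> d1" "3 * h \<le> d2" "3 * h \<le> d3"
    using d1(1) d2(1) d3(1) by (auto simp: h_def)
  define q where "q s t = w + complex_of_real s + complex_of_real t * \<i>" for s t
  have dq: "dist (q s t) w < 3 * h" if "0 \<le> s" "s \<le> h" "0 \<le> t" "t \<le> h" for s t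
  proof -
    have "dist (q s t) w = norm (complex_of_real s + complex_of_real t * \<i>)"
      by (simp add: dist_norm q_def)
    also have "\<dots> \<le> norm (complex_of_real s) + norm (complex_of_real t * \<i>)" by (rule norm_triangle_ineq)
    also have "\<dots> < 3 * h" using that h by (simp add: norm_mult)
    finally show ?thesis .
  qed
  have qS: "q s t \<in> S" if "0 \<le> s" "s \<le> h" "0 \<le> t" "t \<le> h" for s t
    using dq[OF that] h d3 by (auto simp: dist_commute subset_iff)
  have X: "((\<lambda>s. G (q s t)) has_real_derivative dx G (q s t)) (at s)"
    if "Cinf_on G S" "0 \<le> s" "s \<le> h" "0 \<le> t" "t \<le> h" for G :: "complex \<Rightarrow> real" and s t
    using DERIV_along_line[of G "w + complex_of_real t * \<i>" s 1] diff[OF that(1) qS[OF that(2-)]]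
    by (simp add: q_def dx_def add_ac)
  have Y: "((\<lambda>t. G (q s t)) has_real_derivative dy G (q s t)) (at t)"
    if "Cinf_on G S" "0 \<le> s" "s \<le> h" "0 \<le> t" "t \<le> h" for G :: "complex \<Rightarrow> real" and s t
    using DERIV_along_line[of G "w + complex_of_real s" t \<i>] diff[OF that(1) qS[OF that(2-)]]
    by (simp add: q_def dy_def add_ac)
  define \<Delta> where "\<Delta> = g (q h h) - g (q h 0) - g (q 0 h) + g (q 0 0)"
  have "\<exists>s>0. s < h \<and> (g (q h h) - g (q h 0)) - (g (q 0 h) - g (q 0 0)) = (h - 0) * (dx g (q s h) - dx g (q s 0))"
    using h by (intro MVT2 DERIV_diff X assms) auto
  then obtain s where s: "0 < s" "s < h" "\<Delta> = h * (dx g (q s h) - dx g (q s 0))"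
    by (auto simp: \<Delta>_def)
  have "\<exists>t>0. t < h \<and> dx g (q s h) - dx g (q s 0) = (h - 0) * dy (dx g) (q s t)"
    using h s by (intro MVT2 Y Cinf_on_dx assms) auto
  then obtain t where t: "0 < t" "t < h" "\<Delta> = h * (h * dy (dx g) (q s t))" using s by auto
  have "\<exists>t>0. t < h \<and> (g (q h h) - g (q 0 h)) - (g (q h 0) - g (q 0 0)) = (h - 0) * (dy g (q h t) - dy g (q 0 t))"
    using h by (intro MVT2 DERIV_diff Y assms) auto
  then obtain t' where t': "0 < t'" "t' < h" "\<Delta> = h * (dy g (q h t') - dy g (q 0 t'))"
    by (auto simp: \<Delta>_def)
  have "\<exists>s>0. s < h \<and> dy g (q h t') - dy g (q 0 t') = (h - 0) * dx (dy g) (q s t')"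
    using h t' by (intro MVT2 X Cinf_on_dy assms) auto
  then obtain s' where s': "0 < s'" "s' < h" "\<Delta> = h * (h * dx (dy g) (q s' t'))" using t' by auto
  \<comment> \<open>Both sides are the second difference divided by h^2. It is closer than e to each
    mixed derivative at \<open>w\<close>, although these differ by 2 e.\<close>
  have "dy (dx g) (q s t) = dx (dy g) (q s' t')" using t s' h by auto
  moreover have "dist (dy (dx g) (q s t)) (dy (dx g) w) < e"
    using d2(2) dq[of s t] s t h by auto
  moreover have "dist (dx (dy g) (q s' t')) (dx (dy g) w) < e"
    using d1(2) dq[of s' t'] s' t' h by auto
  ultimately show False
    using dist_triangle2[of "dx (dy g) w" "dy (dx g) w" "dx (dy g) (q s' t')"]
    by (simp add: e_def dist_real_def[symmetric] dist_commute)
qed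

lemma dx_linear:
  assumes "bounded_linear L" "F differentiable (at w)"
  shows "dx (\<lambda>w. L (F w)) w = L (dx F w)"
  using dx_eq[OF bounded_linear.has_derivative[OF assms(1)]] assms(2) frechet_derivative_works
  unfolding dx_def by blast

lemma dy_linear:
  assumes "bounded_linear L" "F differentiable (at w)"
  shows "dy (\<lambda>w. L (F w)) w = L (dy F w)"
  using dy_eq[OF bounded_linear.has_derivative[OF assms(1)]] assms(2) frechet_derivative_works
  unfolding dy_def by blast

lemma dx_dy_commute:
  fixes F :: "complex \<Rightarrow> 'b::euclidean_space"
  assumes "open S" "Cinf_on F S" "w \<in> S"
  shows "dx (dy F) w = dy (dx F) w"
proof (rule euclidean_eqI)
  fix b :: 'b assume "b \<in> Basis"
  let ?L = "\<lambda>v. v \<bullet> b"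
  have L: "bounded_linear ?L" by (rule bounded_linear_inner_left)
  note diff = Cinf_on_differentiable[OF _ assms(1)]
  have "dx (dy F) w \<bullet> b = dx (\<lambda>w. dy F w \<bullet> b) w"
    by (rule dx_linear[OF L, symmetric]) (intro diff Cinf_on_dy assms)
  also have "\<dots> = dx (dy (\<lambda>w. F w \<bullet> b)) w"
    by (rule dx_cong[OF assms(1,3)]) (simp add: dy_linear[OF L] diff[OF assms(2)])
  also have "\<dots> = dy (dx (\<lambda>w. F w \<bullet> b)) w"
    by (rule dx_dy_commute_real[OF assms(1) Cinf_on_linear[OF assms(1) L assms(2)] assms(3)])
  also have "\<dots> = dy (\<lambda>w. dx F w \<bullet> b) w"
    by (rule dy_cong[OF assms(1,3)]) (simp add: dx_linear[OF L] diff[OF assms(2)])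
  also have "\<dots> = dy (dx F) w \<bullet> b"
    by (rule dy_linear[OF L]) (intro diff Cinf_on_dx assms)
  finally show "dx (dy F) w \<bullet> b = dy (dx F) w \<bullet> b" .
qed

text \<open>On a ball of radius below \<open>1 / (2 C)\<close> the maximum of \<open>norm u\<close> is at most half of itself.\<close>

lemma linear_ode_zero:
  fixes u :: "complex \<Rightarrow> 'b::real_normed_vector"
  assumes "r > 0" and D: "\<And>w. w \<in> ball w0 r \<Longrightarrow> (u has_derivative u' w) (at w)"
    and B: "\<And>w h. w \<in> ball w0 r \<Longrightarrow> norm (u' w h) \<le> C * norm (u w) * norm h"
    and 0: "u w0 = 0"
  shows "\<exists>\<delta>>0. \<delta> \<le> r \<and> (\<forall>w\<in>ball w0 \<delta>. u w = 0)"
proof -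
  define K where "K = \<bar>C\<bar> + 1"
  have K: "K > 0" "C \<le> K" by (auto simp: K_def)
  define \<delta> where "\<delta> = min (r / 2) (1 / (2 * K))"
  have \<delta>: "\<delta> > 0" "\<delta> < r" "\<delta> * K \<le> 1 / 2"
    using assms(1) K by (auto simp: \<delta>_def min_def field_simps split: if_splits)
  have sub: "cball w0 \<delta> \<subseteq> ball w0 r" using \<delta> by auto
  have "continuous_on (cball w0 \<delta>) (\<lambda>w. norm (u w))"
    using D sub by (intro continuous_on_norm continuous_at_imp_continuous_on)
      (metis has_derivative_continuous subsetD)
  then obtain m where m: "m \<in> cball w0 \<delta>" "\<And>w. w \<in> cball w0 \<delta> \<Longrightarrow> norm (u w) \<le> norm (u m)"
    using continuous_attains_sup[of "cball w0 \<delta>" "\<lambda>w. norm (u w)"] \<delta> by force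
  let ?M = "norm (u m)"
  have "norm (u m - u w0) \<le> (K * ?M) * norm (m - w0)"
  proof (rule differentiable_bound[OF convex_cball[of w0 \<delta>]])
    fix x assume x: "x \<in> cball w0 \<delta>"
    then show "(u has_derivative u' x) (at x within cball w0 \<delta>)"
      using D sub has_derivative_at_withinI by blast
    have "norm (u' x h) \<le> (K * ?M) * norm h" for h
    proof -
      have "norm (u' x h) \<le> C * norm (u x) * norm h" using B x sub by blast
      also have "\<dots> \<le> (K * ?M) * norm h"
        using m(2)[OF x] K by (intro mult_right_mono mult_mono) auto
      finally show ?thesis .
    qed
    then show "onorm (u' x) \<le> K * ?M" by (rule onorm_le)
  qed (use m \<delta> in auto)
  also have "\<dots> \<le> (K * ?M) * \<delta>"
    using m(1) K by (intro mult_left_mono) (auto simp: dist_norm norm_minus_commute)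
  also have "\<dots> = (\<delta> * K) * ?M" by simp
  also have "\<dots> \<le> 1 / 2 * ?M" using \<delta>(3) by (intro mult_right_mono) auto
  finally have "?M = 0" using 0 by simp
  then show ?thesis using m(2) \<delta> by (intro exI[of _ \<delta>]) force
qed


section \<open>Wirtinger calculus\<close>

definition ddz :: "(complex \<Rightarrow> complex) \<Rightarrow> complex \<Rightarrow> complex" where
  "ddz g w = (1/2) * (dx g w - \<i> * dy g w)"

definition ddzbar :: "(complex \<Rightarrow> complex) \<Rightarrow> complex \<Rightarrow> complex" where
  "ddzbar g w = (1/2) * (dx g w + \<i> * dy g w)"

definition cnjv :: "complex^'m \<Rightarrow> complex^'m" where
  "cnjv v = (\<chi> i. cnj (v $ i))"

lemma smult_scaleR: "complex_of_real r *s v = r *\<^sub>R v"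
  by (simp add: vec_eq_iff) (simp add: scaleR_conv_of_real)

lemma bilinear_smult: "bounded_bilinear (\<lambda>(a::complex) (v::complex^'m). a *s v)"
  unfolding bilinear_conv_bounded_bilinear[symmetric] bilinear_def
  by (auto intro!: linearI simp: vec_eq_iff algebra_simps)

lemma differentiable_bilinear:
  "bounded_bilinear B \<Longrightarrow> F differentiable (at w) \<Longrightarrow> G differentiable (at w) \<Longrightarrow>
     (\<lambda>x. B (F x) (G x)) differentiable (at w)"
  unfolding differentiable_def using bounded_bilinear.FDERIV by blast

lemma differentiable_smult:
  "g differentiable (at w) \<Longrightarrow> F differentiable (at w) \<Longrightarrow>
     (\<lambda>x. g x *s (F x :: complex^'m)) differentiable (at w)"
  by (rule differentiable_bilinear[OF bilinear_smult])

lemma linear_smult: "bounded_linear (\<lambda>v::complex^'m. a *s v)"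
  using bilinear_smult bounded_bilinear.bounded_linear_right by blast

lemma linear_cnjv: "bounded_linear cnjv"
  unfolding linear_conv_bounded_linear[symmetric] by (auto intro!: linearI simp: cnjv_def vec_eq_iff)

lemma linear_cvec: "bounded_linear cvec"
  unfolding linear_conv_bounded_linear[symmetric]
  by (auto intro!: linearI simp: cvec_def vec_eq_iff) (simp add: scaleR_conv_of_real)

lemma has_derivative_wirtinger_vec:
  fixes F :: "complex \<Rightarrow> complex^'m"
  assumes "F differentiable (at w)"
  shows "(F has_derivative (\<lambda>h. h *s dz F w + cnj h *s dzbar F w)) (at w)"
proof -
  let ?D = "frechet_derivative F (at w)"
  have D: "(F has_derivative ?D) (at w)" using assms frechet_derivative_works by blast
  have "?D h = h *s dz F w + cnj h *s dzbar F w" for h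
  proof -
    have "Re h *\<^sub>R 1 + Im h *\<^sub>R \<i> = h" by (simp add: complex_eq_iff)
    then have "?D h = ?D (Re h *\<^sub>R 1 + Im h *\<^sub>R \<i>)" by simp
    also have "\<dots> = Re h *\<^sub>R dx F w + Im h *\<^sub>R dy F w"
      unfolding dx_def dy_def using has_derivative_linear[OF D] by (simp only: linear_add linear_cmul)
    also have "\<dots> = h *s dz F w + cnj h *s dzbar F w"
      by (simp add: vec_eq_iff dz_def dzbar_def complex_eq_iff field_simps)
    finally show ?thesis .
  qed
  then have "?D = (\<lambda>h. h *s dz F w + cnj h *s dzbar F w)" by blast
  then show ?thesis using D by simp
qed

lemma has_derivative_wirtinger:
  fixes g :: "complex \<Rightarrow> complex"
  assumes "g differentiable (at w)"
  shows "(g has_derivative (\<lambda>h. h * ddz g w + cnj h * ddzbar g w)) (at w)"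
proof -
  let ?D = "frechet_derivative g (at w)"
  have D: "(g has_derivative ?D) (at w)" using assms frechet_derivative_works by blast
  have "?D h = h * ddz g w + cnj h * ddzbar g w" for h
  proof -
    have "Re h *\<^sub>R 1 + Im h *\<^sub>R \<i> = h" by (simp add: complex_eq_iff)
    then have "?D h = ?D (Re h *\<^sub>R 1 + Im h *\<^sub>R \<i>)" by simp
    also have "\<dots> = Re h *\<^sub>R dx g w + Im h *\<^sub>R dy g w"
      unfolding dx_def dy_def using has_derivative_linear[OF D] by (simp only: linear_add linear_cmul)
    also have "\<dots> = h * ddz g w + cnj h * ddzbar g w"
      by (simp add: ddz_def ddzbar_def complex_eq_iff field_simps)
    finally show ?thesis .
  qed
  then have "?D = (\<lambda>h. h * ddz g w + cnj h * ddzbar g w)" by blast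
  then show ?thesis using D by simp
qed

text \<open>Uniqueness of the coefficients of h and cnj h in a real differential. Each
  differentiation rule below expands its factors by \<open>has_derivative_wirtinger_vec\<close> and
  collects these coefficients.\<close>

lemma wirtinger_vecI:
  fixes F :: "complex \<Rightarrow> complex^'m"
  assumes "(F has_derivative D) (at w)" and "\<And>h. D h = h *s a + cnj h *s b"
  shows "dz F w = a \<and> dzbar F w = b"
  unfolding dz_def dzbar_def dx_eq[OF assms(1)] dy_eq[OF assms(1)] assms(2)
  by (simp add: vec_eq_iff algebra_simps)

lemma wirtingerI:
  fixes g :: "complex \<Rightarrow> complex"
  assumes "(g has_derivative D) (at w)" and "\<And>h. D h = h * a + cnj h * b"
  shows "ddz g w = a \<and> ddzbar g w = b"
  unfolding ddz_def ddzbar_def dx_eq[OF assms(1)] dy_eq[OF assms(1)] assms(2)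
  by (simp add: algebra_simps)

lemma dz_cong: "open S \<Longrightarrow> w \<in> S \<Longrightarrow> (\<And>x. x \<in> S \<Longrightarrow> F x = G x) \<Longrightarrow> dz F w = dz G w"
  and dzbar_cong: "open S \<Longrightarrow> w \<in> S \<Longrightarrow> (\<And>x. x \<in> S \<Longrightarrow> F x = G x) \<Longrightarrow> dzbar F w = dzbar G w"
  by (simp_all only: dz_def dzbar_def dx_cong[of S w F G] dy_cong[of S w F G])

lemma ddz_cong: "open S \<Longrightarrow> w \<in> S \<Longrightarrow> (\<And>x. x \<in> S \<Longrightarrow> F x = G x) \<Longrightarrow> ddz F w = ddz G w"
  and ddzbar_cong: "open S \<Longrightarrow> w \<in> S \<Longrightarrow> (\<And>x. x \<in> S \<Longrightarrow> F x = G x) \<Longrightarrow> ddzbar F w = ddzbar G w"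
  by (simp_all only: ddz_def ddzbar_def dx_cong[of S w F G] dy_cong[of S w F G])

lemma dz_const [simp]: "dz (\<lambda>w. c) w = 0" and dzbar_const [simp]: "dzbar (\<lambda>w. c) w = 0"
  \<comment> \<open>Merges the two goals into one conjunction, the form in which
    \<open>wirtinger_vecI\<close> delivers both derivatives; the following rules are proved in the
    same way.\<close>
  unfolding atomize_conj
  by (rule wirtinger_vecI[OF has_derivative_const]; simp)

lemma ddz_const [simp]: "ddz (\<lambda>w. c) w = 0" and ddzbar_const [simp]: "ddzbar (\<lambda>w. c) w = 0"
  unfolding atomize_conj
  by (rule wirtingerI[OF has_derivative_const]; simp)

lemma
  fixes F G :: "complex \<Rightarrow> complex^'m"
  assumes "F differentiable (at w)" "G differentiable (at w)"
  shows dz_add: "dz (\<lambda>x. F x + G x) w = dz F w + dz G w"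
    and dzbar_add: "dzbar (\<lambda>x. F x + G x) w = dzbar F w + dzbar G w"
  unfolding atomize_conj
  by (rule wirtinger_vecI[OF has_derivative_add[OF assms[THEN has_derivative_wirtinger_vec]]];
      simp add: vec_eq_iff algebra_simps)

lemma
  fixes F G :: "complex \<Rightarrow> complex^'m"
  assumes "F differentiable (at w)" "G differentiable (at w)"
  shows dz_diff: "dz (\<lambda>x. F x - G x) w = dz F w - dz G w"
    and dzbar_diff: "dzbar (\<lambda>x. F x - G x) w = dzbar F w - dzbar G w"
  unfolding atomize_conj
  by (rule wirtinger_vecI[OF has_derivative_diff[OF assms[THEN has_derivative_wirtinger_vec]]];
      simp add: vec_eq_iff algebra_simps)

lemma
  fixes F :: "complex \<Rightarrow> complex^'m"
  assumes "g differentiable (at w)" "F differentiable (at w)"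
  shows dz_smult: "dz (\<lambda>x. g x *s F x) w = ddz g w *s F w + g w *s dz F w"
    and dzbar_smult: "dzbar (\<lambda>x. g x *s F x) w = ddzbar g w *s F w + g w *s dzbar F w"
  unfolding atomize_conj
  by (rule wirtinger_vecI[OF bounded_bilinear.FDERIV[OF bilinear_smult
        has_derivative_wirtinger[OF assms(1)] has_derivative_wirtinger_vec[OF assms(2)]]];
      simp add: vec_eq_iff algebra_simps)

lemma
  assumes "f differentiable (at w)" "g differentiable (at w)"
  shows ddz_mult: "ddz (\<lambda>x. f x * g x) w = ddz f w * g w + f w * ddz g w"
    and ddzbar_mult: "ddzbar (\<lambda>x. f x * g x) w = ddzbar f w * g w + f w * ddzbar g w"
  unfolding atomize_conj
  by (rule wirtingerI[OF has_derivative_mult[OF assms[THEN has_derivative_wirtinger]]];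
      simp add: algebra_simps)

lemma
  fixes F :: "complex \<Rightarrow> complex^'m"
  assumes "F differentiable (at w)"
  shows dz_cnjv: "dz (\<lambda>x. cnjv (F x)) w = cnjv (dzbar F w)"
    and dzbar_cnjv: "dzbar (\<lambda>x. cnjv (F x)) w = cnjv (dz F w)"
  unfolding atomize_conj
  by (rule wirtinger_vecI[OF bounded_linear.has_derivative[OF linear_cnjv
        has_derivative_wirtinger_vec[OF assms]]];
      simp add: cnjv_def vec_eq_iff algebra_simps)

lemma
  assumes "g differentiable (at w)"
  shows ddz_cnj: "ddz (\<lambda>x. cnj (g x)) w = cnj (ddzbar g w)"
    and ddzbar_cnj: "ddzbar (\<lambda>x. cnj (g x)) w = cnj (ddz g w)"
  unfolding atomize_conj
  by (rule wirtingerI[OF bounded_linear.has_derivative[OF bounded_linear_cnj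
        has_derivative_wirtinger[OF assms]]];
      simp add: algebra_simps)

lemma
  fixes F :: "complex \<Rightarrow> complex^'m"
  assumes "(\<phi> has_field_derivative a) (at w)" "F differentiable (at (\<phi> w))"
  shows dz_compose: "dz (\<lambda>x. F (\<phi> x)) w = a *s dz F (\<phi> w)"
    and dzbar_compose: "dzbar (\<lambda>x. F (\<phi> x)) w = cnj a *s dzbar F (\<phi> w)"
  unfolding atomize_conj
  by (rule wirtinger_vecI[OF has_derivative_compose[OF
        assms(1)[unfolded has_field_derivative_def] has_derivative_wirtinger_vec[OF assms(2)]]];
      simp add: vec_eq_iff algebra_simps)

lemma
  assumes "(\<phi> has_field_derivative a) (at w)"
  shows ddz_holomorphic: "ddz \<phi> w = a" and ddzbar_holomorphic: "ddzbar \<phi> w = 0"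
  unfolding atomize_conj
  by (rule wirtingerI[OF assms[unfolded has_field_derivative_def]]; simp)

lemma Cinf_on_dz: "open S \<Longrightarrow> Cinf_on F S \<Longrightarrow> Cinf_on (dz F) S"
proof -
  assume a: "open S" "Cinf_on F S"
  have "Cinf_on (\<lambda>w. (1/2) *s (dx F w + (- \<i>) *s dy F w)) S"
    by (intro Cinf_on_linear[OF a(1) linear_smult] Cinf_on_add a Cinf_on_dx Cinf_on_dy)
  moreover have "dz F = (\<lambda>w. (1/2) *s (dx F w + (- \<i>) *s dy F w))"
    by (rule ext) (simp add: dz_def vec_eq_iff)
  ultimately show ?thesis by simp
qed

lemma Cinf_on_dzbar: "open S \<Longrightarrow> Cinf_on F S \<Longrightarrow> Cinf_on (dzbar F) S"
proof -
  assume a: "open S" "Cinf_on F S"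
  have "Cinf_on (\<lambda>w. (1/2) *s (dx F w + \<i> *s dy F w)) S"
    by (intro Cinf_on_linear[OF a(1) linear_smult] Cinf_on_add a Cinf_on_dx Cinf_on_dy)
  moreover have "dzbar F = (\<lambda>w. (1/2) *s (dx F w + \<i> *s dy F w))"
    by (rule ext) (simp add: dzbar_def)
  ultimately show ?thesis by simp
qed

lemma Cinf_on_smult:
  "open S \<Longrightarrow> Cinf_on g S \<Longrightarrow> Cinf_on F S \<Longrightarrow> Cinf_on (\<lambda>w. g w *s (F w :: complex^'m)) S"
  by (rule Cinf_on_bilinear[OF _ bilinear_smult])

lemma Cinf_on_mult:
  "open S \<Longrightarrow> Cinf_on f S \<Longrightarrow> Cinf_on g S \<Longrightarrow> Cinf_on (\<lambda>w. f w * (g w :: complex)) S"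
  by (rule Cinf_on_bilinear[OF _ bounded_bilinear_mult])

lemma Cinf_on_cnj: "open S \<Longrightarrow> Cinf_on g S \<Longrightarrow> Cinf_on (\<lambda>w. cnj (g w)) S"
  by (rule Cinf_on_linear[OF _ bounded_linear_cnj])

lemma Cinf_on_diff:
  assumes "open S" "Cinf_on F S" "Cinf_on G S"
  shows "Cinf_on (\<lambda>w. F w - G w) S"
  using Cinf_on_add[OF assms(1,2) Cinf_on_linear[OF assms(1) bounded_linear_minus[OF bounded_linear_ident] assms(3)]]
  by simp

text \<open>The cross terms in dx and dy cancel by symmetry of second derivatives, which leaves a
  quarter of the Laplacian in either order.\<close>

lemma dz_dzbar:
  assumes "open S" "Cinf_on F S" "w \<in> S"
  shows "dz (dzbar F) w = (1/4) *s (dx (dx F) w + dy (dy F) w)" (is ?l)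
    and "dzbar (dz F) w = (1/4) *s (dx (dx F) w + dy (dy F) w)" (is ?r)
proof -
  note diff = Cinf_on_differentiable[OF _ assms(1,3)]
  have D: "((\<lambda>w. (1/2) *s (dx F w + a *s dy F w)) has_derivative
     (\<lambda>h. (1/2) *s (frechet_derivative (dx F) (at w) h + a *s frechet_derivative (dy F) (at w) h))) (at w)" for a
    using diff[OF Cinf_on_dx[OF assms(2)]] diff[OF Cinf_on_dy[OF assms(2)]]
    by (intro bounded_linear.has_derivative[OF linear_smult] has_derivative_add)
      (auto simp: frechet_derivative_works[symmetric])
  have e: "dzbar F = (\<lambda>w. (1/2) *s (dx F w + \<i> *s dy F w))" "dz F = (\<lambda>w. (1/2) *s (dx F w + (-\<i>) *s dy F w))"
    by (auto simp: fun_eq_iff dzbar_def dz_def vec_eq_iff)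
  note c = dx_dy_commute[OF assms]
  show ?l
    unfolding dz_def[of "dzbar F"] unfolding e(1) unfolding dx_eq[OF D] dy_eq[OF D]
    unfolding dx_def[symmetric, of "dx F"] dx_def[symmetric, of "dy F"] dy_def[symmetric, of "dx F"] dy_def[symmetric, of "dy F"] c
    by (simp add: vec_eq_iff algebra_simps)
  show ?r
    unfolding dzbar_def[of "dz F"] unfolding e(2) unfolding dx_eq[OF D] dy_eq[OF D]
    unfolding dx_def[symmetric, of "dx F"] dx_def[symmetric, of "dy F"] dy_def[symmetric, of "dx F"] dy_def[symmetric, of "dy F"] c
    by (simp add: vec_eq_iff algebra_simps)
qed

lemma dzbar_dz:
  "open S \<Longrightarrow> Cinf_on F S \<Longrightarrow> w \<in> S \<Longrightarrow> dzbar (dz F) w = dz (dzbar F) w"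
  using dz_dzbar by metis


section \<open>Minkowski space and its complexification\<close>

lemma mink_commute: "mink v w = mink w v"
  by (simp add: mink_def mult.commute)

lemma mink_add_left: "mink (u + v) w = mink u w + mink v w"
  by (simp add: mink_def algebra_simps sum.distrib)

lemma mink_smult_left: "mink (a *s v) w = a * mink v w"
  by (simp add: mink_def algebra_simps sum_distrib_left)

lemma mink_diff_left: "mink (u - v) w = mink u w - mink v w"
  by (simp add: mink_def algebra_simps sum_subtractf)

lemma mink_minus_left: "mink (- v) w = - mink v w"
  by (simp add: mink_def algebra_simps sum_negf)

lemma mink_zero_left: "mink 0 w = 0"
  by (simp add: mink_def)

lemma mink_scaleR_left: "mink (r *\<^sub>R v) w = r * mink v (w :: real^('n::finite option))"
  by (simp add: mink_def algebra_simps sum_distrib_left)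

lemma mink_add_right: "mink w (u + v) = mink w u + mink w v"
  and mink_smult_right: "mink w (a *s v) = a * mink w v"
  and mink_diff_right: "mink w (u - v) = mink w u - mink w v"
  and mink_minus_right: "mink w (- v) = - mink w v"
  and mink_zero_right: "mink w 0 = 0"
  by (simp_all only: mink_commute[of w] mink_add_left mink_smult_left mink_diff_left mink_minus_left
      mink_zero_left)

lemma mink_scaleR_right: "mink w (r *\<^sub>R v) = r * mink w (v :: real^('n::finite option))"
  by (simp only: mink_commute[of w] mink_scaleR_left)

lemmas mink_simps = mink_add_left mink_smult_left mink_diff_left mink_minus_left mink_zero_left
  mink_add_right mink_smult_right mink_diff_right mink_minus_right mink_zero_right
  mink_scaleR_left mink_scaleR_right

lemma bilinear_mink: "bounded_bilinear (mink :: complex^('n::finite option) \<Rightarrow> _)"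
  unfolding bilinear_conv_bounded_bilinear[symmetric] bilinear_def
  by (auto intro!: linearI simp: mink_simps smult_scaleR[symmetric]) (simp_all add: scaleR_conv_of_real)

lemma bilinear_mink_real: "bounded_bilinear (mink :: real^('n::finite option) \<Rightarrow> _)"
  unfolding bilinear_conv_bounded_bilinear[symmetric] bilinear_def
  by (auto intro!: linearI simp: mink_simps)

lemma
  fixes F G :: "complex \<Rightarrow> complex^('n::finite option)"
  assumes "F differentiable (at w)" "G differentiable (at w)"
  shows ddz_mink: "ddz (\<lambda>x. mink (F x) (G x)) w = mink (dz F w) (G w) + mink (F w) (dz G w)"
    and ddzbar_mink: "ddzbar (\<lambda>x. mink (F x) (G x)) w = mink (dzbar F w) (G w) + mink (F w) (dzbar G w)"
  unfolding atomize_conj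
  by (rule wirtingerI[OF bounded_bilinear.FDERIV[OF bilinear_mink
        assms[THEN has_derivative_wirtinger_vec]]];
      simp add: mink_simps algebra_simps)

lemma Cinf_on_mink:
  "open S \<Longrightarrow> Cinf_on F S \<Longrightarrow> Cinf_on G S \<Longrightarrow>
     Cinf_on (\<lambda>w. mink (F w) (G w :: complex^('n::finite option))) S"
  by (rule Cinf_on_bilinear[OF _ bilinear_mink])

text \<open>Differentiating a constant product. This is how derivatives of frame vectors are tested
  against the frame.\<close>

lemma
  fixes F G :: "complex \<Rightarrow> complex^('n::finite option)"
  assumes "open S" "Cinf_on F S" "Cinf_on G S" "w \<in> S" "\<And>x. x \<in> S \<Longrightarrow> mink (F x) (G x) = c"
  shows dz_mink_const: "mink (dz F w) (G w) = - mink (F w) (dz G w)"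
    and dzbar_mink_const: "mink (dzbar F w) (G w) = - mink (F w) (dzbar G w)"
proof -
  note diff = Cinf_on_differentiable[OF _ assms(1,4)]
  have "ddz (\<lambda>x. mink (F x) (G x)) w = ddz (\<lambda>x. c) w" "ddzbar (\<lambda>x. mink (F x) (G x)) w = ddzbar (\<lambda>x. c) w"
    using ddz_cong[OF assms(1,4), of "\<lambda>x. mink (F x) (G x)" "\<lambda>x. c"]
      ddzbar_cong[OF assms(1,4), of "\<lambda>x. mink (F x) (G x)" "\<lambda>x. c"] assms(5) by auto
  then show "mink (dz F w) (G w) = - mink (F w) (dz G w)"
    and "mink (dzbar F w) (G w) = - mink (F w) (dzbar G w)"
    by (simp_all add: ddz_mink ddzbar_mink diff assms(2,3) eq_neg_iff_add_eq_0)
qed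

lemma cnjv_nth [simp]: "cnjv v $ i = cnj (v $ i)"
  by (simp add: cnjv_def)

lemma cvec_nth [simp]: "cvec v $ i = complex_of_real (v $ i)"
  by (simp add: cvec_def)

lemma cnjv_simps [simp]:
  "cnjv (u + v) = cnjv u + cnjv v" "cnjv (u - v) = cnjv u - cnjv v" "cnjv (a *s v) = cnj a *s cnjv v"
  "cnjv (cnjv v) = v" "cnjv 0 = 0" "cnjv (- v) = - cnjv v" "cnjv (cvec x) = cvec x"
  by (simp_all add: vec_eq_iff)

lemma cvec_simps:
  "cvec (x + y) = cvec x + cvec y" "cvec (x - y) = cvec x - cvec y"
  "cvec (r *\<^sub>R x) = complex_of_real r *s cvec x" "cvec 0 = 0" "cvec (- x) = - cvec x"
  by (simp_all add: vec_eq_iff)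

lemma cvec_inject [simp]: "cvec x = cvec y \<longleftrightarrow> x = y"
  by (simp add: vec_eq_iff)

lemma cvec_eq_0 [simp]: "cvec x = 0 \<longleftrightarrow> x = 0"
  by (simp add: vec_eq_iff)

lemma mink_cnjv: "mink (cnjv v) (cnjv w) = cnj (mink v w)"
  by (simp add: mink_def)

lemma mink_cnjv_left: "mink (cnjv v) w = cnj (mink v (cnjv w))"
  by (metis cnjv_simps(4) mink_cnjv)

lemma mink_cnjv_right: "mink u (cnjv v) = cnj (mink (cnjv u) v)"
  by (metis cnjv_simps(4) mink_cnjv)

lemma mink_cvec: "mink (cvec x) (cvec y) = complex_of_real (mink x y)"
  by (simp add: mink_def)

lemma real_vector_is_cvec: "cnjv v = v \<Longrightarrow> v = cvec (\<chi> i. Re (v $ i))"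
  by (auto simp: vec_eq_iff complex_eq_iff)

lemma mink_null_vec: "mink (null_vec x) (null_vec y) = x \<bullet> y - 1"
  by (simp add: mink_def null_vec_def inner_vec_def)

text \<open>Subtracting t times \<open>null_vec x\<close> from u, with t the time component of u,
  preserves the square and leaves a space-like vector or zero. In the second case u is a multiple of
  \<open>null_vec x\<close>, and orthogonality to \<open>null_vec y\<close> makes it vanish because
  the inner product of x and y is not 1.\<close>

lemma mink_orthogonal_null_vecs:
  fixes u :: "real^('n::finite option)"
  assumes "x \<in> sphere 0 1" "y \<in> sphere 0 1" "x \<noteq> y"
    and "mink u (null_vec x) = 0" "mink u (null_vec y) = 0"
  shows "mink u u \<ge> 0" "mink u u = 0 \<Longrightarrow> u = 0"
proof -
  define v :: "real^'n" where "v = (\<chi> j. u $ Some j)"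
  define t where "t = u $ None"
  have uu: "mink u u = v \<bullet> v - t\<^sup>2"
    by (simp add: mink_def v_def t_def inner_vec_def power2_eq_square)
  have vx: "v \<bullet> x = t" and vy: "v \<bullet> y = t"
    using assms(4,5) by (simp_all add: mink_def null_vec_def v_def t_def inner_vec_def)
  have xx: "x \<bullet> x = 1" "y \<bullet> y = 1" using assms(1,2) by (simp_all add: dot_square_norm)
  have "(v - t *\<^sub>R x) \<bullet> (v - t *\<^sub>R x) = v \<bullet> v - t\<^sup>2"
    using vx xx by (simp add: inner_diff inner_commute[of x v] power2_eq_square)
  then have uu': "mink u u = (v - t *\<^sub>R x) \<bullet> (v - t *\<^sub>R x)" using uu by simp
  then show "mink u u \<ge> 0" by simp
  assume "mink u u = 0"
  then have v: "v = t *\<^sub>R x" using uu' by simp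
  have "(x - y) \<bullet> (x - y) = 2 - 2 * (x \<bullet> y)" using xx by (simp add: inner_diff inner_commute[of y x])
  moreover have "(x - y) \<bullet> (x - y) \<noteq> 0" using assms(3) by simp
  ultimately have "x \<bullet> y \<noteq> 1" by linarith
  moreover have "t * (x \<bullet> y) = t" using vy v by simp
  ultimately have "t = 0" by simp
  with v have "v = 0" by simp
  show "u = 0"
  proof (simp only: vec_eq_iff, intro allI)
    fix i show "u $ i = 0 $ i"
      using \<open>t = 0\<close> \<open>v = 0\<close> by (cases i) (auto simp: t_def v_def vec_eq_iff)
  qed
qed

text \<open>The complexification of \<open>V_space\<close>, as \<open>complexified_V_space\<close>
  shows. Wirtinger derivatives as generators make V accessible to linear algebra over the complex
  numbers.\<close>

definition CV :: "(complex \<Rightarrow> complex^'m) \<Rightarrow> complex \<Rightarrow> (complex^'m) set" where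
  "CV Y w = vec.span {Y w, dz Y w, dzbar Y w, dz (dzbar Y) w}"

lemma CV_base: "Y w \<in> CV Y w" "dz Y w \<in> CV Y w" "dzbar Y w \<in> CV Y w" "dz (dzbar Y) w \<in> CV Y w"
  by (auto simp: CV_def intro: vec.span_base)

lemma CV_add: "u \<in> CV Y w \<Longrightarrow> v \<in> CV Y w \<Longrightarrow> u + v \<in> CV Y w"
  and CV_diff: "u \<in> CV Y w \<Longrightarrow> v \<in> CV Y w \<Longrightarrow> u - v \<in> CV Y w"
  and CV_smult: "v \<in> CV Y w \<Longrightarrow> a *s v \<in> CV Y w"
  by (auto simp: CV_def intro: vec.span_add vec.span_diff vec.span_scale)

lemma complexified_span: "complexified (span S) = vec.span (cvec ` S)"
proof
  have *: "cvec a \<in> vec.span (cvec ` S)" if "a \<in> span S" for a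
    using that
  proof (induction rule: span_induct_alt)
    case base
    then show ?case by (simp add: cvec_simps vec.span_zero)
  next
    case (step c x y)
    then show ?case
      by (simp add: cvec_simps vec.span_add vec.span_scale vec.span_base)
  qed
  then show "complexified (span S) \<subseteq> vec.span (cvec ` S)"
    by (auto simp: complexified_def intro: vec.span_add vec.span_scale)
  have "vec.subspace (complexified (span S))"
  proof (rule vec.subspaceI)
    show "0 \<in> complexified (span S)"
      unfolding complexified_def by (auto intro!: exI[of _ 0] span_zero simp: cvec_simps)
    fix x y assume "x \<in> complexified (span S)" "y \<in> complexified (span S)"
    then obtain a b a' b' where x: "x = cvec a + \<i> *s cvec b" "a \<in> span S" "b \<in> span S"
      and y: "y = cvec a' + \<i> *s cvec b'" "a' \<in> span S" "b' \<in> span S"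
      by (auto simp: complexified_def)
    have "x + y = cvec (a + a') + \<i> *s cvec (b + b')"
      using x y by (simp add: cvec_simps vec_eq_iff algebra_simps)
    then show "x + y \<in> complexified (span S)"
      unfolding complexified_def using x y span_add by blast
  next
    fix c x assume "x \<in> complexified (span S)"
    then obtain a b where x: "x = cvec a + \<i> *s cvec b" "a \<in> span S" "b \<in> span S"
      by (auto simp: complexified_def)
    have "c *s x = cvec (Re c *\<^sub>R a - Im c *\<^sub>R b) + \<i> *s cvec (Im c *\<^sub>R a + Re c *\<^sub>R b)"
      unfolding x by (simp add: vec_eq_iff complex_eq_iff algebra_simps)
    then show "c *s x \<in> complexified (span S)"
      unfolding complexified_def using x by (blast intro: span_add span_diff span_scale)
  qed
  moreover have "cvec ` S \<subseteq> complexified (span S)"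
  proof
    fix y assume "y \<in> cvec ` S"
    then obtain x where "x \<in> S" "y = cvec x + \<i> *s cvec 0" by (auto simp: cvec_simps)
    then show "y \<in> complexified (span S)"
      unfolding complexified_def using span_base span_zero by blast
  qed
  ultimately show "vec.span (cvec ` S) \<subseteq> complexified (span S)" by (rule vec.span_minimal[rotated])
qed

lemma cvec_in_complexified_span: "cvec u \<in> complexified (span S) \<longleftrightarrow> u \<in> span S"
proof
  assume "cvec u \<in> complexified (span S)"
  then obtain a b where ab: "cvec u = cvec a + \<i> *s cvec b" "a \<in> span S" by (auto simp: complexified_def)
  then have "u = a" by (auto simp: vec_eq_iff complex_eq_iff)
  with ab show "u \<in> span S" by simp
next
  assume "u \<in> span S"
  moreover have "cvec u = cvec u + \<i> *s cvec 0" by (simp add: cvec_simps)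
  ultimately show "cvec u \<in> complexified (span S)" unfolding complexified_def using span_zero by blast
qed

lemma Cinf_on_cvec: "open S \<Longrightarrow> Cinf_on Y S \<Longrightarrow> Cinf_on (cvec \<circ> Y) S"
  unfolding comp_def by (rule Cinf_on_linear[OF _ linear_cvec])

lemma
  fixes Y :: "complex \<Rightarrow> real^'m"
  assumes "Y differentiable (at w)"
  shows cvec_dx: "cvec (dx Y w) = dz (cvec \<circ> Y) w + dzbar (cvec \<circ> Y) w"
    and cvec_dy: "cvec (dy Y w) = \<i> *s dz (cvec \<circ> Y) w - \<i> *s dzbar (cvec \<circ> Y) w"
  unfolding dz_def dzbar_def comp_def
  by (simp_all only: dx_linear[OF linear_cvec assms] dy_linear[OF linear_cvec assms])
    (simp_all add: vec_eq_iff algebra_simps)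

lemma cvec_laplacian:
  fixes Y :: "complex \<Rightarrow> real^'m"
  assumes "open S" "Cinf_on Y S" "w \<in> S"
  shows "cvec ((1/4) *\<^sub>R (dx (dx Y) w + dy (dy Y) w)) = dz (dzbar (cvec \<circ> Y)) w"
proof -
  note diff = Cinf_on_differentiable[OF _ assms(1)]
  have "dx (dx (cvec \<circ> Y)) w = dx (\<lambda>x. cvec (dx Y x)) w"
    by (rule dx_cong[OF assms(1,3)]) (simp only: comp_def dx_linear[OF linear_cvec diff[OF assms(2)]])
  also have "\<dots> = cvec (dx (dx Y) w)"
    by (rule dx_linear[OF linear_cvec diff[OF Cinf_on_dx[OF assms(2)] assms(3)]])
  finally have x: "dx (dx (cvec \<circ> Y)) w = cvec (dx (dx Y) w)" .
  have "dy (dy (cvec \<circ> Y)) w = dy (\<lambda>x. cvec (dy Y x)) w"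
    by (rule dy_cong[OF assms(1,3)]) (simp only: comp_def dy_linear[OF linear_cvec diff[OF assms(2)]])
  also have "\<dots> = cvec (dy (dy Y) w)"
    by (rule dy_linear[OF linear_cvec diff[OF Cinf_on_dy[OF assms(2)] assms(3)]])
  finally have y: "dy (dy (cvec \<circ> Y)) w = cvec (dy (dy Y) w)" .
  show ?thesis
    unfolding dz_dzbar(1)[OF assms(1) Cinf_on_cvec[OF assms(1,2)] assms(3)] x y
    by (simp add: vec_eq_iff)
qed

text \<open>With p and q the two Wirtinger derivatives, the middle vectors on the left are the
  partial derivatives along 1 and \<i>; the change between the two pairs is invertible.\<close>

lemma span_real_frame:
  fixes y p q n :: "complex^'m"
  shows "vec.span {y, p + q, \<i> *s p - \<i> *s q, n} = vec.span {y, p, q, n}" (is "vec.span ?S = vec.span ?T")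
proof
  have "p + q \<in> vec.span ?T" "\<i> *s p - \<i> *s q \<in> vec.span ?T"
    by (intro vec.span_add vec.span_diff vec.span_scale vec.span_base; simp)+
  then show "vec.span ?S \<subseteq> vec.span ?T"
    by (intro vec.span_minimal vec.subspace_span) (auto intro: vec.span_base)
  have "(1/2) *s (p + q) - (\<i>/2) *s (\<i> *s p - \<i> *s q) \<in> vec.span ?S"
    by (intro vec.span_diff vec.span_scale vec.span_base; simp)
  moreover have "(1/2) *s (p + q) - (\<i>/2) *s (\<i> *s p - \<i> *s q) = p"
    by (simp add: vec_eq_iff algebra_simps)
  moreover have "(1/2) *s (p + q) + (\<i>/2) *s (\<i> *s p - \<i> *s q) \<in> vec.span ?S"
    by (intro vec.span_add vec.span_scale vec.span_base; simp)
  moreover have "(1/2) *s (p + q) + (\<i>/2) *s (\<i> *s p - \<i> *s q) = q"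
    by (simp add: vec_eq_iff algebra_simps)
  ultimately show "vec.span ?T \<subseteq> vec.span ?S"
    by (intro vec.span_minimal vec.subspace_span) (auto intro: vec.span_base)
qed

lemma complexified_V_space:
  fixes Y :: "complex \<Rightarrow> real^('n::finite option)"
  assumes "open S" "Cinf_on Y S" "w \<in> S"
  shows "complexified (V_space Y w) = CV (cvec \<circ> Y) w"
proof -
  note diff = Cinf_on_differentiable[OF assms(2,1,3)]
  let ?S = "{(cvec \<circ> Y) w, dz (cvec \<circ> Y) w + dzbar (cvec \<circ> Y) w,
       \<i> *s dz (cvec \<circ> Y) w - \<i> *s dzbar (cvec \<circ> Y) w, dz (dzbar (cvec \<circ> Y)) w}"
  have "complexified (V_space Y w) = vec.span ?S"
    unfolding V_space_def complexified_span
    by (simp only: image_insert image_empty cvec_dx[OF diff] cvec_dy[OF diff] cvec_laplacian[OF assms] comp_apply)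
  also have "\<dots> = CV (cvec \<circ> Y) w"
    unfolding CV_def by (rule span_real_frame)
  finally show ?thesis .
qed

lemma V_space_iff:
  fixes Y :: "complex \<Rightarrow> real^('n::finite option)"
  assumes "open S" "Cinf_on Y S" "w \<in> S"
  shows "u \<in> V_space Y w \<longleftrightarrow> cvec u \<in> CV (cvec \<circ> Y) w"
  using complexified_V_space[OF assms] cvec_in_complexified_span unfolding V_space_def by metis

lemma complex_perp_V_space:
  fixes Y :: "complex \<Rightarrow> real^('n::finite option)"
  assumes "open S" "Cinf_on Y S" "w \<in> S"
  shows "complex_perp (V_space Y w) = {\<eta>. \<forall>v\<in>CV (cvec \<circ> Y) w. mink \<eta> v = 0}"
proof -
  have "(\<forall>a\<in>V_space Y w. mink \<eta> (cvec a) = 0) \<longleftrightarrow> (\<forall>v\<in>complexified (V_space Y w). mink \<eta> v = 0)" for \<eta>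
  proof
    assume "\<forall>a\<in>V_space Y w. mink \<eta> (cvec a) = 0"
    then show "\<forall>v\<in>complexified (V_space Y w). mink \<eta> v = 0"
      by (auto simp: complexified_def mink_simps)
  next
    assume r: "\<forall>v\<in>complexified (V_space Y w). mink \<eta> v = 0"
    show "\<forall>a\<in>V_space Y w. mink \<eta> (cvec a) = 0"
      using r V_space_iff[OF assms] complexified_V_space[OF assms] by blast
  qed
  then show ?thesis by (simp add: complex_perp_def complexified_V_space[OF assms])
qed

lemma mink_orthogonal_span:
  assumes "\<And>s. s \<in> S \<Longrightarrow> mink u s = 0" "v \<in> vec.span S"
  shows "mink u v = 0"
  using assms(2)
proof (induction rule: vec.span_induct_alt)
  case base
  then show ?case by (simp add: mink_simps)
next
  case (step c x y)
  then show ?case by (simp add: mink_simps assms(1))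
qed


section \<open>The moving frame of a surface with a second envelope\<close>

text \<open>The lifts are complex vector functions fixed by conjugation, so that the frame equations
  can be complex. By \<open>conf\<close> the metric induced by \<open>Yh\<close> is 2 <Yh_z,
  Yh_zbar> |dz|^2, and \<open>imm\<close> says that it does not vanish.\<close>

locale envelope_frame =
  fixes S :: "complex set" and Y Yh :: "complex \<Rightarrow> complex^('n::finite option)"
  assumes op: "open S" and smooth_Y: "Cinf_on Y S" and smooth_Yh: "Cinf_on Yh S"
    and realY: "w \<in> S \<Longrightarrow> cnjv (Y w) = Y w" and realYh: "w \<in> S \<Longrightarrow> cnjv (Yh w) = Yh w"
    and YY: "w \<in> S \<Longrightarrow> mink (Y w) (Y w) = 0"
    and YhYh: "w \<in> S \<Longrightarrow> mink (Yh w) (Yh w) = 0"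
    and YYh: "w \<in> S \<Longrightarrow> mink (Y w) (Yh w) = -1"
    and YzYz: "w \<in> S \<Longrightarrow> mink (dz Y w) (dz Y w) = 0"
    and YzYzbar: "w \<in> S \<Longrightarrow> mink (dz Y w) (dzbar Y w) = 1/2"
    and YhV: "w \<in> S \<Longrightarrow> Yh w \<in> CV Y w" and YhzV: "w \<in> S \<Longrightarrow> dz Yh w \<in> CV Y w"
    and conf: "w \<in> S \<Longrightarrow> mink (dz Yh w) (dz Yh w) = 0"
    and imm: "w \<in> S \<Longrightarrow> mink (dz Yh w) (dzbar Yh w) \<noteq> 0"
begin

text \<open>A multiple of the isotropic \<open>Y\<close> can be added to \<open>dz Y\<close> without
  changing the products among \<open>Y\<close>, \<open>P\<close> and \<open>Pb\<close>; this one
  makes \<open>P\<close> orthogonal to \<open>Yh\<close> as well.\<close>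

definition "\<mu> w = 2 * mink (Yh w) (dz Y w)"
definition "P w = dz Y w + (\<mu> w / 2) *s Y w"
definition "Pb w = dzbar Y w + (cnj (\<mu> w) / 2) *s Y w"
text \<open>As <P, Pb> = 1/2, twice the products with \<open>P\<close> and \<open>Pb\<close> are the
  coefficients of \<open>Pb\<close> and \<open>P\<close>.\<close>

definition "\<theta> w = 2 * mink (P w) (dz Yh w)"
definition "\<rho> w = 2 * mink (Pb w) (dz Yh w)"
text \<open>The normal part of \<open>dz P\<close>, written so that it is visibly smooth;
  \<open>Yzz\<close> identifies it with the Hopf differential.\<close>

definition "\<kappa> w = dz P w - (\<theta> w / 2) *s Y w - (\<mu> w / 2) *s P w"

lemma half_mult: "(\<lambda>w. g w / 2) = (\<lambda>w. (1/2) * (g w :: complex))"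
  by simp

lemma Cinf_on_half: "Cinf_on g S \<Longrightarrow> Cinf_on (\<lambda>w. g w / (2::complex)) S"
  unfolding half_mult by (intro Cinf_on_mult[OF op] Cinf_on_const)

lemma smooth_Yz: "Cinf_on (dz Y) S" and smooth_Yzb: "Cinf_on (dzbar Y) S"
  and smooth_Yhz: "Cinf_on (dz Yh) S" and smooth_Yhzb: "Cinf_on (dzbar Yh) S"
  by (intro Cinf_on_dz Cinf_on_dzbar op smooth_Y smooth_Yh)+

lemma smooth_\<mu>: "Cinf_on \<mu> S"
  unfolding \<mu>_def [abs_def] by (intro Cinf_on_mult[OF op] Cinf_on_const Cinf_on_mink[OF op] smooth_Yz smooth_Yh)

lemma smooth_P: "Cinf_on P S"
  unfolding P_def [abs_def]
  by (intro Cinf_on_add[OF op] Cinf_on_smult[OF op] Cinf_on_half smooth_\<mu> smooth_Y smooth_Yz)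

lemma smooth_Pb: "Cinf_on Pb S"
  unfolding Pb_def [abs_def]
  by (intro Cinf_on_add[OF op] Cinf_on_smult[OF op] Cinf_on_half Cinf_on_cnj[OF op] smooth_\<mu> smooth_Y smooth_Yzb)

lemma smooth_\<theta>: "Cinf_on \<theta> S"
  unfolding \<theta>_def [abs_def] by (intro Cinf_on_mult[OF op] Cinf_on_const Cinf_on_mink[OF op] smooth_P smooth_Yhz)

lemma smooth_\<rho>: "Cinf_on \<rho> S"
  unfolding \<rho>_def [abs_def] by (intro Cinf_on_mult[OF op] Cinf_on_const Cinf_on_mink[OF op] smooth_Pb smooth_Yhz)

lemma smooth_\<kappa>: "Cinf_on \<kappa> S"
  unfolding \<kappa>_def [abs_def]
  by (intro Cinf_on_diff[OF op] Cinf_on_smult[OF op] Cinf_on_half Cinf_on_dz[OF op] smooth_\<mu> smooth_\<theta> smooth_Y smooth_P)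

lemmas smooth = smooth_Y smooth_Yh smooth_Yz smooth_Yzb smooth_Yhz smooth_Yhzb smooth_\<mu> smooth_P smooth_Pb smooth_\<theta> smooth_\<rho> smooth_\<kappa>

lemma diff: "Cinf_on F S \<Longrightarrow> w \<in> S \<Longrightarrow> F differentiable (at w)"
  using Cinf_on_differentiable op by blast

lemma nonzero_nearby:
  fixes F :: "complex \<Rightarrow> 'b::real_normed_vector"
  assumes "Cinf_on F S" "w \<in> S" "F w \<noteq> 0"
  shows "\<exists>\<delta>>0. ball w \<delta> \<subseteq> S \<and> (\<forall>x\<in>ball w \<delta>. F x \<noteq> 0)"
proof -
  have "continuous (at w) F"
    using diff[OF assms(1,2)] differentiable_imp_continuous_within by blast
  then obtain d where "d > 0" "\<And>x. dist w x < d \<Longrightarrow> F x \<noteq> 0"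
    using continuous_at_avoid[of w F 0] assms(3) by blast
  moreover obtain e where "e > 0" "ball w e \<subseteq> S" using op assms(2) open_contains_ball by blast
  ultimately show ?thesis by (intro exI[of _ "min d e"]) auto
qed

lemma dzbar_real:
  assumes "Cinf_on F S" "w \<in> S" "\<And>w. w \<in> S \<Longrightarrow> cnjv (F w) = F w"
  shows "dzbar F w = cnjv (dz F w)"
proof -
  have "dzbar F w = dzbar (\<lambda>x. cnjv (F x)) w"
    by (rule dzbar_cong[OF op assms(2)]) (simp add: assms(3))
  also have "\<dots> = cnjv (dz F w)" by (rule dzbar_cnjv[OF diff[OF assms(1,2)]])
  finally show ?thesis .
qed

lemma YYz_at: "w \<in> S \<Longrightarrow> mink (Y w) (dz Y w) = 0"
  using dz_mink_const[OF op smooth_Y smooth_Y _ YY] mink_commute[of "Y w" "dz Y w"] by auto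

lemma YYzb_at: "w \<in> S \<Longrightarrow> mink (Y w) (dzbar Y w) = 0"
  using dzbar_mink_const[OF op smooth_Y smooth_Y _ YY] mink_commute[of "Y w" "dzbar Y w"] by auto

lemma YzbYzb_at: "w \<in> S \<Longrightarrow> mink (dzbar Y w) (dzbar Y w) = 0"
  by (simp add: dzbar_real[OF smooth_Y _ realY] mink_cnjv YzYz)

context
  fixes w assumes w: "w \<in> S"
begin

lemma Yzb: "dzbar Y w = cnjv (dz Y w)" by (rule dzbar_real[OF smooth_Y w realY])
lemma Yhzb: "dzbar Yh w = cnjv (dz Yh w)" by (rule dzbar_real[OF smooth_Yh w realYh])

lemma cnjv_P: "cnjv (P w) = Pb w"
  by (simp add: P_def Pb_def Yzb realY[OF w])

lemma cnjv_Pb: "cnjv (Pb w) = P w"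
  by (simp flip: cnjv_P)

lemmas YYz = YYz_at[OF w] and YYzb = YYzb_at[OF w]
lemmas YYz' = YYz[THEN trans[OF mink_commute]] YYzb[THEN trans[OF mink_commute]]

lemma table0:
  "mink (Y w) (Y w) = 0" "mink (Y w) (P w) = 0" "mink (Y w) (Pb w) = 0" "mink (Y w) (Yh w) = -1"
  "mink (P w) (P w) = 0" "mink (P w) (Pb w) = 1/2" "mink (P w) (Yh w) = 0" "mink (Pb w) (Pb w) = 0"
  "mink (Pb w) (Yh w) = 0" "mink (Yh w) (Yh w) = 0"
proof -
  show "mink (Y w) (P w) = 0" and "mink (Y w) (Pb w) = 0"
    by (simp_all add: P_def Pb_def mink_simps YY[OF w] YYz YYzb)
  show "mink (P w) (P w) = 0" "mink (P w) (Pb w) = 1/2"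
    by (simp_all add: P_def Pb_def mink_simps YY[OF w] YzYz[OF w] YzYzbar[OF w] YYz YYzb YYz')
  then show "mink (Pb w) (Pb w) = 0" by (metis cnjv_P complex_cnj_zero mink_cnjv)
  show "mink (P w) (Yh w) = 0"
    by (simp add: P_def mink_simps YYh[OF w] \<mu>_def mink_commute)
  then show "mink (Pb w) (Yh w) = 0" by (metis cnjv_P complex_cnj_zero mink_cnjv realYh[OF w])
qed (simp_all add: YY YYh YhYh w)

lemmas table = table0 table0[THEN trans[OF mink_commute]]

lemma \<mu>_alt: "mink (Yh w) (dz Y w) = \<mu> w / 2" "mink (dz Y w) (Yh w) = \<mu> w / 2"
  "mink (dz Yh w) (Y w) = - (\<mu> w / 2)" "mink (Y w) (dz Yh w) = - (\<mu> w / 2)"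
  using dz_mink_const[OF op smooth_Y smooth_Yh w YYh] mink_commute[of "Y w" "dz Yh w"] mink_commute[of "dz Y w" "Yh w"]
  by (auto simp: \<mu>_def)

lemma Yz_P: "dz Y w = P w - (\<mu> w / 2) *s Y w" and Yzb_Pb: "dzbar Y w = Pb w - (cnj (\<mu> w) / 2) *s Y w"
  by (simp_all add: P_def Pb_def)

lemma Yzzb_inner:
  "mink (dz (dzbar Y) w) (Y w) = - 1/2" "mink (dz (dzbar Y) w) (dzbar Y w) = 0"
  "mink (dz (dzbar Y) w) (dz Y w) = 0"
proof -
  have "mink (dz (dzbar Y) w) (Y w) = - mink (dzbar Y w) (dz Y w)"
    by (rule dz_mink_const[OF op smooth_Yzb smooth_Y w, where c=0]) (rule trans[OF mink_commute YYzb_at])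
  then show "mink (dz (dzbar Y) w) (Y w) = - 1/2"
    using YzYzbar[OF w] by (simp add: mink_commute)
  have "mink (dz (dzbar Y) w) (dzbar Y w) = - mink (dzbar Y w) (dz (dzbar Y) w)"
    by (rule dz_mink_const[OF op smooth_Yzb smooth_Yzb w YzbYzb_at])
  then show "mink (dz (dzbar Y) w) (dzbar Y w) = 0"
    by (simp add: mink_commute[of "dzbar Y w"])
  have "mink (dzbar (dz Y) w) (dz Y w) = - mink (dz Y w) (dzbar (dz Y) w)"
    by (rule dzbar_mink_const[OF op smooth_Yz smooth_Yz w YzYz])
  then show "mink (dz (dzbar Y) w) (dz Y w) = 0"
    by (simp add: mink_commute[of "dz Y w"] dzbar_dz[OF op smooth_Y w])
qed

text \<open>The only question is whether the mixed derivative of \<open>Y\<close> lies in the span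
  on the right. Pairing \<open>Yh\<close> with \<open>Y\<close> shows that \<open>Yh\<close>
  contains this derivative with coefficient 2, so the expansion of \<open>Yh\<close> can be solved
  for it.\<close>

lemma CV_frame: "CV Y w = vec.span {Y w, P w, Pb w, Yh w}" (is "_ = vec.span ?F")
proof
  show "vec.span ?F \<subseteq> CV Y w"
    unfolding CV_def
    by (intro vec.span_minimal vec.subspace_span)
      (auto simp: CV_def[symmetric] P_def Pb_def intro!: CV_base CV_add CV_smult YhV[OF w])
  have z: "dz Y w \<in> vec.span ?F" "dzbar Y w \<in> vec.span ?F"
    unfolding Yz_P Yzb_Pb by (intro vec.span_diff vec.span_scale vec.span_base; simp)+
  obtain a b c e where e: "Yh w = a *s Y w + b *s dz Y w + c *s dzbar Y w + e *s dz (dzbar Y) w"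
  proof -
    have "\<exists>a b c e. Yh w = a *s Y w + (b *s dz Y w + (c *s dzbar Y w + e *s dz (dzbar Y) w))"
      using YhV[OF w] unfolding CV_def vec.span_insert vec.span_empty
      by (auto simp: algebra_simps)
    then show ?thesis using that by (metis add.assoc)
  qed
  have "-1 = mink (Yh w) (Y w)" using YYh[OF w] by (simp add: mink_commute)
  also have "\<dots> = - e / 2"
    unfolding e by (simp add: mink_simps table Yzzb_inner YYz')
  finally have [simp]: "e = 2" by simp
  have "dz (dzbar Y) w = (1/2) *s Yh w - (a/2) *s Y w - (b/2) *s dz Y w - (c/2) *s dzbar Y w"
    unfolding e by (simp add: vec_eq_iff field_simps)
  also have "\<dots> \<in> vec.span ?F"
    by (intro vec.span_diff vec.span_scale z) (auto intro: vec.span_base)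
  finally show "CV Y w \<subseteq> vec.span ?F"
    unfolding CV_def using z by (intro vec.span_minimal vec.subspace_span) (auto intro: vec.span_base)
qed

lemma frame_in_CV: "Y w \<in> CV Y w" "P w \<in> CV Y w" "Pb w \<in> CV Y w" "Yh w \<in> CV Y w"
  unfolding CV_frame by (auto intro: vec.span_base)

text \<open>In this null frame the dual basis of \<open>Y\<close>, \<open>Yh\<close>,
  \<open>P\<close>, \<open>Pb\<close> is \<open>- Yh\<close>, \<open>- Y\<close>,
  \<open>2 Pb\<close>, \<open>2 P\<close>.\<close>

lemma expansion:
  assumes "v \<in> CV Y w"
  shows "v = (- mink v (Yh w)) *s Y w + (- mink v (Y w)) *s Yh w
    + (2 * mink v (Pb w)) *s P w + (2 * mink v (P w)) *s Pb w"
proof -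
  have "\<exists>a b c e. v = a *s Y w + (b *s P w + (c *s Pb w + e *s Yh w))"
    using assms unfolding CV_frame vec.span_insert vec.span_empty by (auto simp: algebra_simps)
  then obtain a b c e where v: "v = a *s Y w + (b *s P w + (c *s Pb w + e *s Yh w))" by blast
  have m: "mink v (Yh w) = - a" "mink v (Y w) = - e" "mink v (Pb w) = b/2" "mink v (P w) = c/2"
    unfolding v by (simp_all add: mink_simps table)
  show ?thesis unfolding m by (simp add: v vec_eq_iff)
qed

lemma orthogonal_CV:
  assumes "mink u (Y w) = 0" "mink u (P w) = 0" "mink u (Pb w) = 0" "mink u (Yh w) = 0" "v \<in> CV Y w"
  shows "mink u v = 0" "mink v u = 0"
proof -
  show "mink u v = 0"
    by (rule mink_orthogonal_span[of "{Y w, P w, Pb w, Yh w}"]) (use assms CV_frame in auto)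
  then show "mink v u = 0" by (simp add: mink_commute)
qed

text \<open>V is nondegenerate: all coefficients in \<open>expansion\<close> are products with
  elements of V.\<close>

lemma CV_orthogonal_zero:
  assumes "v \<in> CV Y w" "\<And>u. u \<in> CV Y w \<Longrightarrow> mink v u = 0"
  shows "v = 0"
  using expansion[OF assms(1)] assms(2)[OF frame_in_CV(1)] assms(2)[OF frame_in_CV(2)]
    assms(2)[OF frame_in_CV(3)] assms(2)[OF frame_in_CV(4)] by simp

text \<open>Since \<open>Yh\<close> stays isotropic there is no component along \<open>Y\<close>;
  the component along \<open>Yh\<close> comes from differentiating <Y, Yh> = -1.\<close>

lemma Yhz: "dz Yh w = (\<mu> w / 2) *s Yh w + \<rho> w *s P w + \<theta> w *s Pb w"
proof -
  have "mink (dz Yh w) (Yh w) = 0"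
    using dz_mink_const[OF op smooth_Yh smooth_Yh w YhYh] mink_commute[of "Yh w" "dz Yh w"] by auto
  then show ?thesis
    using expansion[OF YhzV[OF w]]
    by (simp add: \<mu>_alt \<theta>_def \<rho>_def mink_commute)
qed

lemma Yhzb': "dzbar Yh w = (cnj (\<mu> w) / 2) *s Yh w + cnj (\<rho> w) *s Pb w + cnj (\<theta> w) *s P w"
  unfolding Yhzb Yhz by (simp add: realYh[OF w] cnjv_P cnjv_Pb)

lemma \<theta>\<rho>: "\<theta> w * \<rho> w = 0" and \<theta>\<rho>_nonzero: "\<theta> w \<noteq> 0 \<or> \<rho> w \<noteq> 0"
proof -
  have "mink (dz Yh w) (dz Yh w) = \<theta> w * \<rho> w"
    unfolding Yhz by (simp add: mink_simps table field_simps)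
  then show "\<theta> w * \<rho> w = 0" using conf[OF w] by simp
  show "\<theta> w \<noteq> 0 \<or> \<rho> w \<noteq> 0"
  proof (rule ccontr)
    assume "\<not> (\<theta> w \<noteq> 0 \<or> \<rho> w \<noteq> 0)"
    then have "mink (dz Yh w) (dzbar Yh w) = 0"
      unfolding Yhz Yhzb' by (simp add: mink_simps table)
    with imm[OF w] show False by simp
  qed
qed

lemma d_const:
  assumes "Cinf_on F S" "Cinf_on G S" "\<And>w. w \<in> S \<Longrightarrow> mink (F w) (G w) = c"
  shows "mink (dz F w) (G w) = - mink (F w) (dz G w)" "mink (dzbar F w) (G w) = - mink (F w) (dzbar G w)"
  using dz_mink_const[OF op assms(1,2) w assms(3)] dzbar_mink_const[OF op assms(1,2) w assms(3)] by auto

end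

section \<open>Structure equations of the frame and the Codazzi equation\<close>

lemma Pzb:
  assumes w: "w \<in> S"
  shows "dzbar P w = (cnj (\<rho> w) / 2) *s Y w + (1/2) *s Yh w - (cnj (\<mu> w) / 2) *s P w"
proof -
  note [simp] = mink_simps table[OF w] Yzzb_inner[OF w]
  have e: "dzbar P w = dz (dzbar Y) w + (ddzbar (\<lambda>w. \<mu> w / 2) w *s Y w + (\<mu> w / 2) *s dzbar Y w)"
    unfolding P_def [abs_def]
    by (simp add: dzbar_add dzbar_smult differentiable_smult diff[OF _ w] Cinf_on_half smooth dzbar_dz[OF op smooth_Y w])
  \<comment> \<open>There is no normal component, because \<open>P\<close> differs from
    \<open>dz Y\<close> by a multiple of \<open>Y\<close> and the mixed derivative of
    \<open>Y\<close> spans part of V.\<close>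
  have V: "dzbar P w \<in> CV Y w"
    unfolding e by (intro CV_add CV_smult CV_base)
  have Yzbi: "mink (dzbar Y w) (Y w) = 0" "mink (dzbar Y w) (P w) = 1/2" "mink (dzbar Y w) (Pb w) = 0"
    unfolding Yzb_Pb[OF w] by simp_all
  have 1: "mink (dzbar P w) (Y w) = - 1/2" unfolding e by (simp add: Yzbi)
  have 2: "mink (dzbar P w) (P w) = 0"
    using d_const(2)[OF w smooth_P smooth_P table(5)] mink_commute[of "P w" "dzbar P w"] by auto
  have "mink (dz (dzbar Y) w) (Pb w) = - (cnj (\<mu> w) / 4)"
    unfolding Pb_def by simp
  then have 3: "mink (dzbar P w) (Pb w) = - (cnj (\<mu> w) / 4)" unfolding e by (simp add: Yzbi)
  have "mink (dzbar P w) (Yh w) = - mink (P w) (dzbar Yh w)" by (rule d_const(2)[OF w smooth_P smooth_Yh table(7)])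
  also have "mink (P w) (dzbar Yh w) = cnj (mink (Pb w) (dz Yh w))"
    by (simp add: Yhzb[OF w] mink_cnjv_right cnjv_P[OF w])
  finally have 4: "mink (dzbar P w) (Yh w) = - (cnj (\<rho> w) / 2)" by (simp add: \<rho>_def)
  show ?thesis
    using expansion[OF w V] unfolding 1 2 3 4 by (simp add: vec_eq_iff)
qed

lemma Pbz:
  assumes w: "w \<in> S"
  shows "dz Pb w = cnjv (dzbar P w)"
proof -
  have "dz Pb w = dz (\<lambda>x. cnjv (P x)) w" by (rule dz_cong[OF op w]) (simp add: cnjv_P)
  then show ?thesis using dz_cnjv[OF diff[OF smooth_P w]] by simp
qed

lemma Pbzb:
  assumes w: "w \<in> S"
  shows "dzbar Pb w = cnjv (dz P w)"
proof -
  have "dzbar Pb w = dzbar (\<lambda>x. cnjv (P x)) w" by (rule dzbar_cong[OF op w]) (simp add: cnjv_P)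
  then show ?thesis using dzbar_cnjv[OF diff[OF smooth_P w]] by simp
qed

lemma Pz: "dz P w = \<kappa> w + (\<mu> w / 2) *s P w + (\<theta> w / 2) *s Y w"
  by (simp add: \<kappa>_def)

text \<open>The products of \<open>dz P\<close> with the frame, found by differentiating the table,
  show that the terms subtracted in \<open>\<kappa>\<close> are exactly the components of
  \<open>dz P\<close> in V.\<close>

lemma \<kappa>_orthogonal:
  assumes w: "w \<in> S"
  shows "mink (\<kappa> w) (Y w) = 0" "mink (\<kappa> w) (P w) = 0" "mink (\<kappa> w) (Pb w) = 0" "mink (\<kappa> w) (Yh w) = 0"
proof -
  note [simp] = mink_simps table[OF w]
  have "mink (dz P w) (Y w) = - mink (P w) (dz Y w)"
    by (rule d_const(1)[OF w smooth_P smooth_Y trans[OF mink_commute table0(2)]])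
  then have 1: "mink (dz P w) (Y w) = 0" by (simp add: Yz_P[OF w])
  have 2: "mink (dz P w) (P w) = 0"
    using d_const(1)[OF w smooth_P smooth_P table(5)] mink_commute[of "P w" "dz P w"] by auto
  have "mink (dz P w) (Pb w) = - mink (P w) (dz Pb w)"
    by (rule d_const(1)[OF w smooth_P smooth_Pb table(6)])
  then have 3: "mink (dz P w) (Pb w) = \<mu> w / 4"
    by (simp add: Pbz[OF w] Pzb[OF w] cnjv_P[OF w] realY[OF w] realYh[OF w])
  have 4: "mink (dz P w) (Yh w) = - (\<theta> w / 2)"
    using d_const(1)[OF w smooth_P smooth_Yh table(7)] by (simp add: \<theta>_def)
  show "mink (\<kappa> w) (Y w) = 0" "mink (\<kappa> w) (P w) = 0" "mink (\<kappa> w) (Pb w) = 0" "mink (\<kappa> w) (Yh w) = 0"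
    by (simp_all add: \<kappa>_def 1 2 3 4)
qed

lemma \<kappa>_perp:
  assumes w: "w \<in> S" and "v \<in> CV Y w"
  shows "mink (\<kappa> w) v = 0" "mink v (\<kappa> w) = 0"
  using orthogonal_CV[OF w \<kappa>_orthogonal[OF w] assms(2)] by auto

text \<open>This yields the Schwarzian in terms of the second envelope: s = \<mu>_z - \<mu>^2/2 -
  \<theta>.\<close>

lemma Yzz:
  assumes w: "w \<in> S"
  shows "dz (dz Y) w = \<kappa> w - ((ddz \<mu> w - (\<mu> w)\<^sup>2 / 2 - \<theta> w) / 2) *s Y w"
proof -
  have "dz (dz Y) w = dz (\<lambda>x. P x - (\<mu> x / 2) *s Y x) w"
    by (rule dz_cong[OF op w]) (simp add: P_def)
  also have "\<dots> = dz P w - (ddz (\<lambda>x. \<mu> x / 2) w *s Y w + (\<mu> w / 2) *s dz Y w)"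
    by (simp add: dz_diff dz_smult differentiable_smult diff[OF _ w] Cinf_on_half smooth)
  also have "ddz (\<lambda>x. \<mu> x / 2) w = ddz \<mu> w / 2"
    unfolding half_mult using ddz_mult[OF diff[OF Cinf_on_const[of "1/2"] w] diff[OF smooth_\<mu> w]] by simp
  finally have "dz (dz Y) w = dz P w - ((ddz \<mu> w / 2) *s Y w + (\<mu> w / 2) *s dz Y w)" .
  from this[unfolded Yz_P[OF w] Pz] show ?thesis
    by (rule trans) (simp add: vec_eq_iff field_simps power2_eq_square)
qed

text \<open>The Codazzi equation in this frame. On differentiating \<open>Pzb\<close>, only
  \<open>dz P\<close> produces a normal term, because \<open>dz Yh\<close> lies in V by enveloping;
  this gives the normal part of \<open>dzbar \<kappa>\<close>. Its tangent part follows from the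
  products with the frame, of which only the one with \<open>Pb\<close> is nonzero.\<close>

lemma \<kappa>zb:
  assumes w: "w \<in> S"
  shows "dzbar \<kappa> w = - ((cnj (\<mu> w) / 2) *s \<kappa> w) - (2 * mink (\<kappa> w) (cnjv (\<kappa> w))) *s P w"
proof -
  note [simp] = mink_simps table[OF w] \<kappa>_orthogonal[OF w]
  note D = diff[OF _ w]
  have half_cnj: "Cinf_on (\<lambda>w. cnj (g w) / 2) S" if "Cinf_on g S" for g
    by (intro Cinf_on_half Cinf_on_cnj[OF op] that)
  have "dzbar (dz P) w = dz (dzbar P) w" by (rule dzbar_dz[OF op smooth_P w])
  also have "\<dots> = dz (\<lambda>w. (cnj (\<rho> w) / 2) *s Y w + (1/2) *s Yh w - (cnj (\<mu> w) / 2) *s P w) w"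
    by (rule dz_cong[OF op w]) (rule Pzb)
  also have "\<dots> = ddz (\<lambda>w. cnj (\<rho> w) / 2) w *s Y w + (cnj (\<rho> w) / 2) *s dz Y w + (1/2) *s dz Yh w
      - (ddz (\<lambda>w. cnj (\<mu> w) / 2) w *s P w + (cnj (\<mu> w) / 2) *s dz P w)"
    by (simp add: dz_diff dz_add dz_smult differentiable_smult D half_cnj smooth)
  finally have 1: "dzbar (dz P) w = \<dots>" .
  have 2: "dzbar \<kappa> w = dzbar (dz P) w - (ddzbar (\<lambda>w. \<theta> w / 2) w *s Y w + (\<theta> w / 2) *s dzbar Y w)
       - (ddzbar (\<lambda>w. \<mu> w / 2) w *s P w + (\<mu> w / 2) *s dzbar P w)"
    unfolding \<kappa>_def [abs_def]
    by (simp add: dzbar_diff dzbar_smult differentiable_smult D Cinf_on_half Cinf_on_dz[OF op] smooth)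
  \<comment> \<open>In this combination the normal term coming from \<open>dz P\<close> cancels, so
    it lies in V and can be expanded.\<close>
  let ?u = "dzbar \<kappa> w + (cnj (\<mu> w) / 2) *s \<kappa> w"
  have "?u = (ddz (\<lambda>w. cnj (\<rho> w) / 2) w *s Y w + (cnj (\<rho> w) / 2) *s dz Y w + (1/2) *s dz Yh w
      - (ddz (\<lambda>w. cnj (\<mu> w) / 2) w *s P w + (cnj (\<mu> w) / 2) *s ((\<mu> w / 2) *s P w + (\<theta> w / 2) *s Y w)))
      - (ddzbar (\<lambda>w. \<theta> w / 2) w *s Y w + (\<theta> w / 2) *s dzbar Y w)
      - (ddzbar (\<lambda>w. \<mu> w / 2) w *s P w + (\<mu> w / 2) *s dzbar P w)"
    unfolding 2 1 Pz by (simp add: vec_eq_iff algebra_simps)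
  also have "\<dots> \<in> CV Y w"
    unfolding Pzb[OF w]
    by (intro CV_add CV_diff CV_smult CV_base frame_in_CV[OF w] YhzV[OF w])
  finally have V: "?u \<in> CV Y w" .
  have c1: "mink (\<kappa> w) (dzbar Y w) = 0" using \<kappa>_perp[OF w CV_base(3)] by simp
  have i1: "mink (dzbar \<kappa> w) (Y w) = 0"
    using d_const(2)[OF w smooth_\<kappa> smooth_Y \<kappa>_orthogonal(1)] c1 by simp
  have i2: "mink (dzbar \<kappa> w) (P w) = 0"
    using d_const(2)[OF w smooth_\<kappa> smooth_P \<kappa>_orthogonal(2)] by (simp add: Pzb[OF w])
  have i3: "mink (dzbar \<kappa> w) (Pb w) = - mink (\<kappa> w) (cnjv (\<kappa> w))"
    using d_const(2)[OF w smooth_\<kappa> smooth_Pb \<kappa>_orthogonal(3)]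
    by (simp add: Pbzb[OF w] Pz cnjv_P[OF w] realY[OF w])
  have i4: "mink (dzbar \<kappa> w) (Yh w) = 0"
    using d_const(2)[OF w smooth_\<kappa> smooth_Yh \<kappa>_orthogonal(4)] by (simp add: Yhzb'[OF w])
  have u: "?u = (- (2 * mink (\<kappa> w) (cnjv (\<kappa> w)))) *s P w"
    using expansion[OF w V] by (simp add: i1 i2 i3 i4)
  have "dzbar \<kappa> w = ?u - (cnj (\<mu> w) / 2) *s \<kappa> w" by simp
  then show ?thesis unfolding u by (simp add: vec_eq_iff)
qed

end


section \<open>The real normal field and the constant vector when \<rho> vanishes\<close>

lemma
  assumes "g differentiable (at w)" "g w \<noteq> 0"
  shows ddz_inverse: "ddz (\<lambda>x. inverse (g x)) w = - ddz g w / (g w)\<^sup>2"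
    and ddzbar_inverse: "ddzbar (\<lambda>x. inverse (g x)) w = - ddzbar g w / (g w)\<^sup>2"
  unfolding atomize_conj
  by (rule wirtingerI[OF Deriv.has_derivative_inverse[OF assms(2) has_derivative_wirtinger[OF assms(1)]]])
    (use assms(2) in \<open>simp add: field_simps power2_eq_square\<close>)

text \<open>The case in which \<open>\<rho>\<close> vanishes: then \<open>f\<close> is totally umbilic or locally a cmc-1 surface.\<close>

locale cmc_frame = envelope_frame +
  assumes \<rho>0: "w \<in> S \<Longrightarrow> \<rho> w = 0"
    and definite: "w \<in> S \<Longrightarrow> mink (cvec u) (Y w) = 0 \<Longrightarrow> mink (cvec u) (Yh w) = 0 \<Longrightarrow>
      mink u u \<ge> 0 \<and> (mink u u = 0 \<longrightarrow> u = 0)"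
begin

definition "\<xi> w = inverse (\<theta> w) *s \<kappa> w"
definition "h w = mink (\<xi> w) (\<xi> w)"
definition "g w = complex_of_real (sqrt (Re (h w)))"
text \<open>The negative of the vector for the ball: by \<open>q_inner\<close> its product with
  \<open>Y\<close> is -2 g, so that \<open>- q\<close> is the choice with the surface on the
  positive side. The factor 1 / g gives unit length, and the factor 2 g makes the derivative
  vanish.\<close>

definition "q w = inverse (g w) *s \<xi> w + (2 * g w) *s Yh w"

lemma \<theta>0: "w \<in> S \<Longrightarrow> \<theta> w \<noteq> 0"
  using \<theta>\<rho>_nonzero \<rho>0 by blast

lemma Yhz0: "w \<in> S \<Longrightarrow> dz Yh w = (\<mu> w / 2) *s Yh w + \<theta> w *s Pb w"
  and Yhzb0: "w \<in> S \<Longrightarrow> dzbar Yh w = (cnj (\<mu> w) / 2) *s Yh w + cnj (\<theta> w) *s P w"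
  by (simp_all add: Yhz Yhzb' \<rho>0)

text \<open>Both are parts of the compatibility condition dzbar (dz Yh) = dz (dzbar Yh): its product
  with \<open>P\<close> gives holomorphy, and its normal part relates \<open>\<kappa>\<close> to its
  conjugate, which makes \<open>\<xi>\<close> real.\<close>

lemma
  assumes w: "w \<in> S"
  shows \<theta>_holomorphic: "ddzbar \<theta> w = 0" and \<theta>_\<kappa>: "\<theta> w *s cnjv (\<kappa> w) = cnj (\<theta> w) *s \<kappa> w"
proof -
  note [simp] = mink_simps table[OF w]
  note D = diff[OF _ w]
  have half_cnj: "Cinf_on (\<lambda>w. cnj (g w) / 2) S" if "Cinf_on g S" for g
    by (intro Cinf_on_half Cinf_on_cnj[OF op] that)
  have "dzbar (dz Yh) w = dzbar (\<lambda>w. (\<mu> w / 2) *s Yh w + \<theta> w *s Pb w) w"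
    by (rule dzbar_cong[OF op w]) (rule Yhz0)
  also have "\<dots> = ddzbar (\<lambda>w. \<mu> w / 2) w *s Yh w + (\<mu> w / 2) *s dzbar Yh w
      + (ddzbar \<theta> w *s Pb w + \<theta> w *s dzbar Pb w)"
    by (simp add: dzbar_add dzbar_smult differentiable_smult D Cinf_on_half smooth)
  finally have 1: "dzbar (dz Yh) w = \<dots>" .
  have "dz (dzbar Yh) w = dz (\<lambda>w. (cnj (\<mu> w) / 2) *s Yh w + cnj (\<theta> w) *s P w) w"
    by (rule dz_cong[OF op w]) (rule Yhzb0)
  also have "\<dots> = ddz (\<lambda>w. cnj (\<mu> w) / 2) w *s Yh w + (cnj (\<mu> w) / 2) *s dz Yh w
      + (ddz (\<lambda>w. cnj (\<theta> w)) w *s P w + cnj (\<theta> w) *s dz P w)"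
    by (simp add: dz_add dz_smult differentiable_smult D half_cnj Cinf_on_cnj[OF op] smooth)
  finally have 2: "dz (dzbar Yh) w = \<dots>" .
  have e: "ddzbar (\<lambda>w. \<mu> w / 2) w *s Yh w + (\<mu> w / 2) *s dzbar Yh w
      + (ddzbar \<theta> w *s Pb w + \<theta> w *s dzbar Pb w) =
     ddz (\<lambda>w. cnj (\<mu> w) / 2) w *s Yh w + (cnj (\<mu> w) / 2) *s dz Yh w
      + (ddz (\<lambda>w. cnj (\<theta> w)) w *s P w + cnj (\<theta> w) *s dz P w)" (is "?l = ?r")
    using dzbar_dz[OF op smooth_Yh w] unfolding 1 2 .
  have pb: "dzbar Pb w = cnjv (\<kappa> w) + (cnj (\<mu> w) / 2) *s Pb w + (cnj (\<theta> w) / 2) *s Y w"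
    by (simp add: Pbzb[OF w] Pz cnjv_P[OF w] realY[OF w])
  have ck: "mink (cnjv (\<kappa> w)) (P w) = 0"
    using \<kappa>_orthogonal(3)[OF w] by (simp add: mink_cnjv_left cnjv_P[OF w])
  have "mink ?l (P w) = mink ?r (P w)" using e by simp
  then show "ddzbar \<theta> w = 0"
    by (simp add: pb Pz ck \<kappa>_orthogonal[OF w] Yhz0[OF w] Yhzb0[OF w])
  \<comment> \<open>The tangent terms of the compatibility condition. Being equal to the normal
    terms, \<open>v\<close> is also orthogonal to V and hence zero.\<close>
  define v where "v = ddz (\<lambda>w. cnj (\<mu> w) / 2) w *s Yh w + (cnj (\<mu> w) / 2) *s dz Yh w
      + (ddz (\<lambda>w. cnj (\<theta> w)) w *s P w + cnj (\<theta> w) *s ((\<mu> w / 2) *s P w + (\<theta> w / 2) *s Y w))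
      - (ddzbar (\<lambda>w. \<mu> w / 2) w *s Yh w + (\<mu> w / 2) *s dzbar Yh w
      + (ddzbar \<theta> w *s Pb w + \<theta> w *s ((cnj (\<mu> w) / 2) *s Pb w + (cnj (\<theta> w) / 2) *s Y w)))"
  have vV: "v \<in> CV Y w"
    unfolding v_def Yhzb0[OF w] by (intro CV_add CV_diff CV_smult frame_in_CV[OF w] YhzV[OF w])
  have "\<theta> w *s cnjv (\<kappa> w) - cnj (\<theta> w) *s \<kappa> w = v + (?l - ?r)"
    unfolding v_def pb Pz by (simp add: vec_eq_iff algebra_simps)
  then have v: "v = \<theta> w *s cnjv (\<kappa> w) - cnj (\<theta> w) *s \<kappa> w" using e by simp
  have ck': "mink (cnjv (\<kappa> w)) u = 0" if "u \<in> CV Y w" for u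
  proof (rule orthogonal_CV(1)[OF w _ _ _ _ that])
    show "mink (cnjv (\<kappa> w)) (Y w) = 0" "mink (cnjv (\<kappa> w)) (Pb w) = 0" "mink (cnjv (\<kappa> w)) (Yh w) = 0"
      by (simp_all add: mink_cnjv_left cnjv_Pb[OF w] realY[OF w] realYh[OF w] \<kappa>_orthogonal[OF w])
  qed (rule ck)
  have "v = 0"
    by (rule CV_orthogonal_zero[OF w vV]) (simp add: v ck' \<kappa>_perp[OF w])
  then show "\<theta> w *s cnjv (\<kappa> w) = cnj (\<theta> w) *s \<kappa> w" using v by simp
qed

lemma \<kappa>_\<xi>: "w \<in> S \<Longrightarrow> \<kappa> w = \<theta> w *s \<xi> w"
  using \<theta>0 by (simp add: \<xi>_def)

lemma \<xi>_real:
  assumes w: "w \<in> S"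
  shows "cnjv (\<xi> w) = \<xi> w"
proof -
  have "cnjv (\<kappa> w) = inverse (\<theta> w) *s (cnj (\<theta> w) *s \<kappa> w)"
    using \<theta>0[OF w] unfolding \<theta>_\<kappa>[OF w, symmetric] by simp
  then show ?thesis using \<theta>0[OF w] by (simp add: \<xi>_def)
qed

lemma \<xi>_orthogonal:
  assumes w: "w \<in> S"
  shows "mink (\<xi> w) (Y w) = 0" "mink (\<xi> w) (P w) = 0" "mink (\<xi> w) (Pb w) = 0" "mink (\<xi> w) (Yh w) = 0"
  by (simp_all add: \<xi>_def mink_simps \<kappa>_orthogonal[OF w])

lemma h_real:
  assumes w: "w \<in> S"
  shows "h w = complex_of_real (Re (h w))" "Re (h w) \<ge> 0" "h w = 0 \<longleftrightarrow> \<kappa> w = 0"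
proof -
  define u where "u = (\<chi> i. Re (\<xi> w $ i))"
  have u: "\<xi> w = cvec u" using real_vector_is_cvec[OF \<xi>_real[OF w]] by (simp add: u_def)
  have h: "h w = complex_of_real (mink u u)" by (simp add: h_def u mink_cvec)
  then show "h w = complex_of_real (Re (h w))" by simp
  have "mink u u \<ge> 0 \<and> (mink u u = 0 \<longrightarrow> u = 0)"
    by (rule definite[OF w]) (use \<xi>_orthogonal[OF w] u in simp_all)
  then show "Re (h w) \<ge> 0" "h w = 0 \<longleftrightarrow> \<kappa> w = 0"
    using h \<theta>0[OF w] by (auto simp: u \<kappa>_\<xi>[OF w] mink_simps)
qed

lemma differentiable_\<xi>: "w \<in> S \<Longrightarrow> \<xi> differentiable (at w)"
  unfolding \<xi>_def [abs_def]
  by (intro differentiable_bilinear[OF bilinear_smult] differentiable_inverse diff smooth_\<theta> smooth_\<kappa> \<theta>0)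

text \<open>As \<open>\<theta>\<close> is holomorphic, division by it passes through dzbar, so this
  is \<open>\<kappa>zb\<close> divided by \<open>\<theta>\<close>.\<close>

lemma \<xi>zb:
  assumes w: "w \<in> S"
  shows "dzbar \<xi> w = - ((cnj (\<mu> w) / 2) *s \<xi> w) - (2 * cnj (\<theta> w) * h w) *s P w"
proof -
  have "(\<lambda>x. inverse (\<theta> x)) differentiable (at w)"
    by (intro differentiable_inverse diff smooth_\<theta> \<theta>0 w)
  then have "dzbar \<xi> w = inverse (\<theta> w) *s dzbar \<kappa> w"
    unfolding \<xi>_def [abs_def]
    using dzbar_smult[of "\<lambda>x. inverse (\<theta> x)" w \<kappa>] diff[OF smooth_\<kappa> w]
      ddzbar_inverse[OF diff[OF smooth_\<theta> w] \<theta>0[OF w]] \<theta>_holomorphic[OF w] by simp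
  moreover have "mink (\<kappa> w) (cnjv (\<kappa> w)) = \<theta> w * (cnj (\<theta> w) * h w)"
    by (simp add: \<kappa>_\<xi>[OF w] mink_simps \<xi>_real[OF w] h_def)
  ultimately show ?thesis
    using \<theta>0[OF w] by (simp add: \<kappa>zb[OF w] \<xi>_def vec_eq_iff field_simps)
qed

lemma \<xi>z:
  assumes w: "w \<in> S"
  shows "dz \<xi> w = - ((\<mu> w / 2) *s \<xi> w) - (2 * \<theta> w * h w) *s Pb w"
proof -
  have "dz \<xi> w = dz (\<lambda>x. cnjv (\<xi> x)) w"
    by (rule dz_cong[OF op w]) (simp add: \<xi>_real)
  also have "\<dots> = cnjv (dzbar \<xi> w)" by (rule dz_cnjv[OF differentiable_\<xi>[OF w]])
  also have "cnj (h w) = h w" using h_real(1)[OF w] by (metis complex_cnj_complex_of_real)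
  then have "cnjv (dzbar \<xi> w) = - ((\<mu> w / 2) *s \<xi> w) - (2 * \<theta> w * h w) *s Pb w"
    unfolding \<xi>zb[OF w] by (simp add: \<xi>_real[OF w] cnjv_P[OF w])
  finally show ?thesis .
qed

lemma differentiable_h: "w \<in> S \<Longrightarrow> h differentiable (at w)"
  unfolding h_def [abs_def]
  using differentiable_bilinear[OF bilinear_mink differentiable_\<xi> differentiable_\<xi>] by simp

lemma
  assumes w: "w \<in> S"
  shows hz: "ddz h w = - \<mu> w * h w" and hzb: "ddzbar h w = - cnj (\<mu> w) * h w"
proof -
  note [simp] = mink_simps \<xi>_orthogonal[OF w] \<xi>_orthogonal[OF w, THEN trans[OF mink_commute]]
  show "ddz h w = - \<mu> w * h w"
    unfolding h_def [abs_def] ddz_mink[OF differentiable_\<xi>[OF w] differentiable_\<xi>[OF w]] \<xi>z[OF w] by simp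
  show "ddzbar h w = - cnj (\<mu> w) * h w"
    unfolding h_def [abs_def] ddzbar_mink[OF differentiable_\<xi>[OF w] differentiable_\<xi>[OF w]] \<xi>zb[OF w] by simp
qed

lemma locally_bounded:
  fixes F :: "complex \<Rightarrow> 'b::real_normed_vector"
  assumes "w \<in> S" "continuous (at w) F"
  shows "\<exists>r>0. ball w r \<subseteq> S \<and> (\<forall>x\<in>ball w r. norm (F x) \<le> norm (F w) + 1)"
proof -
  obtain d where d: "d > 0" "\<And>x. dist x w < d \<Longrightarrow> dist (F x) (F w) < 1"
    using assms(2) unfolding continuous_at_eps_delta by (metis zero_less_one)
  obtain e where e: "e > 0" "ball w e \<subseteq> S" using op assms(1) open_contains_ball by blast
  have "norm (F x) \<le> norm (F w) + 1" if "x \<in> ball w d" for x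
  proof -
    have "norm (F x - F w) < 1" using d(2)[of x] that by (simp add: dist_norm norm_minus_commute)
    then show ?thesis using norm_triangle_ineq2[of "F x" "F w"] by linarith
  qed
  then show ?thesis using d e by (intro exI[of _ "min d e"]) auto
qed

lemma continuous_at_smooth: "Cinf_on F S \<Longrightarrow> w \<in> S \<Longrightarrow> continuous (at w) F"
  using diff differentiable_imp_continuous_within by blast

lemma \<kappa>_locally_zero:
  assumes w0: "w0 \<in> S" and "\<kappa> w0 = 0"
  shows "\<exists>\<delta>>0. ball w0 \<delta> \<subseteq> S \<and> (\<forall>w\<in>ball w0 \<delta>. \<kappa> w = 0)"
proof -
  obtain r where r: "r > 0" "ball w0 r \<subseteq> S" "\<And>x. x \<in> ball w0 r \<Longrightarrow> norm (\<mu> x) \<le> norm (\<mu> w0) + 1"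
    using locally_bounded[OF w0 continuous_at_smooth[OF smooth_\<mu> w0]] by blast
  have "\<exists>\<delta>>0. \<delta> \<le> r \<and> (\<forall>w\<in>ball w0 \<delta>. h w = 0)"
  proof (rule linear_ode_zero[OF r(1)])
    fix w assume "w \<in> ball w0 r"
    then have w: "w \<in> S" and b: "norm (\<mu> w) \<le> norm (\<mu> w0) + 1" using r by auto
    show "(h has_derivative (\<lambda>k. k * ddz h w + cnj k * ddzbar h w)) (at w)"
      by (rule has_derivative_wirtinger[OF differentiable_h[OF w]])
    fix k
    have "norm (k * ddz h w + cnj k * ddzbar h w) \<le> norm (k * ddz h w) + norm (cnj k * ddzbar h w)"
      by (rule norm_triangle_ineq)
    \<comment> \<open>The two Wirtinger derivatives of \<open>h\<close> are multiples of
      \<open>h\<close> by factors of the same modulus, whence the 2.\<close>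
    also have "\<dots> = (2 * norm (\<mu> w)) * norm (h w) * norm k"
      by (simp add: hz[OF w] hzb[OF w] norm_mult)
    also have "\<dots> \<le> (2 * (norm (\<mu> w0) + 1)) * norm (h w) * norm k"
      using b by (intro mult_right_mono) auto
    finally show "norm (k * ddz h w + cnj k * ddzbar h w) \<le> (2 * (norm (\<mu> w0) + 1)) * norm (h w) * norm k" .
  qed (use assms h_real(3) in auto)
  then show ?thesis using r(2) h_real(3) by (meson subset_ball order_trans subsetD)
qed

lemma g_square: "w \<in> S \<Longrightarrow> g w * g w = h w"
  using h_real(1,2)[of w] by (simp add: g_def flip: of_real_mult)

context
  fixes w assumes w: "w \<in> S" and nz: "\<kappa> w \<noteq> 0"
begin

lemma Re_h_pos: "Re (h w) > 0"
  using h_real[OF w] nz by (metis less_eq_real_def of_real_0)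

lemma g_nonzero: "g w \<noteq> 0"
  using Re_h_pos by (simp add: g_def)

lemma differentiable_g: "g differentiable (at w)"
proof -
  obtain D where D: "(h has_derivative D) (at w)" using differentiable_h[OF w] by (auto simp: differentiable_def)
  have "((\<lambda>x. sqrt (Re (h x))) has_derivative (\<lambda>k. (inverse (sqrt (Re (h w))) / 2) * Re (D k))) (at w)"
    using has_derivative_compose[OF bounded_linear.has_derivative[OF bounded_linear_Re D]
        DERIV_real_sqrt[OF Re_h_pos, unfolded has_field_derivative_def]] .
  from bounded_linear.has_derivative[OF bounded_linear_of_real this]
  show ?thesis unfolding g_def [abs_def] differentiable_def by blast
qed

lemma gz: "ddz g w = - (\<mu> w / 2) * g w" and gzb: "ddzbar g w = - (cnj (\<mu> w) / 2) * g w"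
proof -
  have "ddz h w = ddz (\<lambda>x. g x * g x) w" by (rule ddz_cong[OF op w]) (simp add: g_square)
  also have "\<dots> = 2 * g w * ddz g w" by (simp add: ddz_mult[OF differentiable_g differentiable_g])
  finally have "2 * g w * ddz g w = - \<mu> w * (g w * g w)" by (simp add: hz[OF w] g_square[OF w])
  then have "(2 * g w) * ddz g w = (2 * g w) * (- (\<mu> w / 2) * g w)" by (simp add: algebra_simps)
  then show "ddz g w = - (\<mu> w / 2) * g w" using g_nonzero by (simp only: mult_cancel_left) simp
  have "ddzbar h w = ddzbar (\<lambda>x. g x * g x) w" by (rule ddzbar_cong[OF op w]) (simp add: g_square)
  also have "\<dots> = 2 * g w * ddzbar g w" by (simp add: ddzbar_mult[OF differentiable_g differentiable_g])
  finally have "2 * g w * ddzbar g w = - cnj (\<mu> w) * (g w * g w)" by (simp add: hzb[OF w] g_square[OF w])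
  then have "(2 * g w) * ddzbar g w = (2 * g w) * (- (cnj (\<mu> w) / 2) * g w)" by (simp add: algebra_simps)
  then show "ddzbar g w = - (cnj (\<mu> w) / 2) * g w" using g_nonzero by (simp only: mult_cancel_left) simp
qed

text \<open>The equations for \<open>\<xi>\<close>, \<open>g\<close> and \<open>Yh\<close> have
  matching factors \<mu>/2, so the terms along \<open>\<xi>\<close> and \<open>Yh\<close> cancel.
  What is left is -2 \<theta> h / g times \<open>Pb\<close> from the first summand and 2 \<theta> g
  times \<open>Pb\<close> from the second; they cancel because g^2 = h. The conjugate computation
  gives dzbar.\<close>

lemma differentiable_q: "q differentiable (at w)" and qz: "dz q w = 0" and qzb: "dzbar q w = 0"
proof -
  have i: "(\<lambda>x. inverse (g x)) differentiable (at w)"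
    by (intro differentiable_inverse differentiable_g g_nonzero)
  have t: "(\<lambda>x. 2 * g x) differentiable (at w)" using differentiable_g by (intro differentiable_mult) auto
  note yh = diff[OF smooth_Yh w]
  have s: "(\<lambda>x. inverse (g x) *s \<xi> x) differentiable (at w)" "(\<lambda>x. (2 * g x) *s Yh x) differentiable (at w)"
    using differentiable_bilinear[OF bilinear_smult] i t yh differentiable_\<xi>[OF w] by blast+
  show "q differentiable (at w)" unfolding q_def [abs_def] by (intro differentiable_add s)
  have t2: "ddz (\<lambda>x. 2 * g x) w = - \<mu> w * g w" "ddzbar (\<lambda>x. 2 * g x) w = - cnj (\<mu> w) * g w"
    using ddz_mult[OF differentiable_const differentiable_g, of 2] ddzbar_mult[OF differentiable_const differentiable_g, of 2]
    by (simp_all add: gz gzb)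
  show "dz q w = 0"
    unfolding q_def [abs_def] dz_add[OF s] dz_smult[OF i differentiable_\<xi>[OF w]] dz_smult[OF t yh] t2
      ddz_inverse[OF differentiable_g g_nonzero] gz \<xi>z[OF w] Yhz0[OF w] g_square[OF w, symmetric]
    using g_nonzero by (simp add: vec_eq_iff field_simps power2_eq_square)
  show "dzbar q w = 0"
    unfolding q_def [abs_def] dzbar_add[OF s] dzbar_smult[OF i differentiable_\<xi>[OF w]] dzbar_smult[OF t yh] t2
      ddzbar_inverse[OF differentiable_g g_nonzero] gzb \<xi>zb[OF w] Yhzb0[OF w] g_square[OF w, symmetric]
    using g_nonzero by (simp add: vec_eq_iff field_simps power2_eq_square)
qed

lemma q_inner:
  "mink (q w) (q w) = 1" "mink (q w) (Y w) = - 2 * g w" "mink (q w) (Yh w) = 0"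
  "mink (q w) (P w) = 0" "mink (q w) (Pb w) = 0" "cnjv (q w) = q w"
proof -
  note [simp] = mink_simps table[OF w] \<xi>_orthogonal[OF w] \<xi>_orthogonal[OF w, THEN trans[OF mink_commute]]
  show "mink (q w) (q w) = 1"
    using g_nonzero by (simp add: q_def h_def[symmetric] g_square[OF w, symmetric] mult.assoc[symmetric])
  show "mink (q w) (Y w) = - 2 * g w" "mink (q w) (Yh w) = 0" "mink (q w) (P w) = 0" "mink (q w) (Pb w) = 0"
    by (simp_all add: q_def)
  show "cnjv (q w) = q w"
    by (simp add: q_def g_def \<xi>_real[OF w] realYh[OF w])
qed

text \<open>Closes the system of structure equations: for u orthogonal to \<open>q\<close>, the
  product with \<open>\<kappa>\<close> becomes a multiple of the product with
  \<open>Yh\<close>.\<close>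

lemma \<kappa>_q: "\<kappa> w = (\<theta> w * g w) *s q w - (2 * \<theta> w * h w) *s Yh w"
  using g_nonzero by (simp add: \<kappa>_\<xi>[OF w] q_def vec_eq_iff field_simps flip: g_square[OF w])

end

lemma q_locally_constant:
  assumes w0: "w0 \<in> S" and nz: "\<kappa> w0 \<noteq> 0"
  shows "\<exists>\<delta>>0. ball w0 \<delta> \<subseteq> S \<and> (\<forall>w\<in>ball w0 \<delta>. \<kappa> w \<noteq> 0 \<and> q w = q w0)"
proof -
  obtain \<delta> where \<delta>: "\<delta> > 0" "ball w0 \<delta> \<subseteq> S" "\<And>x. x \<in> ball w0 \<delta> \<Longrightarrow> \<kappa> x \<noteq> 0"
    using nonzero_nearby[OF smooth_\<kappa> w0 nz] by blast
  have "(q has_derivative (\<lambda>k. 0)) (at x within ball w0 \<delta>)" if "x \<in> ball w0 \<delta>" for x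
  proof -
    have x: "x \<in> S" "\<kappa> x \<noteq> 0" using \<delta> that by auto
    show ?thesis
      using has_derivative_wirtinger_vec[OF differentiable_q[OF x]] by (simp add: qz[OF x] qzb[OF x] has_derivative_at_withinI)
  qed
  from has_derivative_zero_constant[OF convex_ball this]
  obtain c where c: "\<And>x. x \<in> ball w0 \<delta> \<Longrightarrow> q x = c" by blast
  then have "\<forall>x\<in>ball w0 \<delta>. q x = q w0" using \<delta>(1) centre_in_ball by metis
  then show ?thesis using \<delta> by blast
qed

text \<open>The orthogonal complement of V + span q is locally constant. The products of u with
  \<open>Y\<close>, \<open>P\<close> and \<open>Yh\<close> satisfy a homogeneous linear first-order
  system with locally bounded coefficients, so they vanish near a common zero.\<close>

lemma orthogonal_frame_locally:
  assumes w0: "w0 \<in> S" and nz: "\<kappa> w0 \<noteq> 0" and u: "cnjv u = u" and uq: "mink u (q w0) = 0"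
    and u0: "mink u (Y w0) = 0" "mink u (P w0) = 0" "mink u (Yh w0) = 0"
  shows "\<exists>\<delta>>0. ball w0 \<delta> \<subseteq> S \<and>
    (\<forall>w\<in>ball w0 \<delta>. mink u (Y w) = 0 \<and> mink u (P w) = 0 \<and> mink u (Yh w) = 0)"
proof -
  obtain d where d: "d > 0" "ball w0 d \<subseteq> S" "\<And>w. w \<in> ball w0 d \<Longrightarrow> \<kappa> w \<noteq> 0 \<and> q w = q w0"
    using q_locally_constant[OF w0 nz] by blast
  \<comment> \<open>Packing the coefficients into one map bounds all of them on a single
    ball.\<close>
  define B where "B w = (\<mu> w, \<theta> w, h w)" for w
  have "continuous (at w0) B"
    unfolding B_def [abs_def]
    using continuous_at_smooth[OF smooth_\<mu> w0] continuous_at_smooth[OF smooth_\<theta> w0]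
      differentiable_imp_continuous_within[OF differentiable_h[OF w0]] by (intro continuous_Pair) auto
  from locally_bounded[OF w0 this] obtain r0 where
    r0: "r0 > 0" "\<And>x. x \<in> ball w0 r0 \<Longrightarrow> norm (B x) \<le> norm (B w0) + 1" by blast
  define m where "m = norm (B w0) + 1"
  define r where "r = min d r0"
  have r: "r > 0" "ball w0 r \<subseteq> S" using d r0 by (auto simp: r_def)
  have m: "norm (\<mu> x) \<le> m" "norm (\<theta> x) \<le> m" "norm (h x) \<le> m" if "x \<in> ball w0 r" for x
  proof -
    have b: "norm (B x) \<le> m" using r0(2)[of x] that by (simp add: r_def m_def)
    show "norm (\<mu> x) \<le> m" using norm_fst_le[of "\<mu> x" "(\<theta> x, h x)"] b by (simp add: B_def)
    have c: "norm (\<theta> x, h x) \<le> m" using norm_snd_le[of "(\<theta> x, h x)" "\<mu> x"] b by (simp add: B_def)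
    show "norm (\<theta> x) \<le> m" "norm (h x) \<le> m"
      using norm_fst_le[of "\<theta> x" "h x"] norm_snd_le[of "h x" "\<theta> x"] c by simp_all
  qed
  define a b b' c where "a w = mink u (Y w)" and "b w = mink u (P w)"
    and "b' w = mink u (Pb w)" and "c w = mink u (Yh w)" for w
  note du = differentiable_const[of u]
  \<comment> \<open>As u is real, the product with \<open>Pb\<close> is the conjugate of the one
    with \<open>P\<close> and not a further unknown.\<close>
  have b': "norm (b' w) = norm (b w)" if "w \<in> S" for w
    using mink_cnjv[of u "P w"] u by (simp add: b_def b'_def cnjv_P[OF that])
  define U where "U w = (a w, b w, c w)" for w
  \<comment> \<open>The differential of U according to the structure equations. The term with
    \<theta> h c is the contribution of \<open>\<kappa>\<close>, rewritten by
    \<open>\<kappa>_q\<close>.\<close>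
  define U' where "U' w k = (k * (b w - \<mu> w / 2 * a w) + cnj k * (b' w - cnj (\<mu> w) / 2 * a w),
      k * (- 2 * \<theta> w * h w * c w + \<mu> w / 2 * b w + \<theta> w / 2 * a w) + cnj k * (c w / 2 - cnj (\<mu> w) / 2 * b w),
      k * (\<mu> w / 2 * c w + \<theta> w * b' w) + cnj k * (cnj (\<mu> w) / 2 * c w + cnj (\<theta> w) * b w))" for w k
  have "\<exists>\<delta>>0. \<delta> \<le> r \<and> (\<forall>w\<in>ball w0 \<delta>. U w = 0)"
  proof (rule linear_ode_zero[OF r(1)])
    fix w assume wr: "w \<in> ball w0 r"
    then have w: "w \<in> S" and nz': "\<kappa> w \<noteq> 0" and qw: "mink u (q w) = 0"
      using r d(3)[of w] uq by (auto simp: r_def)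
    note D = diff[OF _ w]
    have dm: "(\<lambda>w. mink u (F w)) differentiable (at w)" if "F differentiable (at w)" for F
      using differentiable_bilinear[OF bilinear_mink du that] .
    have da: "a differentiable (at w)" "b differentiable (at w)" "c differentiable (at w)"
      unfolding a_def [abs_def] b_def [abs_def] c_def [abs_def]
      by (intro dm D smooth)+
    have 1: "ddz a w = b w - \<mu> w / 2 * a w" "ddzbar a w = b' w - cnj (\<mu> w) / 2 * a w"
      unfolding a_def [abs_def] ddz_mink[OF du D[OF smooth_Y]] ddzbar_mink[OF du D[OF smooth_Y]]
      by (simp_all add: Yz_P[OF w] Yzb_Pb[OF w] mink_simps b_def b'_def)
    have 2: "ddz b w = - 2 * \<theta> w * h w * c w + \<mu> w / 2 * b w + \<theta> w / 2 * a w"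
      "ddzbar b w = c w / 2 - cnj (\<mu> w) / 2 * b w"
      unfolding b_def [abs_def] ddz_mink[OF du D[OF smooth_P]] ddzbar_mink[OF du D[OF smooth_P]]
      by (simp_all add: Pz \<kappa>_q[OF w nz'] Pzb[OF w] \<rho>0[OF w] qw mink_simps a_def c_def)
    have 3: "ddz c w = \<mu> w / 2 * c w + \<theta> w * b' w" "ddzbar c w = cnj (\<mu> w) / 2 * c w + cnj (\<theta> w) * b w"
      unfolding c_def [abs_def] ddz_mink[OF du D[OF smooth_Yh]] ddzbar_mink[OF du D[OF smooth_Yh]]
      by (simp_all add: Yhz0[OF w] Yhzb0[OF w] mink_simps b_def b'_def)
    have "((\<lambda>w. (a w, b w, c w)) has_derivative (\<lambda>k. (k * ddz a w + cnj k * ddzbar a w,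
        k * ddz b w + cnj k * ddzbar b w, k * ddz c w + cnj k * ddzbar c w))) (at w)"
      by (intro has_derivative_Pair has_derivative_wirtinger da)
    then show "(U has_derivative U' w) (at w)"
      unfolding U_def [abs_def] U'_def [abs_def] 1 2 3 .
    fix k
    define N where "N = norm (U w)"
    have N: "norm (a w) \<le> N" "norm (b w) \<le> N" "norm (c w) \<le> N" "norm (b' w) \<le> N"
    proof -
      show "norm (a w) \<le> N" using norm_fst_le[of "a w" "(b w, c w)"] by (simp add: N_def U_def)
      have x: "norm (b w, c w) \<le> N" using norm_snd_le[of "(b w, c w)" "a w"] by (simp add: N_def U_def)
      show "norm (b w) \<le> N" "norm (c w) \<le> N"
        using norm_fst_le[of "b w" "c w"] norm_snd_le[of "c w" "b w"] x by simp_all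
      then show "norm (b' w) \<le> N" using b'[OF w] by simp
    qed
    note M = m[OF wr]
    have m0: "0 \<le> m" "0 \<le> N" by (simp_all add: m_def N_def)
    have p: "norm (x * y) \<le> m * N" if "norm x \<le> m" "norm y \<le> N" for x y :: complex
      using that m0 by (simp add: norm_mult mult_mono)
    have ph: "norm (x / 2 * y) \<le> m * N" if "norm x \<le> m" "norm y \<le> N" for x y :: complex
      using p[OF that] m0 by (simp add: norm_mult norm_divide) (smt (verit) mult_nonneg_nonneg)
    have K: "norm (k * x + cnj k * y) \<le> norm k * (s + t)" if "norm x \<le> s" "norm y \<le> t" for x y s t
    proof -
      have "norm (k * x + cnj k * y) \<le> norm k * norm x + norm k * norm y"
        by (rule order_trans[OF norm_triangle_ineq]) (simp add: norm_mult)
      also have "\<dots> \<le> norm k * (s + t)" using that by (simp add: ring_distribs mult_left_mono add_mono)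
      finally show ?thesis .
    qed
    have A: "norm (k * (b w - \<mu> w / 2 * a w) + cnj k * (b' w - cnj (\<mu> w) / 2 * a w))
        \<le> norm k * ((N + m * N) + (N + m * N))"
      by (intro K order_trans[OF norm_triangle_ineq4] add_mono ph N) (use M in auto)
    have t: "norm (- 2 * \<theta> w * h w * c w) \<le> 2 * m * (m * N)"
    proof -
      have "norm (- 2 * \<theta> w * h w * c w) = 2 * norm (\<theta> w) * norm (h w * c w)" by (simp add: norm_mult)
      also have "\<dots> \<le> 2 * m * (m * N)" using p[OF M(3) N(3)] M(2) m0 by (intro mult_mono) auto
      finally show ?thesis .
    qed
    have c2: "norm (c w / 2) \<le> N" using N(3) m0 by (simp add: norm_divide)
    have B: "norm (k * (- 2 * \<theta> w * h w * c w + \<mu> w / 2 * b w + \<theta> w / 2 * a w) + cnj k * (c w / 2 - cnj (\<mu> w) / 2 * b w))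
       \<le> norm k * ((2 * m * (m * N) + m * N + m * N) + (N + m * N))"
      by (intro K order_trans[OF norm_triangle_ineq4] order_trans[OF norm_triangle_ineq] add_mono ph N t c2)
        (use M in auto)
    have C: "norm (k * (\<mu> w / 2 * c w + \<theta> w * b' w) + cnj k * (cnj (\<mu> w) / 2 * c w + cnj (\<theta> w) * b w))
       \<le> norm k * ((m * N + m * N) + (m * N + m * N))"
      by (intro K order_trans[OF norm_triangle_ineq] add_mono ph p N) (use M in auto)
    have "norm (U' w k) \<le> norm k * ((N + m * N) + (N + m * N))
       + (norm k * ((2 * m * (m * N) + m * N + m * N) + (N + m * N)) + norm k * ((m * N + m * N) + (m * N + m * N)))"
      unfolding U'_def by (intro order_trans[OF norm_Pair_le] add_mono A B C)
    \<comment> \<open>Collecting A, B and C gives 3 terms N, 9 terms m N and one term 2 m^2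
      N.\<close>
    also have "\<dots> = (3 + 9 * m + 2 * m * m) * norm (U w) * norm k"
      unfolding N_def by (simp add: algebra_simps)
    finally show "norm (U' w k) \<le> (3 + 9 * m + 2 * m * m) * norm (U w) * norm k" .
  next
    show "U w0 = 0" using u0 by (simp add: U_def a_def b_def c_def zero_prod_def)
  qed
  then obtain \<delta> where "\<delta> > 0" "\<delta> \<le> r" "\<forall>w\<in>ball w0 \<delta>. U w = 0" by blast
  then show ?thesis
    using r(2) by (intro exI[of _ \<delta>]) (auto simp: U_def a_def b_def c_def zero_prod_def)
qed

end


section \<open>Lifts of conformal immersions\<close>

definition lightcone :: "(complex \<Rightarrow> real^'n::finite) \<Rightarrow> complex \<Rightarrow> complex^('n option)" where
  "lightcone p w = cvec (null_vec (p w))"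

text \<open>Rescaling a lift adds to a derivative only multiples of derivatives of lower order.
  Hence V, and the second derivative modulo V up to the factor s, can be computed from any lift, in
  particular from \<open>lightcone\<close>.\<close>

lemma CV_scale_subset:
  assumes op: "open S" and s: "Cinf_on s S" and X: "Cinf_on X S" and w: "w \<in> S"
    and Y: "\<And>x. x \<in> S \<Longrightarrow> Y x = s x *s X x"
  shows "CV Y w \<subseteq> CV X w" "dz (dz Y) w - s w *s dz (dz X) w \<in> CV X w"
    "dz Y w = ddz s w *s X w + s w *s dz X w" "dzbar Y w = ddzbar s w *s X w + s w *s dzbar X w"
    "dz (dzbar Y) w = ddz (ddzbar s) w *s X w + ddzbar s w *s dz X w + (ddz s w *s dzbar X w + s w *s dz (dzbar X) w)"
proof -
  have sz: "Cinf_on (ddz s) S" "Cinf_on (ddzbar s) S"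
  proof -
    have "Cinf_on (\<lambda>w. (1/2) * (dx s w + (- \<i>) * dy s w)) S" "Cinf_on (\<lambda>w. (1/2) * (dx s w + \<i> * dy s w)) S"
      by (intro Cinf_on_mult Cinf_on_const Cinf_on_add op Cinf_on_dx Cinf_on_dy s)+
    then show "Cinf_on (ddz s) S" "Cinf_on (ddzbar s) S"
      by (simp_all add: ddz_def [abs_def] ddzbar_def [abs_def])
  qed
  note D = Cinf_on_differentiable[OF _ op]
  have 1: "dz Y x = ddz s x *s X x + s x *s dz X x" "dzbar Y x = ddzbar s x *s X x + s x *s dzbar X x"
    if x: "x \<in> S" for x
    using dz_cong[OF op x Y] dzbar_cong[OF op x Y] dz_smult[OF D[OF s x] D[OF X x]]
      dzbar_smult[OF D[OF s x] D[OF X x]] by simp_all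
  show "dz Y w = ddz s w *s X w + s w *s dz X w" "dzbar Y w = ddzbar s w *s X w + s w *s dzbar X w"
    using 1[OF w] by auto
  have dXz: "Cinf_on (dz X) S" "Cinf_on (dzbar X) S" by (intro Cinf_on_dz Cinf_on_dzbar op X)+
  note Dw = D[OF _ w]
  have "dz (dz Y) w = dz (\<lambda>x. ddz s x *s X x + s x *s dz X x) w"
    by (rule dz_cong[OF op w]) (rule 1)
  also have "\<dots> = (ddz (ddz s) w *s X w + ddz s w *s dz X w) + (ddz s w *s dz X w + s w *s dz (dz X) w)"
    by (simp add: dz_add dz_smult differentiable_smult Dw sz dXz X s)
  finally have "dz (dz Y) w - s w *s dz (dz X) w = ddz (ddz s) w *s X w + ddz s w *s dz X w + ddz s w *s dz X w"
    by simp
  also have "\<dots> \<in> CV X w" by (intro CV_add CV_smult CV_base)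
  finally show "dz (dz Y) w - s w *s dz (dz X) w \<in> CV X w" .
  have "dz (dzbar Y) w = dz (\<lambda>x. ddzbar s x *s X x + s x *s dzbar X x) w"
    by (rule dz_cong[OF op w]) (rule 1)
  also have "\<dots> = (ddz (ddzbar s) w *s X w + ddzbar s w *s dz X w) + (ddz s w *s dzbar X w + s w *s dz (dzbar X) w)"
    by (simp add: dz_add dz_smult differentiable_smult Dw sz dXz X s)
  finally show 2: "dz (dzbar Y) w = ddz (ddzbar s) w *s X w + ddzbar s w *s dz X w + (ddz s w *s dzbar X w + s w *s dz (dzbar X) w)" .
  have "{Y w, dz Y w, dzbar Y w, dz (dzbar Y) w} \<subseteq> CV X w"
    unfolding 1[OF w] 2 Y[OF w] by (auto intro!: CV_add CV_smult CV_base)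
  then show "CV Y w \<subseteq> CV X w"
    unfolding CV_def by (intro vec.span_minimal vec.subspace_span)
qed

lemma Cinf_on_of_real: "open S \<Longrightarrow> Cinf_on s S \<Longrightarrow> Cinf_on (\<lambda>w. complex_of_real (s w)) S"
  by (rule Cinf_on_linear[OF _ bounded_linear_of_real])

lemma CV_scale:
  assumes op: "open S" and s: "Cinf_on s S" and X: "Cinf_on X S" and w: "w \<in> S"
    and Y: "\<And>x. x \<in> S \<Longrightarrow> Y x = complex_of_real (s x) *s X x" and s0: "\<And>x. x \<in> S \<Longrightarrow> s x \<noteq> 0"
  shows "CV Y w = CV X w"
proof
  show "CV Y w \<subseteq> CV X w" by (rule CV_scale_subset(1)[OF op Cinf_on_of_real[OF op s] X w Y])
  have "Cinf_on Y S"
    using Cinf_on_smult[OF op Cinf_on_of_real[OF op s] X] Cinf_on_cong[where F=Y, OF op Y] by simp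
  moreover have "X x = complex_of_real (inverse (s x)) *s Y x" if "x \<in> S" for x
    using s0[OF that] Y[OF that] by simp
  ultimately show "CV X w \<subseteq> CV Y w"
    by (intro CV_scale_subset(1)[OF op Cinf_on_of_real[OF op Cinf_on_inverse[OF op s s0]] _ w])
qed

text \<open>Since dzbar annihilates \<open>\<phi>\<close> and its derivative, the mixed second
  derivative gains only a factor, and the pure one only a multiple of \<open>dz X\<close>.\<close>

lemma dz_compose_holomorphic:
  assumes op: "open U" and phi: "\<phi> holomorphic_on U" and w: "w \<in> U"
    and op': "open S" and im: "\<And>x. x \<in> U \<Longrightarrow> \<phi> x \<in> S" and X: "Cinf_on X S"
    and Y: "\<And>x. x \<in> U \<Longrightarrow> Y x = X (\<phi> x)"
  shows "dz Y w = deriv \<phi> w *s dz X (\<phi> w)" "dzbar Y w = cnj (deriv \<phi> w) *s dzbar X (\<phi> w)"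
    "dz (dzbar Y) w = (cnj (deriv \<phi> w) * deriv \<phi> w) *s dz (dzbar X) (\<phi> w)"
    "dz (dz Y) w = deriv (deriv \<phi>) w *s dz X (\<phi> w) + (deriv \<phi> w)\<^sup>2 *s dz (dz X) (\<phi> w)"
proof -
  have ph: "(\<phi> has_field_derivative deriv \<phi> x) (at x)" if "x \<in> U" for x
    using holomorphic_derivI[OF phi op that] .
  have ph': "(deriv \<phi> has_field_derivative deriv (deriv \<phi>) w) (at w)"
    using holomorphic_derivI[OF holomorphic_deriv[OF phi op] op w] .
  note D = Cinf_on_differentiable[OF _ op' im]
  have 1: "dz Y x = deriv \<phi> x *s dz X (\<phi> x)" "dzbar Y x = cnj (deriv \<phi> x) *s dzbar X (\<phi> x)"
    if x: "x \<in> U" for x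
    using dz_cong[OF op x Y] dzbar_cong[OF op x Y] dz_compose[OF ph[OF x] D[OF X x]]
      dzbar_compose[OF ph[OF x] D[OF X x]] by simp_all
  show "dz Y w = deriv \<phi> w *s dz X (\<phi> w)" "dzbar Y w = cnj (deriv \<phi> w) *s dzbar X (\<phi> w)"
    using 1[OF w] by auto
  have d1: "deriv \<phi> differentiable (at w)"
    using ph' unfolding has_field_derivative_def differentiable_def by blast
  have d2: "(\<lambda>x. cnj (deriv \<phi> x)) differentiable (at w)"
    using d1 bounded_linear.has_derivative[OF bounded_linear_cnj] unfolding differentiable_def by blast
  have d3: "(\<lambda>x. F (\<phi> x)) differentiable (at w)" if "F differentiable (at (\<phi> w))" for F :: "complex \<Rightarrow> complex^'b"
    using that has_derivative_compose[OF ph[OF w, unfolded has_field_derivative_def]]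
    unfolding differentiable_def by blast
  note DX = D[OF Cinf_on_dz[OF op' X] w] D[OF Cinf_on_dzbar[OF op' X] w]
  have "dz (dz Y) w = dz (\<lambda>x. deriv \<phi> x *s dz X (\<phi> x)) w" by (rule dz_cong[OF op w]) (rule 1)
  also have "\<dots> = deriv (deriv \<phi>) w *s dz X (\<phi> w) + deriv \<phi> w *s (deriv \<phi> w *s dz (dz X) (\<phi> w))"
    unfolding dz_smult[OF d1 d3[OF DX(1)]] ddz_holomorphic[OF ph'] dz_compose[OF ph[OF w] DX(1)] ..
  finally show "dz (dz Y) w = deriv (deriv \<phi>) w *s dz X (\<phi> w) + (deriv \<phi> w)\<^sup>2 *s dz (dz X) (\<phi> w)"
    by (simp add: power2_eq_square)
  have "dz (dzbar Y) w = dz (\<lambda>x. cnj (deriv \<phi> x) *s dzbar X (\<phi> x)) w" by (rule dz_cong[OF op w]) (rule 1)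
  also have "\<dots> = cnj (deriv \<phi> w) *s (deriv \<phi> w *s dz (dzbar X) (\<phi> w))"
    unfolding dz_smult[OF d2 d3[OF DX(2)]] ddz_cnj[OF d1] ddzbar_holomorphic[OF ph'] dz_compose[OF ph[OF w] DX(2)]
    by simp
  finally show "dz (dzbar Y) w = (cnj (deriv \<phi> w) * deriv \<phi> w) *s dz (dzbar X) (\<phi> w)" by simp
qed

text \<open>\<open>null_vec\<close> is affine with constant time component 1; its linear part embeds
  tangent vectors of the sphere isometrically into Minkowski space.\<close>

lemma null_vec_affine: "bounded_linear (\<lambda>x::real^'n::finite. null_vec x - null_vec 0)"
proof -
  have "linear (\<lambda>x::real^'n. null_vec x - null_vec 0)"
    by (intro linearI) (auto simp: null_vec_def vec_eq_iff split: option.split)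
  then show ?thesis by (simp add: linear_conv_bounded_linear)
qed

lemma mink_null_vec_diff:
  "mink (null_vec x - null_vec 0) (null_vec y - null_vec 0) = x \<bullet> (y :: real^'n::finite)"
  by (simp add: mink_simps mink_null_vec)

lemma Cinf_on_null_vec: "open S \<Longrightarrow> Cinf_on p S \<Longrightarrow> Cinf_on (\<lambda>w. null_vec (p w)) S"
  using Cinf_on_add[OF _ Cinf_on_linear[OF _ null_vec_affine] Cinf_on_const[of "null_vec 0"]] by simp

lemma
  assumes "p differentiable (at w)"
  shows dx_null_vec: "dx (\<lambda>w. null_vec (p w)) w = null_vec (dx p w) - null_vec 0"
    and dy_null_vec: "dy (\<lambda>w. null_vec (p w)) w = null_vec (dy p w) - null_vec 0"
    and differentiable_null_vec: "(\<lambda>w. null_vec (p w)) differentiable (at w)"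
proof -
  obtain D where D: "(p has_derivative D) (at w)" using assms by (auto simp: differentiable_def)
  have E: "((\<lambda>w. (null_vec (p w) - null_vec 0) + null_vec 0) has_derivative (\<lambda>h. (null_vec (D h) - null_vec 0) + 0)) (at w)"
    by (intro has_derivative_add bounded_linear.has_derivative[OF null_vec_affine D] has_derivative_const)
  then have E': "((\<lambda>w. null_vec (p w)) has_derivative (\<lambda>h. null_vec (D h) - null_vec 0)) (at w)" by simp
  show "dx (\<lambda>w. null_vec (p w)) w = null_vec (dx p w) - null_vec 0"
    unfolding dx_eq[OF E'] dx_eq[OF D] ..
  show "dy (\<lambda>w. null_vec (p w)) w = null_vec (dy p w) - null_vec 0"
    unfolding dy_eq[OF E'] dy_eq[OF D] ..
  show "(\<lambda>w. null_vec (p w)) differentiable (at w)" using E' differentiable_def by blast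
qed

section \<open>The canonical lift of a conformal immersion\<close>

locale conformal_immersion =
  fixes S :: "complex set" and p :: "complex \<Rightarrow> real^'n::finite"
  assumes op: "open S" and smooth_p: "Cinf_on p S" and sphere: "w \<in> S \<Longrightarrow> p w \<in> sphere 0 1"
    and conf: "w \<in> S \<Longrightarrow> norm (dx p w) = norm (dy p w)" "w \<in> S \<Longrightarrow> dx p w \<bullet> dy p w = 0"
    and inj: "w \<in> S \<Longrightarrow> inj (frechet_derivative p (at w))"
begin

abbreviation "X \<equiv> lightcone p"

text \<open>By conformality the induced metric is e |dz|^2.\<close>

definition "e w = dx p w \<bullet> dx p w"

lemma smooth_X: "Cinf_on X S"
  unfolding lightcone_def [abs_def] by (rule Cinf_on_linear[OF op linear_cvec Cinf_on_null_vec[OF op smooth_p]])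

lemma smooth_e: "Cinf_on e S"
  unfolding e_def [abs_def] by (intro Cinf_on_bilinear[OF op bounded_bilinear_inner] Cinf_on_dx smooth_p)

lemma e_pos:
  assumes w: "w \<in> S"
  shows "e w > 0"
proof -
  have "linear (frechet_derivative p (at w))"
    using Cinf_on_differentiable[OF smooth_p op w] by (metis linear_frechet_derivative)
  then have "frechet_derivative p (at w) 0 = 0" by (rule linear_0)
  then have "dx p w \<noteq> 0"
    using inj[OF w] unfolding dx_def by (metis injD zero_neq_one)
  then show ?thesis by (simp add: e_def)
qed

lemma XX: "w \<in> S \<Longrightarrow> mink (X w) (X w) = 0"
  using sphere[of w] by (simp add: lightcone_def mink_cvec mink_null_vec dot_square_norm)

lemma realX: "cnjv (X w) = X w"
  by (simp add: lightcone_def)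

lemma dX:
  assumes w: "w \<in> S"
  shows "dx X w = cvec (null_vec (dx p w) - null_vec 0)" "dy X w = cvec (null_vec (dy p w) - null_vec 0)"
proof -
  note D = Cinf_on_differentiable[OF smooth_p op w]
  show "dx X w = cvec (null_vec (dx p w) - null_vec 0)" "dy X w = cvec (null_vec (dy p w) - null_vec 0)"
    unfolding lightcone_def [abs_def] dx_linear[OF linear_cvec differentiable_null_vec[OF D]]
      dy_linear[OF linear_cvec differentiable_null_vec[OF D]] dx_null_vec[OF D] dy_null_vec[OF D] by simp_all
qed

lemma
  assumes w: "w \<in> S"
  shows XzXz: "mink (dz X w) (dz X w) = 0"
    and XzXzbar: "mink (dz X w) (dzbar X w) = complex_of_real (e w) / 2"
proof -
  have "dx p w \<bullet> dx p w = dy p w \<bullet> dy p w" using conf(1)[OF w] by (simp add: dot_square_norm)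
  then have ee: "dx p w \<bullet> dx p w = e w" "dy p w \<bullet> dy p w = e w" by (simp_all add: e_def)
  have m: "mink (dx X w) (dx X w) = complex_of_real (e w)" "mink (dy X w) (dy X w) = complex_of_real (e w)"
    "mink (dx X w) (dy X w) = 0" "mink (dy X w) (dx X w) = 0"
    by (simp_all only: dX[OF w] mink_cvec mink_null_vec_diff ee conf(2)[OF w] inner_commute[of "dy p w" "dx p w"] of_real_0)
  show "mink (dz X w) (dz X w) = 0" "mink (dz X w) (dzbar X w) = complex_of_real (e w) / 2"
    by (simp_all add: dz_def dzbar_def mink_simps m algebra_simps)
qed

lemma
  assumes w: "w \<in> S"
  shows XXz: "mink (X w) (dz X w) = 0" "mink (dz X w) (X w) = 0"
    and XXzb: "mink (X w) (dzbar X w) = 0" "mink (dzbar X w) (X w) = 0"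
  using dz_mink_const[OF op smooth_X smooth_X w XX] mink_commute[of "X w" "dz X w"]
    dzbar_mink_const[OF op smooth_X smooth_X w XX] mink_commute[of "X w" "dzbar X w"] by auto

lemma rescaled_lift:
  assumes s: "Cinf_on s S" and w: "w \<in> S" and Y: "\<And>x. x \<in> S \<Longrightarrow> Y x = complex_of_real (s x) *s X x"
  shows "mink (dz Y w) (dz Y w) = 0" "mink (dz Y w) (dzbar Y w) = complex_of_real ((s w)\<^sup>2 * e w / 2)"
proof -
  let ?s = "\<lambda>x. complex_of_real (s x)"
  have d: "dz Y w = ddz ?s w *s X w + s w *s dz X w" "dzbar Y w = ddzbar ?s w *s X w + s w *s dzbar X w"
    using CV_scale_subset(3,4)[of S ?s X w Y] op Cinf_on_of_real[OF op s] smooth_X w Y by auto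
  show "mink (dz Y w) (dz Y w) = 0" "mink (dz Y w) (dzbar Y w) = complex_of_real ((s w)\<^sup>2 * e w / 2)"
    unfolding d
    by (simp_all add: mink_simps XXz[OF w] XXzb[OF w] XX[OF w] XzXz[OF w] XzXzbar[OF w] power2_eq_square)
qed

text \<open>Rescaling the lift \<open>X\<close> by a function s multiplies its metric by s^2, so
  this factor normalises it to |dz|^2.\<close>

definition "r w = inverse (sqrt (e w))"

lemma smooth_r: "Cinf_on r S" and r_pos: "w \<in> S \<Longrightarrow> r w > 0" and r_e: "w \<in> S \<Longrightarrow> (r w)\<^sup>2 * e w = 1"
proof -
  show "Cinf_on r S"
    unfolding r_def [abs_def] using e_pos by (intro Cinf_on_inverse[OF op] Cinf_on_sqrt[OF op] smooth_e) force+
  show "w \<in> S \<Longrightarrow> r w > 0" using e_pos[of w] by (simp add: r_def)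
  show "w \<in> S \<Longrightarrow> (r w)\<^sup>2 * e w = 1" using e_pos[of w] by (simp add: r_def power_inverse)
qed

definition "Yr w = r w *\<^sub>R null_vec (p w)"

lemma cvec_Yr: "(cvec \<circ> Yr) w = complex_of_real (r w) *s X w"
  by (simp add: Yr_def lightcone_def cvec_simps)

lemma smooth_Yr: "Cinf_on Yr S"
  unfolding Yr_def [abs_def]
  by (intro Cinf_on_bilinear[OF op bounded_bilinear_scaleR] smooth_r Cinf_on_null_vec[OF op smooth_p])

lemma canonical_lift: "canonical_lift S p Yr"
  unfolding canonical_lift_def
proof (intro conjI ballI)
  fix w assume w: "w \<in> S"
  show "0 < Yr w $ None" using r_pos[OF w] by (simp add: Yr_def null_vec_def)
  show "Yr w \<in> span {null_vec (p w)}" by (simp add: Yr_def span_scale span_base)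
  show "mink (dz (cvec \<circ> Yr) w) (dz (cvec \<circ> Yr) w) = 0"
    "mink (dz (cvec \<circ> Yr) w) (dzbar (cvec \<circ> Yr) w) = 1/2"
    using rescaled_lift[where Y="cvec \<circ> Yr", OF smooth_r w cvec_Yr] r_e[OF w] by auto
qed (rule smooth_Yr)

text \<open>As \<open>null_vec\<close> has time component 1, any canonical lift is \<open>X\<close>
  times its own time component, a smooth positive function. The space V therefore agrees with that
  of \<open>X\<close>, whichever canonical lift is taken.\<close>

lemma V_space_canonical_lift:
  assumes "canonical_lift S p Y" "w \<in> S"
  shows "u \<in> V_space Y w \<longleftrightarrow> cvec u \<in> CV X w"
proof -
  have smooth_Y: "Cinf_on Y S" using assms(1) by (simp add: canonical_lift_def)
  have s: "Cinf_on (\<lambda>w. Y w $ None) S" by (rule Cinf_on_linear[OF op bounded_linear_vec_nth smooth_Y])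
  have "(cvec \<circ> Y) x = complex_of_real (Y x $ None) *s X x" if "x \<in> S" for x
  proof -
    have "Y x \<in> span {null_vec (p x)}" using assms(1) that by (simp add: canonical_lift_def)
    then obtain t where t: "Y x = t *\<^sub>R null_vec (p x)" unfolding span_singleton by (rule imageE)
    then show ?thesis by (simp add: lightcone_def cvec_simps null_vec_def vec_eq_iff)
  qed
  from CV_scale[where Y="cvec \<circ> Y", OF op s smooth_X assms(2) this] have "CV (cvec \<circ> Y) w = CV X w"
    using assms(1) by (force simp: canonical_lift_def)
  then show ?thesis using V_space_iff[OF op smooth_Y assms(2)] by simp
qed

end


section \<open>The invariant form of the case distinction\<close>

lemma (in envelope_frame) restrict:
  assumes "open B" "B \<subseteq> S"
  shows "envelope_frame B Y Yh"
  using assms realY realYh YY YhYh YYh YzYz YzYzbar YhV YhzV conf imm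
  by unfold_locales (auto intro: Cinf_on_subset[OF smooth_Y] Cinf_on_subset[OF smooth_Yh])

text \<open>
  Up to a factor the mixed derivative of the logarithm of \<open>mink (X z) (Xh z')\<close> on the diagonal, which
  is why it does not depend on the lifts.
\<close>

definition cross_form ::
    "(complex \<Rightarrow> complex^('n::finite option)) \<Rightarrow> (complex \<Rightarrow> complex^('n option)) \<Rightarrow> complex \<Rightarrow> complex" where
  "cross_form X Xh w = - 2 * (mink (dz X w) (dz Xh w) * mink (X w) (Xh w)
      - mink (dz X w) (Xh w) * mink (X w) (dz Xh w)) / (mink (X w) (Xh w))\<^sup>2"

text \<open>The numerator is a 2 by 2 determinant, from which the terms with \<open>a\<close> and
  \<open>b\<close> drop out; the remaining factor (s t)^2 cancels against the denominator.\<close>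

lemma cross_form_scale:
  assumes "dz Y w = a *s X w + s *s dz X w" "Y w = s *s X w" "s \<noteq> 0"
    and "dz Yh w = b *s Xh w + t *s dz Xh w" "Yh w = t *s Xh w" "t \<noteq> 0"
  shows "cross_form Y Yh w = cross_form X Xh w"
proof -
  define A K M N where "A = mink (X w) (Xh w)" and "K = mink (dz X w) (dz Xh w)"
    and "M = mink (X w) (dz Xh w)" and "N = mink (dz X w) (Xh w)"
  have "mink (dz Y w) (dz Yh w) * mink (Y w) (Yh w) - mink (dz Y w) (Yh w) * mink (Y w) (dz Yh w)
      = (s * t)\<^sup>2 * (K * A - N * M)"
    unfolding assms(1,2,4,5) by (simp add: mink_simps A_def K_def M_def N_def algebra_simps power2_eq_square)
  moreover have "mink (Y w) (Yh w) = (s * t) * A" by (simp add: assms mink_simps A_def)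
  ultimately have "cross_form Y Yh w = - 2 * ((s * t)\<^sup>2 * (K * A - N * M)) / ((s * t)\<^sup>2 * A\<^sup>2)"
    by (simp add: cross_form_def power_mult_distrib)
  also have "\<dots> = - 2 * (K * A - N * M) / A\<^sup>2"
    using assms(3,6) by (simp add: divide_simps)
  also have "\<dots> = cross_form X Xh w"
    by (simp add: cross_form_def A_def K_def M_def N_def)
  finally show ?thesis .
qed

lemma (in envelope_frame) \<theta>_cross_form:
  assumes w: "w \<in> S"
  shows "\<theta> w = cross_form Y Yh w"
proof -
  have "\<mu> w = 2 * mink (dz Y w) (Yh w)" by (simp add: \<mu>_def mink_commute)
  then show ?thesis using YYh[OF w] by (simp add: \<theta>_def P_def cross_form_def mink_simps)
qed

text \<open>
  In the cmc-1 case \<open>Z\<close> is the real normal vector \<open>\<kappa> / \<theta>\<close>, rescaled, and the only element of this set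
  is the constant vector that determines the hyperbolic space; in the other cases the set is empty.
\<close>

definition horo_vectors ::
    "(complex \<Rightarrow> real^'n::finite) \<Rightarrow> (complex \<Rightarrow> real^'n) \<Rightarrow> complex \<Rightarrow> (real^('n option)) set" where
  "horo_vectors p ph w = {Q. cross_form (lightcone p) (lightcone ph) w \<noteq> 0 \<and>
     (\<exists>Z. mink Z Z > 0 \<and> (\<forall>v\<in>CV (lightcone p) w. mink (cvec Z) v = 0) \<and>
        dz (dz (lightcone p)) w - cross_form (lightcone p) (lightcone ph) w *s cvec Z \<in> CV (lightcone p) w \<and>
        Q = - ((1 / sqrt (mink Z Z)) *\<^sub>R Z + (2 * sqrt (mink Z Z) / (1 - p w \<bullet> ph w)) *\<^sub>R null_vec (ph w)))}"

locale envelope_chart = conformal_immersion S p + hat: conformal_immersion S ph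
  for S and p ph :: "complex \<Rightarrow> real^'n::finite" +
  assumes ne: "w \<in> S \<Longrightarrow> p w \<noteq> ph w"
    and XhV: "w \<in> S \<Longrightarrow> lightcone ph w \<in> CV (lightcone p) w"
    and XhzV: "w \<in> S \<Longrightarrow> dz (lightcone ph) w \<in> CV (lightcone p) w"
begin

lemma separated: "w \<in> S \<Longrightarrow> 1 - p w \<bullet> ph w > 0"
proof -
  assume w: "w \<in> S"
  have n: "p w \<bullet> p w = 1" "ph w \<bullet> ph w = 1"
    using sphere[OF w] hat.sphere[OF w] by (simp_all add: dot_square_norm)
  have "(p w - ph w) \<bullet> (p w - ph w) > 0" using ne[OF w] by simp
  then show ?thesis using n by (simp add: inner_diff inner_commute[of "ph w" "p w"])
qed

text \<open>The factor for which <Y, Yh> = -1, given \<open>mink_X_Xh\<close> and the factor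
  \<open>r\<close> of \<open>Y\<close>.\<close>

definition "t w = inverse (r w * (1 - p w \<bullet> ph w))"
definition "Y = cvec \<circ> Yr"
definition "Yh w = complex_of_real (t w) *s lightcone ph w"

lemma Y_X: "Y w = complex_of_real (r w) *s lightcone p w"
  unfolding Y_def by (rule cvec_Yr)

lemma t_pos: "w \<in> S \<Longrightarrow> t w > 0"
  using r_pos separated by (simp add: t_def)

lemma smooth_t: "Cinf_on t S"
  unfolding t_def [abs_def]
proof (rule Cinf_on_inverse[OF op])
  show "Cinf_on (\<lambda>w. r w * (1 - p w \<bullet> ph w)) S"
    by (intro Cinf_on_bilinear[OF op bounded_bilinear_mult] Cinf_on_diff[OF op]
        Cinf_on_bilinear[OF op bounded_bilinear_inner] Cinf_on_const smooth_r smooth_p hat.smooth_p)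
qed (use r_pos separated in force)

lemma smooth_Y: "Cinf_on Y S"
  unfolding Y_def by (rule Cinf_on_cvec[OF op smooth_Yr])

lemma smooth_Yh: "Cinf_on Yh S"
  unfolding Yh_def [abs_def] by (intro Cinf_on_smult[OF op] Cinf_on_of_real[OF op] smooth_t hat.smooth_X)

lemma CV_Y:
  assumes w: "w \<in> S"
  shows "CV Y w = CV (lightcone p) w"
  using CV_scale[of S r "lightcone p" w Y] op smooth_r smooth_X w Y_X r_pos by force

lemma scale_Y:
  assumes w: "w \<in> S"
  shows "dz Y w = ddz (\<lambda>x. complex_of_real (r x)) w *s lightcone p w + complex_of_real (r w) *s dz (lightcone p) w"
    "dz (dz Y) w - complex_of_real (r w) *s dz (dz (lightcone p)) w \<in> CV (lightcone p) w"
  using CV_scale_subset(2,3)[of S "\<lambda>x. complex_of_real (r x)" "lightcone p" w Y] op Cinf_on_of_real[OF op smooth_r] smooth_X w Y_X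
  by auto

lemma scale_Yh:
  assumes w: "w \<in> S"
  shows "dz Yh w = ddz (\<lambda>x. complex_of_real (t x)) w *s lightcone ph w + complex_of_real (t w) *s dz (lightcone ph) w"
  using CV_scale_subset(3)[of S "\<lambda>x. complex_of_real (t x)" "lightcone ph" w Yh] op Cinf_on_of_real[OF op smooth_t] hat.smooth_X w
  by (auto simp: Yh_def)

lemma mink_X_Xh: "mink (lightcone p w) (lightcone ph w) = - complex_of_real (1 - p w \<bullet> ph w)"
  by (simp add: lightcone_def mink_cvec mink_null_vec)

sublocale frame: envelope_frame S Y Yh
proof
  fix w assume w: "w \<in> S"
  show "cnjv (Y w) = Y w" "cnjv (Yh w) = Yh w"
    by (simp_all add: Y_X Yh_def realX hat.realX)
  show "mink (Y w) (Y w) = 0" "mink (Yh w) (Yh w) = 0"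
    by (simp_all add: Y_X Yh_def mink_simps XX[OF w] hat.XX[OF w])
  have "complex_of_real (r w) * (complex_of_real (t w) * complex_of_real (1 - p w \<bullet> ph w)) = 1"
    using r_pos[OF w] separated[OF w] by (simp add: t_def field_simps flip: of_real_mult)
  then show "mink (Y w) (Yh w) = -1"
    by (simp add: Y_X Yh_def mink_simps mink_X_Xh mult.left_commute del: of_real_diff)
  show "mink (dz Y w) (dz Y w) = 0" "mink (dz Y w) (dzbar Y w) = 1 / 2"
    using canonical_lift w by (auto simp: canonical_lift_def Y_def)
  show "Yh w \<in> CV Y w" "dz Yh w \<in> CV Y w"
    unfolding CV_Y[OF w] scale_Yh[OF w] by (simp_all add: Yh_def CV_smult CV_add XhV[OF w] XhzV[OF w])
  show "mink (dz Yh w) (dz Yh w) = 0"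
    using hat.rescaled_lift(1)[of t w Yh] smooth_t w by (simp add: Yh_def)
  have "mink (dz Yh w) (dzbar Yh w) = complex_of_real ((t w)\<^sup>2 * hat.e w / 2)"
    using hat.rescaled_lift(2)[of t w Yh] smooth_t w by (simp add: Yh_def)
  moreover have "(t w)\<^sup>2 * hat.e w / 2 \<noteq> 0" using t_pos[OF w] hat.e_pos[OF w] by simp
  ultimately show "mink (dz Yh w) (dzbar Yh w) \<noteq> 0" by (metis of_real_eq_0_iff)
qed (rule op smooth_Y smooth_Yh)+

lemma \<theta>_eq: "w \<in> S \<Longrightarrow> frame.\<theta> w = cross_form (lightcone p) (lightcone ph) w"
  unfolding frame.\<theta>_cross_form
  using r_pos[of w] t_pos[of w]
  by (intro cross_form_scale[OF scale_Y(1) Y_X _ scale_Yh Yh_def]) auto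

lemma mink_cvec_Y: "mink (cvec u) (Y w) = complex_of_real (r w * mink u (null_vec (p w)))"
  and mink_cvec_Yh: "mink (cvec u) (Yh w) = complex_of_real (t w * mink u (null_vec (ph w)))"
  by (simp_all add: Y_X Yh_def mink_simps lightcone_def mink_cvec)

lemma definite:
  assumes w: "w \<in> S" and "mink (cvec u) (Y w) = 0" "mink (cvec u) (Yh w) = 0"
  shows "mink u u \<ge> 0 \<and> (mink u u = 0 \<longrightarrow> u = 0)"
proof -
  have "mink u (null_vec (p w)) = 0" "mink u (null_vec (ph w)) = 0"
    using assms(2,3) r_pos[OF w] t_pos[OF w] by (simp_all add: mink_cvec_Y mink_cvec_Yh)
  then show ?thesis
    using mink_orthogonal_null_vecs[OF sphere[OF w] hat.sphere[OF w] ne[OF w]] by blast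
qed

text \<open>Modulo V both terms represent the second derivative of \<open>Y\<close>: the first by
  rescaling, the second by \<open>Yzz\<close>. So \<open>\<kappa>\<close> is visible in the
  unnormalised lift.\<close>

lemma Xzz_\<kappa>:
  assumes w: "w \<in> S"
  shows "complex_of_real (r w) *s dz (dz (lightcone p)) w - frame.\<kappa> w \<in> CV (lightcone p) w"
proof -
  have "dz (dz Y) w - frame.\<kappa> w \<in> CV Y w"
    unfolding frame.Yzz[OF w] using CV_smult[OF CV_base(1)[of Y w], of "- ((ddz frame.\<mu> w - (frame.\<mu> w)\<^sup>2 / 2 - frame.\<theta> w) / 2)"]
    by (simp add: vec.scale_minus_left)
  then have "(dz (dz Y) w - frame.\<kappa> w) - (dz (dz Y) w - complex_of_real (r w) *s dz (dz (lightcone p)) w) \<in> CV (lightcone p) w"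
    using scale_Y(2)[OF w] unfolding CV_Y[OF w] by (rule CV_diff)
  then show ?thesis by simp
qed

text \<open>If \<open>\<theta>\<close> is nonzero but \<open>\<kappa>\<close> vanishes, the second
  derivative of the lift lies in V, and so does any admissible Z. Being also orthogonal to V, Z
  would be isotropic.\<close>

lemma horo_vectors_empty:
  assumes w: "w \<in> S" and "frame.\<theta> w = 0 \<or> frame.\<kappa> w = 0"
  shows "horo_vectors p ph w = {}"
proof (rule ccontr)
  let ?X = "lightcone p"
  assume "horo_vectors p ph w \<noteq> {}"
  then obtain Z where c: "frame.\<theta> w \<noteq> 0" and Z: "mink Z Z > 0" "\<And>v. v \<in> CV ?X w \<Longrightarrow> mink (cvec Z) v = 0"
    "dz (dz ?X) w - frame.\<theta> w *s cvec Z \<in> CV ?X w"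
    unfolding horo_vectors_def \<theta>_eq[OF w] by auto
  then have "frame.\<kappa> w = 0" using assms(2) by simp
  then have "complex_of_real (r w) *s dz (dz ?X) w \<in> CV ?X w" using Xzz_\<kappa>[OF w] by simp
  then have "inverse (complex_of_real (r w)) *s (complex_of_real (r w) *s dz (dz ?X) w) \<in> CV ?X w"
    by (rule CV_smult)
  then have "dz (dz ?X) w \<in> CV ?X w" using r_pos[OF w] by simp
  from CV_diff[OF this Z(3)] have "inverse (frame.\<theta> w) *s (frame.\<theta> w *s cvec Z) \<in> CV ?X w"
    by (intro CV_smult[of "frame.\<theta> w *s cvec Z"]) simp
  then have "cvec Z \<in> CV ?X w" using c by simp
  from Z(2)[OF this] show False using Z(1) by (simp add: mink_cvec)
qed

text \<open>Two admissible Z differ by a vector that is both in V and orthogonal to V, so Z is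
  unique; it remains to recognise it as a multiple of \<open>\<xi>\<close>.\<close>

lemma horo_vectors_eq:
  assumes B: "cmc_frame B Y Yh" "B \<subseteq> S" and w: "w \<in> B" and k: "frame.\<kappa> w \<noteq> 0"
  shows "horo_vectors p ph w = {Q. cvec Q = - cmc_frame.q Y Yh w}" (is "?l = ?r")
    and "\<exists>Q. horo_vectors p ph w = {Q}"
proof -
  interpret C: cmc_frame B Y Yh by (rule B)
  have w': "w \<in> S" using w B by auto
  note [simp] = \<theta>_eq[OF w', symmetric]
  let ?X = "lightcone p"
  define x where "x = (\<chi> i. Re (C.\<xi> w $ i))"
  have x: "C.\<xi> w = cvec x" using real_vector_is_cvec[OF C.\<xi>_real[OF w]] by (simp add: x_def)
  have h: "C.h w = complex_of_real (mink x x)" by (simp add: C.h_def x mink_cvec)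
  have hpos: "mink x x > 0" using C.Re_h_pos[OF w k] h by simp
  \<comment> \<open>Modulo V the second derivative of the lift is \<kappa> / r = \<theta> \<xi> / r,
    which dictates this multiple.\<close>
  define Z0 where "Z0 = (1 / r w) *\<^sub>R x"
  have r: "r w > 0" by (rule r_pos[OF w'])
  have xperp: "mink (cvec x) v = 0" if "v \<in> CV ?X w" for v
    using that C.\<kappa>_perp[OF w, of v] by (simp add: x[symmetric] C.\<xi>_def mink_simps CV_Y[OF w'])
  have Z0: "mink Z0 Z0 > 0" "\<And>v. v \<in> CV ?X w \<Longrightarrow> mink (cvec Z0) v = 0"
    using hpos r xperp by (simp_all add: Z0_def mink_simps cvec_simps)
  have e: "dz (dz ?X) w - frame.\<theta> w *s cvec Z0 \<in> CV ?X w"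
  proof -
    have "inverse (complex_of_real (r w)) *s (complex_of_real (r w) *s dz (dz ?X) w - frame.\<kappa> w) \<in> CV ?X w"
      by (intro CV_smult Xzz_\<kappa> w')
    also have "inverse (complex_of_real (r w)) *s (complex_of_real (r w) *s dz (dz ?X) w - frame.\<kappa> w)
        = dz (dz ?X) w - frame.\<theta> w *s cvec Z0"
      using r by (simp add: C.\<kappa>_\<xi>[OF w] x Z0_def cvec_simps vec_eq_iff field_simps)
    finally show ?thesis .
  qed
  have sq: "sqrt (mink Z0 Z0) = sqrt (mink x x) / r w"
    using r by (simp add: Z0_def mink_simps real_sqrt_mult real_sqrt_divide)
  define Q0 where "Q0 = - ((1 / sqrt (mink Z0 Z0)) *\<^sub>R Z0 + (2 * sqrt (mink Z0 Z0) / (1 - p w \<bullet> ph w)) *\<^sub>R null_vec (ph w))"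
  have "sqrt (mink x x) > 0" using hpos by simp
  \<comment> \<open>The powers of r cancel: the unit vector ignores the scale of Z, and 1 / r
    together with the denominator is \<open>t\<close>.\<close>
  then have "Q0 = - ((1 / sqrt (mink x x)) *\<^sub>R x + (2 * sqrt (mink x x) * t w) *\<^sub>R null_vec (ph w))"
    unfolding Q0_def sq using r by (simp add: Z0_def t_def divide_inverse mult.assoc)
  moreover have "C.g w = complex_of_real (sqrt (mink x x))" by (simp add: C.g_def h)
  ultimately have Q0q: "cvec Q0 = - C.q w"
    unfolding C.q_def x Yh_def lightcone_def by (simp add: cvec_simps divide_inverse)
  have 1: "horo_vectors p ph w = {Q0}"
  proof (intro equalityI subsetI)
    fix Q assume "Q \<in> horo_vectors p ph w"
    then obtain Z where Z: "mink Z Z > 0" "\<And>v. v \<in> CV ?X w \<Longrightarrow> mink (cvec Z) v = 0"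
      "dz (dz ?X) w - frame.\<theta> w *s cvec Z \<in> CV ?X w"
      and Q: "Q = - ((1 / sqrt (mink Z Z)) *\<^sub>R Z + (2 * sqrt (mink Z Z) / (1 - p w \<bullet> ph w)) *\<^sub>R null_vec (ph w))"
      unfolding horo_vectors_def by auto
    have "inverse (frame.\<theta> w) *s ((dz (dz ?X) w - frame.\<theta> w *s cvec Z) - (dz (dz ?X) w - frame.\<theta> w *s cvec Z0)) \<in> CV ?X w"
      by (intro CV_smult CV_diff Z e)
    also have "inverse (frame.\<theta> w) *s ((dz (dz ?X) w - frame.\<theta> w *s cvec Z) - (dz (dz ?X) w - frame.\<theta> w *s cvec Z0)) = cvec Z0 - cvec Z"
      using C.\<theta>0[OF w] by (simp add: vec_eq_iff field_simps)
    finally have "cvec Z0 - cvec Z \<in> CV Y w" by (simp add: CV_Y[OF w'])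
    then have "cvec Z0 - cvec Z = 0"
      by (rule frame.CV_orthogonal_zero[OF w']) (simp add: CV_Y[OF w'] mink_simps Z Z0)
    then have "Z = Z0" by simp
    then show "Q \<in> {Q0}" using Q by (simp add: Q0_def)
  next
    fix Q assume "Q \<in> {Q0}"
    then show "Q \<in> horo_vectors p ph w"
      unfolding horo_vectors_def using Z0 e C.\<theta>0[OF w] by (auto simp: Q0_def)
  qed
  then show "\<exists>Q. horo_vectors p ph w = {Q}" by blast
  show "?l = ?r" unfolding 1 Q0q[symmetric] by auto
qed

lemma cmc_frame_restrict:
  assumes "open B" "B \<subseteq> S" "\<And>w. w \<in> B \<Longrightarrow> frame.\<theta> w \<noteq> 0"
  shows "cmc_frame B Y Yh"
proof -
  interpret E: envelope_frame B Y Yh by (rule frame.restrict[OF assms(1,2)])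
  show ?thesis
  proof
    fix w assume w: "w \<in> B"
    show "E.\<rho> w = 0" using E.\<theta>\<rho>[OF w] assms(3)[OF w] by simp
  qed (use definite assms(2) in blast)
qed

text \<open>Where \<open>\<theta>\<close> vanishes, \<open>\<rho>\<close> does not, also nearby, and
  \<theta> \<rho> = 0 keeps \<open>\<theta>\<close> zero there. Where \<open>\<theta>\<close> is
  nonzero, either \<open>\<kappa>\<close> vanishes on a neighbourhood by the linear equation for
  \<open>h\<close>, or \<open>q\<close> is locally constant.\<close>

lemma horo_vectors_locally_constant:
  assumes w0: "w0 \<in> S"
  shows "\<exists>\<delta>>0. ball w0 \<delta> \<subseteq> S \<and> (\<forall>w\<in>ball w0 \<delta>. horo_vectors p ph w = horo_vectors p ph w0)"
proof (cases "frame.\<theta> w0 = 0")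
  case True
  then have "frame.\<rho> w0 \<noteq> 0" using frame.\<theta>\<rho>_nonzero[OF w0] by simp
  then obtain \<delta> where \<delta>: "\<delta> > 0" "ball w0 \<delta> \<subseteq> S" "\<forall>x\<in>ball w0 \<delta>. frame.\<rho> x \<noteq> 0"
    using frame.nonzero_nearby[OF frame.smooth_\<rho> w0] by blast
  have "horo_vectors p ph w = {}" if "w \<in> ball w0 \<delta>" for w
  proof -
    have "w \<in> S" using \<delta> that by blast
    moreover have "frame.\<theta> w = 0" using frame.\<theta>\<rho>[OF \<open>w \<in> S\<close>] \<delta> that by simp
    ultimately show ?thesis using horo_vectors_empty by blast
  qed
  then show ?thesis using \<delta>(1,2) centre_in_ball by metis
next
  case False
  then obtain d where d: "d > 0" "ball w0 d \<subseteq> S" "\<forall>x\<in>ball w0 d. frame.\<theta> x \<noteq> 0"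
    using frame.nonzero_nearby[OF frame.smooth_\<theta> w0] by blast
  have C': "cmc_frame (ball w0 d) Y Yh" using d by (intro cmc_frame_restrict) auto
  interpret C: cmc_frame "ball w0 d" Y Yh by (rule C')
  have w0': "w0 \<in> ball w0 d" using d by simp
  show ?thesis
  proof (cases "frame.\<kappa> w0 = 0")
    case True
    obtain \<delta> where \<delta>: "\<delta> > 0" "ball w0 \<delta> \<subseteq> ball w0 d" "\<forall>w\<in>ball w0 \<delta>. frame.\<kappa> w = 0"
      using C.\<kappa>_locally_zero[OF w0' True] by blast
    have "horo_vectors p ph w = {}" if "w \<in> ball w0 \<delta>" for w
      using horo_vectors_empty[of w] \<delta> d that by blast
    then show ?thesis using \<delta>(1,2) d(2) centre_in_ball by (metis order_trans)
  next
    case False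
    obtain \<delta> where \<delta>: "\<delta> > 0" "ball w0 \<delta> \<subseteq> ball w0 d" "\<forall>w\<in>ball w0 \<delta>. frame.\<kappa> w \<noteq> 0 \<and> C.q w = C.q w0"
      using C.q_locally_constant[OF w0' False] by blast
    have "horo_vectors p ph w = horo_vectors p ph w0" if "w \<in> ball w0 \<delta>" for w
      using horo_vectors_eq(1)[OF C' d(2), of w] horo_vectors_eq(1)[OF C' d(2) w0' False] \<delta>(2,3) that by auto
    then show ?thesis using \<delta>(1,2) d(2) by (metis order_trans)
  qed
qed

section \<open>The Willmore operator on the Hopf differential\<close>

lemma normal_proj_eq:
  assumes w: "w \<in> S" and perp: "\<And>v. v \<in> CV Y w \<Longrightarrow> mink \<eta> v = 0" and d: "\<psi> - \<eta> \<in> CV Y w"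
  shows "normal_proj (V_space Yr w) \<psi> = \<eta>"
  unfolding normal_proj_def complexified_V_space[OF op smooth_Yr w] complex_perp_V_space[OF op smooth_Yr w] Y_def[symmetric]
proof (rule the_equality)
  fix \<eta>' assume a: "\<eta>' \<in> {\<eta>. \<forall>v\<in>CV Y w. mink \<eta> v = 0} \<and> \<psi> - \<eta>' \<in> CV Y w"
  have "(\<psi> - \<eta>) - (\<psi> - \<eta>') \<in> CV Y w" using a by (intro CV_diff[OF d]) simp
  then have "\<eta>' - \<eta> \<in> CV Y w" by simp
  then have "\<eta>' - \<eta> = 0"
    by (rule frame.CV_orthogonal_zero[OF w]) (use a perp in \<open>simp add: mink_simps\<close>)
  then show "\<eta>' = \<eta>" by simp
qed (use perp d in auto)

lemma D_zbar_\<kappa>: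
  assumes w: "w \<in> S"
  shows "D_zbar Yr frame.\<kappa> w = (- cnj (frame.\<mu> w) / 2) *s frame.\<kappa> w"
  unfolding D_zbar_def
proof (rule normal_proj_eq[OF w])
  have e: "dzbar frame.\<kappa> w - (- cnj (frame.\<mu> w) / 2) *s frame.\<kappa> w
      = (- (2 * mink (frame.\<kappa> w) (cnjv (frame.\<kappa> w)))) *s frame.P w"
    unfolding frame.\<kappa>zb[OF w] by (simp add: vec_eq_iff)
  show "dzbar frame.\<kappa> w - (- cnj (frame.\<mu> w) / 2) *s frame.\<kappa> w \<in> CV Y w"
    unfolding e by (rule CV_smult[OF frame.frame_in_CV(2)[OF w]])
qed (simp add: mink_simps frame.\<kappa>_perp[OF w])

definition "schwarzian w = ddz frame.\<mu> w - (frame.\<mu> w)\<^sup>2 / 2 - frame.\<theta> w"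

lemma invariants: "invariants S p Yr schwarzian frame.\<kappa>"
  unfolding invariants_def
proof (intro conjI ballI canonical_lift)
  fix w assume w: "w \<in> S"
  show "frame.\<kappa> w \<in> complex_perp (V_space Yr w)"
    unfolding complex_perp_V_space[OF op smooth_Yr w] Y_def[symmetric] using frame.\<kappa>_perp[OF w] by blast
  show "dz (dz (cvec \<circ> Yr)) w + (schwarzian w / 2) *s cvec (Yr w) = frame.\<kappa> w"
    using frame.Yzz[OF w] unfolding schwarzian_def Y_def by simp
qed

text \<open>With D \<kappa> = c \<kappa> and c = - conj(\<mu>)/2, the second derivative is (c_zbar +
  c^2) \<kappa>. The Schwarzian from \<open>Yzz\<close> cancels both terms and leaves only
  \<open>\<theta>\<close>.\<close>

lemma willmore_operator:
  assumes w: "w \<in> S"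
  shows "D_zbar Yr (D_zbar Yr frame.\<kappa>) w + (cnj (schwarzian w) / 2) *s frame.\<kappa> w
    = (- cnj (frame.\<theta> w) / 2) *s frame.\<kappa> w"
proof -
  note D = frame.diff[OF _ w]
  let ?c = "\<lambda>w. - cnj (frame.\<mu> w) / 2"
  have sc: "Cinf_on ?c S"
    using Cinf_on_mult[OF op Cinf_on_const[of "- 1/2"] Cinf_on_cnj[OF op frame.smooth_\<mu>]] by simp
  have "ddzbar (\<lambda>w. (- 1/2) * cnj (frame.\<mu> w)) w = - cnj (ddz frame.\<mu> w) / 2"
    using ddzbar_mult[OF D[OF Cinf_on_const[of "- 1/2"]] D[OF Cinf_on_cnj[OF op frame.smooth_\<mu>]]]
      ddzbar_cnj[OF D[OF frame.smooth_\<mu>]] by simp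
  then have c: "ddzbar ?c w = - cnj (ddz frame.\<mu> w) / 2" by simp
  have "dzbar (D_zbar Yr frame.\<kappa>) w = dzbar (\<lambda>w. ?c w *s frame.\<kappa> w) w"
    by (rule dzbar_cong[OF op w]) (rule D_zbar_\<kappa>)
  also have "\<dots> = ddzbar ?c w *s frame.\<kappa> w + ?c w *s dzbar frame.\<kappa> w"
    by (rule dzbar_smult[OF D[OF sc] D[OF frame.smooth_\<kappa>]])
  finally have d: "dzbar (D_zbar Yr frame.\<kappa>) w = \<dots>" .
  define \<eta> where "\<eta> = (- cnj (ddz frame.\<mu> w) / 2 + (cnj (frame.\<mu> w))\<^sup>2 / 4) *s frame.\<kappa> w"
  have "D_zbar Yr (D_zbar Yr frame.\<kappa>) w = \<eta>"
    unfolding D_zbar_def[of Yr "D_zbar Yr frame.\<kappa>"]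
  proof (rule normal_proj_eq[OF w])
    have e: "dzbar (D_zbar Yr frame.\<kappa>) w - \<eta>
       = (cnj (frame.\<mu> w) * mink (frame.\<kappa> w) (cnjv (frame.\<kappa> w))) *s frame.P w"
      unfolding d c frame.\<kappa>zb[OF w] \<eta>_def by (simp add: vec_eq_iff field_simps power2_eq_square)
    show "dzbar (D_zbar Yr frame.\<kappa>) w - \<eta> \<in> CV Y w"
      unfolding e by (rule CV_smult[OF frame.frame_in_CV(2)[OF w]])
  qed (simp add: \<eta>_def mink_simps frame.\<kappa>_perp[OF w])
  then show ?thesis
    by (simp add: \<eta>_def schwarzian_def vec_eq_iff field_simps power2_eq_square)
qed

lemma s_willmore_chart:
  assumes "\<And>w. w \<in> S \<Longrightarrow> horo_vectors p ph w = {}"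
  shows "\<exists>Y s \<kappa>. invariants S p Y s \<kappa> \<and>
      (\<forall>w\<in>S. D_zbar Y (D_zbar Y \<kappa>) w + (cnj (s w) / 2) *s \<kappa> w = 0) \<and>
      (\<forall>w\<in>S. \<exists>a b :: complex. (a \<noteq> 0 \<or> b \<noteq> 0) \<and> a *s \<kappa> w + b *s D_zbar Y \<kappa> w = 0)"
proof (intro exI conjI ballI)
  show "invariants S p Yr schwarzian frame.\<kappa>" by (rule invariants)
  fix w assume w: "w \<in> S"
  \<comment> \<open>Otherwise a neighbourhood of \<open>w\<close> falls under
    \<open>cmc_frame\<close>, where the set is a singleton.\<close>
  have "frame.\<theta> w = 0 \<or> frame.\<kappa> w = 0"
  proof (rule ccontr)
    assume n: "\<not> (frame.\<theta> w = 0 \<or> frame.\<kappa> w = 0)"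
    then obtain d where d: "d > 0" "ball w d \<subseteq> S" "\<forall>x\<in>ball w d. frame.\<theta> x \<noteq> 0"
      using frame.nonzero_nearby[OF frame.smooth_\<theta> w] by blast
    then have "cmc_frame (ball w d) Y Yh" by (intro cmc_frame_restrict) auto
    from horo_vectors_eq(2)[OF this d(2), of w] obtain Q where "horo_vectors p ph w = {Q}"
      using d(1) n by auto
    then show False using assms[OF w] by simp
  qed
  then show "D_zbar Yr (D_zbar Yr frame.\<kappa>) w + (cnj (schwarzian w) / 2) *s frame.\<kappa> w = 0"
    unfolding willmore_operator[OF w] by auto
  \<comment> \<open>The relation with coefficients conj(\<mu>)/2 and 1 comes from
    \<open>D_zbar_\<kappa>\<close>; the 1 makes it nontrivial at every point.\<close>
  show "(cnj (frame.\<mu> w) / 2 \<noteq> 0 \<or> (1::complex) \<noteq> 0)" by simp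
  show "(cnj (frame.\<mu> w) / 2) *s frame.\<kappa> w + 1 *s D_zbar Yr frame.\<kappa> w = 0"
    unfolding D_zbar_\<kappa>[OF w] by (simp add: vec_eq_iff)
qed

end


section \<open>Invariance under holomorphic coordinate changes\<close>

lemma CV_compose:
  assumes "open U" "\<phi> holomorphic_on U" "w \<in> U" "open S" "\<And>x. x \<in> U \<Longrightarrow> \<phi> x \<in> S" "Cinf_on X S"
    and Y: "\<And>x. x \<in> U \<Longrightarrow> Y x = X (\<phi> x)" and nz: "deriv \<phi> w \<noteq> 0"
  shows "CV Y w = CV X (\<phi> w)"
proof
  let ?a = "deriv \<phi> w"
  have d: "dz Y w = ?a *s dz X (\<phi> w)" "dzbar Y w = cnj ?a *s dzbar X (\<phi> w)"
    "dz (dzbar Y) w = (cnj ?a * ?a) *s dz (dzbar X) (\<phi> w)"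
    using dz_compose_holomorphic[of U \<phi> w S X Y] assms by auto
  have "{Y w, dz Y w, dzbar Y w, dz (dzbar Y) w} \<subseteq> CV X (\<phi> w)"
    unfolding d Y[OF assms(3)] by (auto intro!: CV_smult CV_base)
  then show "CV Y w \<subseteq> CV X (\<phi> w)"
    unfolding CV_def by (intro vec.span_minimal vec.subspace_span)
  have "X (\<phi> w) = Y w" "dz X (\<phi> w) = inverse ?a *s dz Y w"
    "dzbar X (\<phi> w) = inverse (cnj ?a) *s dzbar Y w"
    using nz unfolding d Y[OF assms(3)] by simp_all
  moreover have "inverse (cnj ?a * ?a) * (cnj ?a * ?a) = 1"
    using nz by (intro left_inverse) simp
  then have "dz (dzbar X) (\<phi> w) = inverse (cnj ?a * ?a) *s dz (dzbar Y) w"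
    by (simp only: d vec.scale_scale vec.scale_one)
  ultimately have "{X (\<phi> w), dz X (\<phi> w), dzbar X (\<phi> w), dz (dzbar X) (\<phi> w)} \<subseteq> CV Y w"
    by (auto intro!: CV_smult CV_base)
  then show "CV X (\<phi> w) \<subseteq> CV Y w"
    unfolding CV_def by (intro vec.span_minimal vec.subspace_span)
qed

text \<open>\<open>cross_form\<close> and the second derivative modulo V both acquire the factor
  \<phi>'^2, so the condition on Z is unchanged, and Q depends only on Z and the two points of the
  sphere.\<close>

lemma horo_vectors_compose:
  assumes U: "open U" "\<phi> holomorphic_on U" "w \<in> U" and S: "open S" "\<And>x. x \<in> U \<Longrightarrow> \<phi> x \<in> S"
    and p: "Cinf_on p S" "Cinf_on ph S" and nz: "deriv \<phi> w \<noteq> 0"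
    and eq: "\<And>x. x \<in> U \<Longrightarrow> p' x = p (\<phi> x)" "\<And>x. x \<in> U \<Longrightarrow> ph' x = ph (\<phi> x)"
  shows "horo_vectors p' ph' w = horo_vectors p ph (\<phi> w)"
proof -
  let ?X = "lightcone p" and ?Xh = "lightcone ph" and ?X' = "lightcone p'" and ?Xh' = "lightcone ph'"
  let ?a = "deriv \<phi> w"
  have s: "Cinf_on ?X S" "Cinf_on ?Xh S"
    unfolding lightcone_def [abs_def]
    by (intro Cinf_on_linear[OF S(1) linear_cvec] Cinf_on_null_vec[OF S(1)] p)+
  have e: "\<And>x. x \<in> U \<Longrightarrow> ?X' x = ?X (\<phi> x)" "\<And>x. x \<in> U \<Longrightarrow> ?Xh' x = ?Xh (\<phi> x)"
    by (simp_all add: lightcone_def eq)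
  have dX: "dz ?X' w = ?a *s dz ?X (\<phi> w)"
    "dz (dz ?X') w = deriv (deriv \<phi>) w *s dz ?X (\<phi> w) + ?a\<^sup>2 *s dz (dz ?X) (\<phi> w)"
    using dz_compose_holomorphic[of U \<phi> w S ?X ?X'] U S s e by auto
  have dXh: "dz ?Xh' w = ?a *s dz ?Xh (\<phi> w)"
    using dz_compose_holomorphic[of U \<phi> w S ?Xh ?Xh'] U S s e by auto
  have CV: "CV ?X' w = CV ?X (\<phi> w)"
    by (rule CV_compose[OF U S s(1) e(1) nz])
  have c: "cross_form ?X' ?Xh' w = ?a\<^sup>2 * cross_form ?X ?Xh (\<phi> w)"
    unfolding cross_form_def dX dXh e[OF U(3)]
    by (simp add: mink_simps algebra_simps power2_eq_square)
  have "dz (dz ?X') w - cross_form ?X' ?Xh' w *s cvec Z \<in> CV ?X (\<phi> w) \<longleftrightarrow>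
      dz (dz ?X) (\<phi> w) - cross_form ?X ?Xh (\<phi> w) *s cvec Z \<in> CV ?X (\<phi> w)" (is "?l \<longleftrightarrow> ?r") for Z
  proof -
    let ?v = "dz (dz ?X) (\<phi> w) - cross_form ?X ?Xh (\<phi> w) *s cvec Z"
    have 1: "dz (dz ?X') w - cross_form ?X' ?Xh' w *s cvec Z = deriv (deriv \<phi>) w *s dz ?X (\<phi> w) + ?a\<^sup>2 *s ?v"
      unfolding dX c by (simp add: vec_eq_iff algebra_simps)
    have 2: "?v = inverse (?a\<^sup>2) *s ((deriv (deriv \<phi>) w *s dz ?X (\<phi> w) + ?a\<^sup>2 *s ?v) - deriv (deriv \<phi>) w *s dz ?X (\<phi> w))"
      using nz by simp
    show ?thesis
    proof
      assume ?l then show ?r unfolding 1 by (subst 2) (intro CV_smult[of "_ - _"] CV_diff CV_smult[of "dz ?X (\<phi> w)"] CV_base)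
    next
      assume ?r then show ?l unfolding 1 by (intro CV_smult CV_add CV_base)
    qed
  qed
  then show ?thesis
    unfolding horo_vectors_def CV c[symmetric] using nz c by (simp add: eq[OF U(3)])
qed

section \<open>Orthogonal bases of signature (4, 1)\<close>

lemma mink_orthogonal_independent:
  fixes S :: "(real^('n::finite option)) set"
  assumes "\<And>x. x \<in> S \<Longrightarrow> mink x x \<noteq> 0" "\<And>x y. x \<in> S \<Longrightarrow> y \<in> S \<Longrightarrow> x \<noteq> y \<Longrightarrow> mink x y = 0"
  shows "independent S"
  unfolding dependent_def
proof (intro notI, elim bexE)
  fix a assume a: "a \<in> S" "a \<in> span (S - {a})"
  have "mink a y = 0" if "y \<in> span (S - {a})" for y
    using that
  proof (induction rule: span_induct_alt)
    case (step c x y)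
    then show ?case using assms(2)[of a x] a(1) by (auto simp: mink_simps)
  qed (simp add: mink_simps)
  then show False using a assms(1) by blast
qed

lemma span4:
  fixes a :: "'b::real_vector"
  assumes "x \<in> span {a, b, c, d}"
  shows "\<exists>\<alpha> \<beta> \<gamma> \<delta>. x = \<alpha> *\<^sub>R a + \<beta> *\<^sub>R b + \<gamma> *\<^sub>R c + \<delta> *\<^sub>R d"
proof -
  obtain \<alpha> \<beta> \<gamma> \<delta> where "x - \<alpha> *\<^sub>R a - \<beta> *\<^sub>R b - \<gamma> *\<^sub>R c - \<delta> *\<^sub>R d = 0"
    using assms unfolding span_insert span_empty by auto
  then have "x = \<alpha> *\<^sub>R a + \<beta> *\<^sub>R b + \<gamma> *\<^sub>R c + \<delta> *\<^sub>R d" by (simp add: algebra_simps)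
  then show ?thesis by blast
qed

definition lorentz_basis :: "real^('n::finite option) \<Rightarrow> real^('n option) \<Rightarrow> real^('n option) \<Rightarrow>
    real^('n option) \<Rightarrow> real^('n option) \<Rightarrow> bool" where
  "lorentz_basis a b c d e \<longleftrightarrow>
     mink a a > 0 \<and> mink b b > 0 \<and> mink c c > 0 \<and> mink d d > 0 \<and> mink e e < 0 \<and>
     mink a b = 0 \<and> mink a c = 0 \<and> mink a d = 0 \<and> mink a e = 0 \<and> mink b c = 0 \<and> mink b d = 0 \<and>
     mink b e = 0 \<and> mink c d = 0 \<and> mink c e = 0 \<and> mink d e = 0"

lemma lorentz_basis_signature:
  assumes "lorentz_basis a b c d e"
  shows "has_signature (span {a, b, c, d, e}) 4 1"
  unfolding has_signature_def
proof (intro exI conjI)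
  note L = assms[unfolded lorentz_basis_def]
  have s: "mink b a = 0" "mink c a = 0" "mink d a = 0" "mink e a = 0" "mink c b = 0" "mink d b = 0"
     "mink e b = 0" "mink d c = 0" "mink e c = 0" "mink e d = 0"
    using L by (simp_all add: mink_commute)
  have n: "a \<noteq> b" "a \<noteq> c" "a \<noteq> d" "b \<noteq> c" "b \<noteq> d" "c \<noteq> d" using L by auto
  show "subspace (span {a, b, c, d})" "subspace (span {e})" by (rule subspace_span)+
  have "independent {a, b, c, d}"
    by (rule mink_orthogonal_independent) (use L s in auto)
  then have "dim (span {a, b, c, d}) = card {a, b, c, d}"
    using dim_eq_card_independent dim_span by metis
  then show "dim (span {a, b, c, d}) = 4" using n by simp
  have "independent {e}" by (rule mink_orthogonal_independent) (use L in auto)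
  then have "dim (span {e}) = card {e}" using dim_eq_card_independent dim_span by metis
  then show "dim (span {e}) = 1" by simp
  show "\<forall>x\<in>span {a, b, c, d}. x \<noteq> 0 \<longrightarrow> mink x x > 0"
  proof (intro ballI impI)
    fix x assume "x \<in> span {a, b, c, d}" and x0: "x \<noteq> 0"
    then obtain \<alpha> \<beta> \<gamma> \<delta> where x: "x = \<alpha> *\<^sub>R a + \<beta> *\<^sub>R b + \<gamma> *\<^sub>R c + \<delta> *\<^sub>R d" using span4 by blast
    have "mink x x = \<alpha>\<^sup>2 * mink a a + \<beta>\<^sup>2 * mink b b + \<gamma>\<^sup>2 * mink c c + \<delta>\<^sup>2 * mink d d"
      unfolding x using L s by (simp add: mink_simps power2_eq_square)
    moreover have "\<alpha> \<noteq> 0 \<or> \<beta> \<noteq> 0 \<or> \<gamma> \<noteq> 0 \<or> \<delta> \<noteq> 0" using x x0 by auto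
    moreover have "\<alpha>\<^sup>2 * mink a a \<ge> 0" "\<beta>\<^sup>2 * mink b b \<ge> 0" "\<gamma>\<^sup>2 * mink c c \<ge> 0" "\<delta>\<^sup>2 * mink d d \<ge> 0"
      using L by simp_all
    moreover have "\<alpha> \<noteq> 0 \<Longrightarrow> \<alpha>\<^sup>2 * mink a a > 0" "\<beta> \<noteq> 0 \<Longrightarrow> \<beta>\<^sup>2 * mink b b > 0"
       "\<gamma> \<noteq> 0 \<Longrightarrow> \<gamma>\<^sup>2 * mink c c > 0" "\<delta> \<noteq> 0 \<Longrightarrow> \<delta>\<^sup>2 * mink d d > 0"
      using L by simp_all
    ultimately show "mink x x > 0" by linarith
  qed
  show "\<forall>y\<in>span {e}. y \<noteq> 0 \<longrightarrow> mink y y < 0"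
  proof (intro ballI impI)
    fix y assume "y \<in> span {e}" "y \<noteq> 0"
    then obtain k where k: "y = k *\<^sub>R e" "k \<noteq> 0" by (auto simp: span_singleton)
    then have "mink y y = k\<^sup>2 * mink e e" by (simp add: mink_simps power2_eq_square)
    then show "mink y y < 0" using k L by (simp add: mult_pos_neg)
  qed
  show "\<forall>x\<in>span {a, b, c, d}. \<forall>y\<in>span {e}. mink x y = 0"
    using L by (auto simp: span_singleton mink_simps dest!: span4)
  have "{a, b, c, d, e} = {a, b, c, d} \<union> {e}" by auto
  then show "span {a, b, c, d, e} = {x + y |x y. x \<in> span {a, b, c, d} \<and> y \<in> span {e}}"
    by (simp only: span_Un)
qed

text \<open>Subtract from x its orthogonal projection to the span. The difference is orthogonal to
  the span, hence by assumption to x and so to itself; definiteness on the complement of a and e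
  makes it zero.\<close>

lemma in_span_lorentz_basis:
  assumes "lorentz_basis a b c d e"
    and pos: "\<And>u. mink u a = 0 \<Longrightarrow> mink u e = 0 \<Longrightarrow> mink u u = 0 \<Longrightarrow> u = 0"
    and x: "\<And>u. mink u a = 0 \<Longrightarrow> mink u b = 0 \<Longrightarrow> mink u c = 0 \<Longrightarrow> mink u d = 0 \<Longrightarrow> mink u e = 0 \<Longrightarrow> mink u x = 0"
  shows "x \<in> span {a, b, c, d, e}"
proof -
  note L = assms(1)[unfolded lorentz_basis_def]
  have s: "mink b a = 0" "mink c a = 0" "mink d a = 0" "mink e a = 0" "mink c b = 0" "mink d b = 0"
     "mink e b = 0" "mink d c = 0" "mink e c = 0" "mink e d = 0"
    using L by (simp_all add: mink_commute)
  define v where "v = (mink x a / mink a a) *\<^sub>R a + (mink x b / mink b b) *\<^sub>R b + (mink x c / mink c c) *\<^sub>R c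
     + (mink x d / mink d d) *\<^sub>R d + (mink x e / mink e e) *\<^sub>R e"
  have u: "mink (x - v) a = 0" "mink (x - v) b = 0" "mink (x - v) c = 0" "mink (x - v) d = 0" "mink (x - v) e = 0"
    unfolding v_def using L s by (simp_all add: mink_simps)
  have "mink (x - v) v = 0" by (subst (2) v_def) (simp add: mink_add_right mink_scaleR_right u)
  then have "mink (x - v) (x - v) = 0" using x[OF u] by (simp add: mink_diff_right)
  then have "x = v" using pos[OF u(1,5)] by simp
  also have "v \<in> span {a, b, c, d, e}"
    unfolding v_def by (intro span_add span_scale span_base) auto
  finally show ?thesis .
qed

section \<open>The surface and its unit normal in hyperbolic space\<close>

locale cmc_chart = envelope_chart S p ph
  for S and p ph :: "complex \<Rightarrow> real^'n::finite" +
  fixes Q :: "real^('n option)"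
  assumes hQ: "w \<in> S \<Longrightarrow> Q \<in> horo_vectors p ph w"
begin

lemma \<theta>_nonzero: "w \<in> S \<Longrightarrow> frame.\<theta> w \<noteq> 0" and \<kappa>_nonzero: "w \<in> S \<Longrightarrow> frame.\<kappa> w \<noteq> 0"
  using horo_vectors_empty hQ by blast+

sublocale cmc: cmc_frame S Y Yh
  by (rule cmc_frame_restrict[OF op order_refl \<theta>_nonzero])

lemma Q_q: "w \<in> S \<Longrightarrow> cvec Q = - cmc.q w"
  using horo_vectors_eq(1)[OF cmc.cmc_frame_axioms order_refl _ \<kappa>_nonzero] hQ by blast

text \<open>Transcribed from \<open>q_inner\<close> with the sign reversed. The last product places
  the second envelope on the boundary sphere of the ball.\<close>

lemma Q_inner:
  assumes w: "w \<in> S"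
  shows "mink Q Q = 1" "mink (null_vec (p w)) Q > 0" "mink (null_vec (ph w)) Q = 0"
proof -
  note q = cmc.q_inner[OF w \<kappa>_nonzero[OF w]]
  have "complex_of_real (mink Q Q) = 1"
    unfolding mink_cvec[symmetric] Q_q[OF w] by (simp add: mink_simps q)
  then show "mink Q Q = 1" by (metis of_real_eq_1_iff)
  have "complex_of_real (r w * mink Q (null_vec (p w))) = complex_of_real (2 * sqrt (Re (cmc.h w)))"
    unfolding mink_cvec_Y[symmetric] Q_q[OF w] by (simp add: mink_simps q cmc.g_def)
  then have "r w * mink Q (null_vec (p w)) = 2 * sqrt (Re (cmc.h w))" by (simp only: of_real_eq_iff)
  then have "r w * mink Q (null_vec (p w)) > 0" using cmc.Re_h_pos[OF w \<kappa>_nonzero[OF w]] by simp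
  then show "mink (null_vec (p w)) Q > 0"
    using r_pos[OF w] by (simp add: zero_less_mult_iff mink_commute)
  have "complex_of_real (t w * mink Q (null_vec (ph w))) = 0"
    unfolding mink_cvec_Yh[symmetric] Q_q[OF w] by (simp add: mink_simps q)
  then show "mink (null_vec (ph w)) Q = 0" using t_pos[OF w] by (simp add: mink_commute)
qed

definition "perp u w \<longleftrightarrow> (\<forall>v\<in>CV (lightcone p) w. mink (cvec u) v = 0)"

text \<open>The product with \<open>Pb\<close> is missing on the right because, u being real, it is
  the conjugate of that with \<open>P\<close>.\<close>

lemma perp_frame:
  assumes w: "w \<in> S"
  shows "perp u w \<longleftrightarrow> mink (cvec u) (Y w) = 0 \<and> mink (cvec u) (frame.P w) = 0 \<and> mink (cvec u) (Yh w) = 0"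
    (is "_ \<longleftrightarrow> ?r")
proof
  assume "perp u w"
  then show ?r unfolding perp_def CV_Y[OF w, symmetric] using frame.frame_in_CV[OF w] by blast
next
  assume r: ?r
  then have "mink (cvec u) (frame.Pb w) = 0"
    using mink_cnjv[of "cvec u" "frame.P w"] by (simp add: frame.cnjv_P[OF w])
  then show "perp u w"
    unfolding perp_def CV_Y[OF w, symmetric] using frame.orthogonal_CV(1)[OF w] r by blast
qed

text \<open>Orthogonality persists nearby by the linear system in
  \<open>orthogonal_frame_locally\<close>; if it fails, some product with a frame vector is nonzero,
  and remains so by continuity.\<close>

lemma perp_locally_constant:
  assumes w0: "w0 \<in> S" and u: "mink u Q = 0"
  shows "\<exists>\<delta>>0. ball w0 \<delta> \<subseteq> S \<and> (\<forall>w\<in>ball w0 \<delta>. perp u w \<longleftrightarrow> perp u w0)"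
proof (cases "perp u w0")
  case True
  have "mink (cvec u) (cmc.q w0) = - mink (cvec u) (cvec Q)" unfolding Q_q[OF w0] by (simp add: mink_simps)
  then have "mink (cvec u) (cmc.q w0) = 0" using u by (simp add: mink_cvec)
  then obtain \<delta> where \<delta>: "\<delta> > 0" "ball w0 \<delta> \<subseteq> S" "\<forall>w\<in>ball w0 \<delta>. mink (cvec u) (Y w) = 0 \<and>
      mink (cvec u) (frame.P w) = 0 \<and> mink (cvec u) (Yh w) = 0"
    using cmc.orthogonal_frame_locally[OF w0 \<kappa>_nonzero[OF w0], of "cvec u"] True[unfolded perp_frame[OF w0]]
    by auto
  then have "\<forall>w\<in>ball w0 \<delta>. perp u w" using perp_frame by blast
  then show ?thesis using \<delta> True by blast
next
  case False
  then obtain F where F: "Cinf_on F S" "mink (cvec u) (F w0) \<noteq> 0" "F = Y \<or> F = frame.P \<or> F = Yh"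
    unfolding perp_frame[OF w0] using smooth_Y smooth_Yh frame.smooth_P by metis
  have "Cinf_on (\<lambda>w. mink (cvec u) (F w)) S" by (intro Cinf_on_mink[OF op] Cinf_on_const F)
  from frame.nonzero_nearby[OF this w0 F(2)] obtain \<delta> where \<delta>: "\<delta> > 0" "ball w0 \<delta> \<subseteq> S"
    "\<forall>x\<in>ball w0 \<delta>. mink (cvec u) (F x) \<noteq> 0" by blast
  then have "\<forall>w\<in>ball w0 \<delta>. \<not> perp u w" using F(3) perp_frame by blast
  then show ?thesis using \<delta> False by blast
qed

lemma lorentz_basis_at:
  assumes w: "w \<in> S"
  shows "\<exists>a b c d e. lorentz_basis a b c d e \<and> Q \<in> span {a, b, c, d, e} \<and>
    (\<forall>u. mink u a = 0 \<and> mink u e = 0 \<longrightarrow> mink u (null_vec (p w)) = 0 \<and> mink u (null_vec (ph w)) = 0) \<and>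
    (\<forall>u. mink u a = 0 \<and> mink u b = 0 \<and> mink u c = 0 \<and> mink u d = 0 \<and> mink u e = 0
       \<longrightarrow> mink u Q = 0 \<and> perp u w)"
proof -
  define y where "y = Yr w"
  define yh where "yh = t w *\<^sub>R null_vec (ph w)"
  define b where "b = (\<chi> i. Re (frame.P w $ i))"
  define c where "c = (\<chi> i. Im (frame.P w $ i))"
  define d where "d = (\<chi> i. Re (cmc.\<xi> w $ i))"
  have Y: "Y w = cvec y" by (simp add: Y_def y_def)
  have Yh: "Yh w = cvec yh" by (simp add: Yh_def yh_def lightcone_def cvec_simps)
  have P: "frame.P w = cvec b + \<i> *s cvec c" by (simp add: b_def c_def vec_eq_iff complex_eq_iff)
  have Pb: "frame.Pb w = cvec b - \<i> *s cvec c" unfolding frame.cnjv_P[OF w, symmetric] P by (simp add: vec_eq_iff)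
  have x: "cmc.\<xi> w = cvec d" using real_vector_is_cvec[OF cmc.\<xi>_real[OF w]] by (simp add: d_def)
  have m: "mink y y = 0" "mink y yh = -1" "mink yh yh = 0" "mink y b = 0" "mink y c = 0" "mink yh b = 0" "mink yh c = 0"
    "mink d y = 0" "mink d yh = 0" "mink d b = 0" "mink d c = 0"
    "mink b b = 1/4" "mink c c = 1/4" "mink b c = 0" "mink d d > 0"
  proof -
    note T = frame.table[OF w, unfolded Y Yh P Pb] cmc.\<xi>_orthogonal[OF w, unfolded x Y Yh P Pb]
    have "complex_of_real (mink y yh) = complex_of_real (-1)" using T(4) by (simp add: mink_cvec)
    then show "mink y yh = -1" by (simp only: of_real_eq_iff)
    show "mink y y = 0" "mink yh yh = 0" "mink d y = 0" "mink d yh = 0"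
      using T by (simp_all add: mink_cvec)
    have z: "mink u b = 0" "mink u c = 0" if "mink (cvec u) (cvec b + \<i> *s cvec c) = 0" for u
      using that by (simp_all add: mink_simps mink_cvec complex_eq_iff)
    show "mink y b = 0" "mink y c = 0" "mink d b = 0" "mink d c = 0" "mink yh b = 0" "mink yh c = 0"
      using T by (auto intro!: z)
    have "mink b b - mink c c = 0 \<and> 2 * mink b c = 0" 
      using T(5) by (simp add: mink_simps mink_cvec complex_eq_iff mink_commute[of c b])
    moreover have "mink b b + mink c c = 1/2"
      using T(6) by (simp add: mink_simps mink_cvec complex_eq_iff mink_commute[of c b])
    ultimately show "mink b b = 1/4" "mink c c = 1/4" "mink b c = 0" by auto
    have "cmc.h w = complex_of_real (mink d d)" by (simp add: cmc.h_def x mink_cvec)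
    then show "mink d d > 0" using cmc.Re_h_pos[OF w \<kappa>_nonzero[OF w]] by simp
  qed
  note m' = m m(1-14)[THEN trans[OF mink_commute]]
  \<comment> \<open>The null pair with product -1 is replaced by its difference and sum, of squares
    2 and -2; real and imaginary part of \<open>P\<close> are orthogonal since \<open>P\<close> is
    isotropic. The span is V + span Q, because Q combines \<open>\<xi>\<close> and
    \<open>Yh\<close>.\<close>
  have "lorentz_basis (y - yh) b c d (y + yh)"
    unfolding lorentz_basis_def using m' by (simp add: mink_simps)
  moreover have "Q \<in> span {y - yh, b, c, d, y + yh}"
  proof -
    have "cvec Q = - (inverse (cmc.g w) *s cvec d + (2 * cmc.g w) *s cvec yh)"
      unfolding Q_q[OF w] cmc.q_def x Yh ..
    also have "\<dots> = cvec (- (inverse (sqrt (Re (cmc.h w))) *\<^sub>R d + (2 * sqrt (Re (cmc.h w))) *\<^sub>R yh))"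
      by (simp add: cmc.g_def cvec_simps)
    finally have Q: "Q = - (inverse (sqrt (Re (cmc.h w))) *\<^sub>R d + (2 * sqrt (Re (cmc.h w))) *\<^sub>R yh)" by simp
    have yh: "yh = (1/2) *\<^sub>R ((y + yh) - (y - yh))" by (simp add: algebra_simps flip: scaleR_2)
    have "yh \<in> span {y - yh, b, c, d, y + yh}"
      by (subst yh) (intro span_scale span_diff span_base; simp)
    then show ?thesis
      unfolding Q by (intro span_neg span_add span_scale) (auto intro: span_base)
  qed
  moreover have u: "mink u y = 0 \<and> mink u yh = 0" if "mink u (y - yh) = 0" "mink u (y + yh) = 0" for u
    using that by (simp add: mink_simps)
  have u': "mink u (null_vec (p w)) = 0 \<and> mink u (null_vec (ph w)) = 0" if "mink u (y - yh) = 0" "mink u (y + yh) = 0" for u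
    using u[OF that] r_pos[OF w] t_pos[OF w] by (simp add: y_def yh_def Yr_def mink_simps)
  moreover have "mink u Q = 0 \<and> perp u w" if "mink u (y - yh) = 0 \<and> mink u b = 0 \<and> mink u c = 0 \<and> mink u d = 0 \<and> mink u (y + yh) = 0" for u
  proof -
    have U: "mink u y = 0" "mink u yh = 0" using u[of u] that by auto
    have "complex_of_real (mink u Q) = 0"
      unfolding mink_cvec[symmetric] Q_q[OF w] cmc.q_def x Yh using U that by (simp add: mink_simps mink_cvec)
    moreover have "perp u w"
      unfolding perp_frame[OF w] Y Yh P using U that by (simp add: mink_simps mink_cvec)
    ultimately show ?thesis by simp
  qed
  ultimately show ?thesis by blast
qed

text \<open>Chosen so that point plus normal is an isotropic vector over \<open>ph w\<close>: the
  normal geodesic ends at \<open>ph w\<close> on the ideal boundary. The second envelope is thus the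
  hyperbolic Gauss map. The factor is the one that makes the normal orthogonal to the position
  vector.\<close>

definition "normal w = (mink (null_vec (p w)) Q / (1 - p w \<bullet> ph w)) *\<^sub>R null_vec (ph w) - to_hyperboloid Q (p w)"

lemma hyperboloid_inner:
  assumes w: "w \<in> S"
  defines "k \<equiv> to_hyperboloid Q (p w)"
  shows "mink k k = -1" "mink k Q = 0" "k $ None > 0" "mink (normal w) Q = 0" "mink (normal w) k = 0" "mink (normal w) (normal w) = 1"
proof -
  let ?x = "null_vec (p w)" and ?y = "null_vec (ph w)"
  define m where "m = mink ?x Q"
  have m: "m > 0" using Q_inner(2)[OF w] by (simp add: m_def)
  note I = Q_inner(1,3)[OF w] Q_inner(3)[OF w, THEN trans[OF mink_commute]]
  define D where "D = 1 - p w \<bullet> ph w"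
  have x: "mink ?x ?x = 0" "mink ?y ?y = 0" "mink ?x ?y = - D" "mink ?y ?x = - D"
    using sphere[OF w] hat.sphere[OF w] by (simp_all add: D_def mink_null_vec dot_square_norm inner_commute)
  have mm: "mink ?x Q = m" "mink Q ?x = m" by (simp_all add: m_def mink_commute)
  have k: "k = (1 / m) *\<^sub>R ?x - Q" by (simp add: k_def to_hyperboloid_def m_def)
  have n: "normal w = (m / D) *\<^sub>R ?y - ((1 / m) *\<^sub>R ?x - Q)"
    by (simp add: normal_def m_def to_hyperboloid_def D_def)
  have s: "D \<noteq> 0" using separated[OF w] by (simp add: D_def)
  show kk: "mink k k = -1" and kQ: "mink k Q = 0"
    using m by (simp_all add: k mink_simps x mm I)
  have yk: "mink ?y k = - D / m" "mink k ?y = - D / m"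
    by (simp_all add: k mink_simps x I)
  have n': "normal w = (m / D) *\<^sub>R ?y - k" by (simp add: n k)
  show "mink (normal w) Q = 0" by (simp add: n' mink_simps I kQ)
  show "mink (normal w) k = 0" using s m by (simp add: n' mink_simps yk kk)
  show "mink (normal w) (normal w) = 1" using s m by (simp add: n' mink_simps yk kk x)
  show "k $ None > 0"
  \<comment> \<open>A time-like vector that is not future-directed has positive product with the
    future-directed \<open>null_vec (p w)\<close>, but here this product is -m.\<close>
  proof (rule ccontr)
    assume "\<not> k $ None > 0"
    then have k0: "k $ None \<le> 0" by simp
    define v :: "real^'n" where "v = (\<chi> j. k $ Some j)"
    have "mink k ?x = v \<bullet> p w - k $ None"
      by (simp add: mink_def null_vec_def v_def inner_vec_def)
    moreover have "mink k ?x = - m" using m by (simp add: k mink_simps x mm)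
    ultimately have 1: "v \<bullet> p w < k $ None" using m by linarith
    have 2: "v \<bullet> v - (k $ None)\<^sup>2 = -1"
      using kk by (simp add: mink_def v_def inner_vec_def power2_eq_square)
    have "\<bar>v \<bullet> p w\<bar> \<le> norm v * norm (p w)" by (rule Cauchy_Schwarz_ineq2)
    then have "\<bar>v \<bullet> p w\<bar> \<le> norm v" using sphere[OF w] by simp
    moreover have "(norm v)\<^sup>2 < (k $ None)\<^sup>2" using 2 by (simp add: dot_square_norm)
    then have "norm v < \<bar>k $ None\<bar>" by (metis abs_norm_cancel power2_less_imp_less abs_ge_zero power2_abs)
    ultimately show False using 1 k0 by linarith
  qed
qed

text \<open>The surface is Y / \<omega> - Q, conformal with metric |dz|^2 / \<omega>^2, so its mean
  curvature only involves the mixed derivative. The normal pairs with that derivative to half the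
  conformal factor, which is mean curvature 1.\<close>

lemma mean_curvature_eq_1:
  assumes w: "w \<in> S" and k: "\<And>x. x \<in> S \<Longrightarrow> k x = to_hyperboloid Q (p x)"
  shows "mink (normal w) (dx k w) = 0" "mink (normal w) (dy k w) = 0" "mean_curvature k (normal w) w = 1"
proof -
  \<comment> \<open>The product of the canonical lift with Q, by which the lift is divided to reach
    the hyperboloid.\<close>
  define \<omega> where "\<omega> x = r x * mink (null_vec (p x)) Q" for x
  have \<omega>: "\<omega> x > 0" if "x \<in> S" for x using r_pos[OF that] Q_inner(2)[OF that] by (simp add: \<omega>_def)
  have s\<omega>: "Cinf_on (\<lambda>x. inverse (\<omega> x)) S"
    using \<omega> unfolding \<omega>_def [abs_def]
    by (intro Cinf_on_inverse[OF op] Cinf_on_bilinear[OF op bounded_bilinear_mult] smooth_r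
        Cinf_on_bilinear[OF op bilinear_mink_real] Cinf_on_null_vec[OF op smooth_p] Cinf_on_const) force
  let ?s = "\<lambda>x. complex_of_real (inverse (\<omega> x))"
  define K where "K x = cvec (k x)" for x
  define L where "L x = ?s x *s Y x" for x
  have ss: "Cinf_on ?s S" by (rule Cinf_on_of_real[OF op s\<omega>])
  have KL: "K x = L x - cvec Q" if x: "x \<in> S" for x
  proof -
    have "k x = inverse (\<omega> x) *\<^sub>R Yr x - Q"
      unfolding k[OF x] to_hyperboloid_def \<omega>_def Yr_def using r_pos[OF x] by (simp add: divide_inverse)
    then show ?thesis by (simp add: K_def L_def Y_def cvec_simps)
  qed
  have sL: "Cinf_on L S" unfolding L_def [abs_def] by (intro Cinf_on_smult[OF op] ss smooth_Y)
  have sk: "Cinf_on k S"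
  proof -
    have "Cinf_on (\<lambda>x. inverse (\<omega> x) *\<^sub>R Yr x - Q) S"
      by (intro Cinf_on_diff[OF op] Cinf_on_bilinear[OF op bounded_bilinear_scaleR] s\<omega> smooth_Yr Cinf_on_const)
    moreover have "k x = inverse (\<omega> x) *\<^sub>R Yr x - Q" if "x \<in> S" for x
      unfolding k[OF that] to_hyperboloid_def \<omega>_def Yr_def using r_pos[OF that] by (simp add: divide_inverse)
    ultimately show ?thesis using Cinf_on_cong[of S k "\<lambda>x. inverse (\<omega> x) *\<^sub>R Yr x - Q"] op by simp
  qed
  have KL': "dz K x = dz L x" "dzbar K x = dzbar L x" if x: "x \<in> S" for x
    using dz_cong[OF op x KL] dzbar_cong[OF op x KL] dz_diff[OF frame.diff[OF sL x] differentiable_const, of "cvec Q"]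
      dzbar_diff[OF frame.diff[OF sL x] differentiable_const, of "cvec Q"] by simp_all
  have KL'': "dz (dzbar K) w = dz (dzbar L) w" by (rule dz_cong[OF op w KL'(2)])
  have L: "dz L w = ddz ?s w *s Y w + ?s w *s dz Y w" "dzbar L w = ddzbar ?s w *s Y w + ?s w *s dzbar Y w"
    "dz (dzbar L) w = ddz (ddzbar ?s) w *s Y w + ddzbar ?s w *s dz Y w + (ddz ?s w *s dzbar Y w + ?s w *s dz (dzbar Y) w)"
    using CV_scale_subset(3-5)[of S ?s Y w L] op ss smooth_Y w by (simp_all add: L_def)
  note fr = frame.table[OF w] frame.YYz[OF w] frame.YYzb[OF w] frame.YYz'[OF w]
    frame.YzYz[OF w] frame.YzYzbar[OF w] frame.YzbYzb_at[OF w]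
    frame.YzYzbar[OF w, THEN trans[OF mink_commute]]
  have KK: "mink (dz K w) (dz K w) = 0" "mink (dzbar K w) (dzbar K w) = 0"
    "mink (dz K w) (dzbar K w) = (?s w)\<^sup>2 / 2" "mink (dzbar K w) (dz K w) = (?s w)\<^sup>2 / 2"
    unfolding KL'[OF w] L by (simp_all add: mink_simps fr power2_eq_square)
  define N where "N = cvec (normal w)"
  have \<omega>Y: "mink (cvec Q) (Y w) = complex_of_real (\<omega> w)" by (simp add: mink_cvec_Y \<omega>_def mink_commute)
  \<comment> \<open>In the frame, \<open>N\<close> is orthogonal to \<open>Y\<close>,
    \<open>P\<close> and \<open>Pb\<close>; it is nontrivial on V only through
    \<open>Yh\<close>.\<close>
  have N: "N = complex_of_real (\<omega> w) *s Yh w - ?s w *s Y w + cvec Q"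
  proof -
    have "N = complex_of_real (mink (null_vec (p w)) Q / (1 - p w \<bullet> ph w)) *s lightcone ph w - K w"
      by (simp add: N_def normal_def K_def k[OF w] lightcone_def cvec_simps)
    also have "mink (null_vec (p w)) Q / (1 - p w \<bullet> ph w) = \<omega> w * t w"
      using r_pos[OF w] by (simp add: \<omega>_def t_def divide_inverse)
    finally show ?thesis unfolding KL[OF w] L_def by (simp add: Yh_def)
  qed
  note q = cmc.q_inner[OF w \<kappa>_nonzero[OF w]]
  have QF: "mink (cvec Q) (Yh w) = 0" "mink (cvec Q) (frame.P w) = 0" "mink (cvec Q) (frame.Pb w) = 0"
    unfolding Q_q[OF w] by (simp_all add: mink_simps q)
  have NY: "mink N (Y w) = 0" "mink N (frame.P w) = 0" "mink N (frame.Pb w) = 0" "mink N (Yh w) = ?s w"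
    unfolding N by (simp_all add: mink_simps frame.table[OF w] QF \<omega>Y)
  then have NYz: "mink N (dz Y w) = 0" "mink N (dzbar Y w) = 0"
    unfolding frame.Yz_P[OF w] frame.Yzb_Pb[OF w] by (simp_all add: mink_simps)
  \<comment> \<open>Only the component along \<open>Yh\<close> counts. Its coefficient is minus the
    product with \<open>Y\<close>, that is 1/2, and the product of \<open>N\<close> with
    \<open>Yh\<close> is 1 / \<omega>.\<close>
  have "mink N (dz (dzbar Y) w) = ?s w / 2"
    using arg_cong[OF frame.expansion[OF w CV_base(4)], of "mink N"]
    by (simp add: mink_simps NY frame.Yzzb_inner[OF w])
  then have NK: "mink N (dz K w) = 0" "mink N (dzbar K w) = 0" "mink N (dz (dzbar K) w) = (?s w)\<^sup>2 / 2"
    unfolding KL'[OF w] KL'' L by (simp_all add: mink_simps NY NYz power2_eq_square)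
  have Kk: "K = cvec \<circ> k" by (simp add: K_def fun_eq_iff)
  note D = Cinf_on_differentiable[OF sk op w]
  have dk: "cvec (dx k w) = dz K w + dzbar K w" "cvec (dy k w) = \<i> *s dz K w - \<i> *s dzbar K w"
    unfolding Kk by (rule cvec_dx[OF D], rule cvec_dy[OF D])
  have "complex_of_real (mink (normal w) (dx k w)) = 0" "complex_of_real (mink (normal w) (dy k w)) = 0"
    unfolding mink_cvec[symmetric] dk N_def[symmetric] by (simp_all add: mink_simps NK)
  then show "mink (normal w) (dx k w) = 0" "mink (normal w) (dy k w) = 0" by simp_all
  let ?G = "(inverse (\<omega> w))\<^sup>2"
  have "complex_of_real (mink (dx k w) (dx k w)) = complex_of_real ?G"
    "complex_of_real (mink (dy k w) (dy k w)) = complex_of_real ?G"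
    "complex_of_real (mink (dx k w) (dy k w)) = 0"
    unfolding mink_cvec[symmetric] dk by (simp_all add: mink_simps KK algebra_simps)
  then have g: "mink (dx k w) (dx k w) = ?G" "mink (dy k w) (dy k w) = ?G" "mink (dx k w) (dy k w) = 0"
    by (simp_all only: of_real_eq_iff of_real_eq_0_iff)
  have "complex_of_real (mink ((1/4) *\<^sub>R (dx (dx k) w + dy (dy k) w)) (normal w)) = mink N (dz (dzbar K) w)"
    unfolding mink_cvec[symmetric] cvec_laplacian[OF op sk w] Kk N_def by (rule mink_commute)
  also have "\<dots> = complex_of_real (?G / 2)" unfolding NK by simp
  finally have "mink ((1/4) *\<^sub>R (dx (dx k) w + dy (dy k) w)) (normal w) = ?G / 2"
    by (simp only: of_real_eq_iff)
  then have b: "mink (dx (dx k) w) (normal w) + mink (dy (dy k) w) (normal w) = 2 * ?G"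
    by (simp add: mink_simps)
  have "x * (2 * x) / (2 * (x * x)) = 1" if "x > 0" for x :: real using that by simp
  then have G: "?G * (2 * ?G) / (2 * (?G * ?G)) = 1" using \<omega>[OF w] by (metis inverse_positive_iff_positive zero_less_power)
  have "mean_curvature k (normal w) w
     = ?G * (mink (dx (dx k) w) (normal w) + mink (dy (dy k) w) (normal w)) / (2 * (?G * ?G))"
    unfolding mean_curvature_def Let_def g by (simp add: algebra_simps)
  also have "\<dots> = 1" unfolding b by (rule G)
  finally show "mean_curvature k (normal w) w = 1" .
qed

end


section \<open>From charts to the surface\<close>

text \<open>A curve in the sphere has its null vectors in the subspace W, hence so is their
  velocity. Membership is tested with the Euclidean orthogonal complement, whose complement is W
  again.\<close>

lemma tangent_space_round_sphere:
  fixes W :: "(real^('n::finite option)) set"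
  assumes W: "subspace W" and v: "v \<in> tangent_space (round_sphere W) x"
  shows "null_vec v - null_vec 0 \<in> W"
proof -
  let ?L = "\<lambda>x::real^'n. null_vec x - null_vec 0"
  obtain \<gamma> where \<gamma>: "\<forall>\<^sub>F t in nhds (0::real). \<gamma> t \<in> round_sphere W"
    and d: "(\<gamma> has_vector_derivative v) (at 0)"
    using v by (auto simp: tangent_space_def)
  have "?L v \<bullet> y = 0" if y: "y \<in> orthogonal_comp W" for y
  proof -
    have "((\<lambda>t. ?L (\<gamma> t) \<bullet> y) has_vector_derivative ?L v \<bullet> y) (at 0)"
      by (intro bounded_linear.has_vector_derivative[OF bounded_linear_inner_left]
          bounded_linear.has_vector_derivative[OF null_vec_affine d])
    moreover have "((\<lambda>t. ?L (\<gamma> t) \<bullet> y) has_vector_derivative 0) (at 0)"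
    proof -
      obtain S where S: "open S" "0 \<in> S" "\<And>t. t \<in> S \<Longrightarrow> \<gamma> t \<in> round_sphere W"
        using \<gamma> unfolding eventually_nhds by blast
      \<comment> \<open>The linear part differs from \<open>null_vec\<close> by a constant vector,
        and y is orthogonal to \<open>null_vec (\<gamma> t)\<close>; so the function is constant
        near 0.\<close>
      have "- (null_vec 0 \<bullet> y) = ?L (\<gamma> t) \<bullet> y" if "t \<in> S" for t
        using S(3)[OF that] y by (simp add: round_sphere_def orthogonal_comp_def orthogonal_def inner_diff_left)
      then show ?thesis
        by (rule has_vector_derivative_transform_within_open[OF has_vector_derivative_const S(1,2)])
    qed
    ultimately show ?thesis by (rule vector_derivative_unique_at)
  qed
  then have "?L v \<in> orthogonal_comp (orthogonal_comp W)"
    by (auto simp: orthogonal_comp_def orthogonal_def inner_commute)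
  then show ?thesis using orthogonal_comp_self[OF W] by simp
qed

locale riemann_surface_charts =
  fixes A :: "'a::t2_space chart set"
  assumes rs: "riemann_surface A"
begin

lemma ex_chart: "\<exists>c\<in>A. p \<in> fst c"
  using rs unfolding riemann_surface_def by blast

lemma open_dom: "c \<in> A \<Longrightarrow> open (fst c)" and open_image: "c \<in> A \<Longrightarrow> open (chart_image c)"
  and chart_homeomorphism: "c \<in> A \<Longrightarrow> homeomorphism (fst c) (chart_image c) (snd c) (chart_inv c)"
  using rs unfolding riemann_surface_def by blast+

lemma chart_inv_chart [simp]: "c \<in> A \<Longrightarrow> p \<in> fst c \<Longrightarrow> chart_inv c (snd c p) = p"
  using homeomorphism_apply1[OF chart_homeomorphism] .

lemma chart_chart_inv [simp]: "c \<in> A \<Longrightarrow> w \<in> chart_image c \<Longrightarrow> snd c (chart_inv c w) = w"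
  using homeomorphism_apply2[OF chart_homeomorphism] .

lemma chart_inv_dom [simp]: "c \<in> A \<Longrightarrow> w \<in> chart_image c \<Longrightarrow> chart_inv c w \<in> fst c"
  using homeomorphism_image2[OF chart_homeomorphism] by blast

lemma chart_in_image [simp]: "p \<in> fst c \<Longrightarrow> snd c p \<in> chart_image c"
  by (simp add: chart_image_def)

lemma transition:
  assumes "c \<in> A" "d \<in> A"
  defines "U \<equiv> snd c ` (fst c \<inter> fst d)" and "\<phi> \<equiv> snd d \<circ> chart_inv c"
  shows "open U" "\<phi> holomorphic_on U" "\<And>x. x \<in> U \<Longrightarrow> \<phi> x \<in> chart_image d"
    "\<And>x. x \<in> U \<Longrightarrow> chart_inv c x = chart_inv d (\<phi> x)"
proof -
  have "U = chart_image c \<inter> chart_inv c -` fst d"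
    unfolding U_def chart_image_def using assms(1) by force
  moreover have "continuous_on (chart_image c) (chart_inv c)"
    using chart_homeomorphism[OF assms(1)] homeomorphism_cont2 by blast
  ultimately show "open U"
    using continuous_open_preimage open_image[OF assms(1)] open_dom[OF assms(2)] by metis
  show "\<phi> holomorphic_on U" using rs assms unfolding riemann_surface_def by blast
  show "\<phi> x \<in> chart_image d" "chart_inv c x = chart_inv d (\<phi> x)" if "x \<in> U" for x
    using that assms by auto
qed

text \<open>Chain rule for the transition map and its inverse: the two derivatives multiply to
  1.\<close>

lemma transition_deriv:
  assumes "c \<in> A" "d \<in> A" "p \<in> fst c" "p \<in> fst d"
  shows "deriv (snd d \<circ> chart_inv c) (snd c p) \<noteq> 0"
proof -
  let ?\<phi> = "snd d \<circ> chart_inv c" and ?\<psi> = "snd c \<circ> chart_inv d"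
  let ?U = "snd c ` (fst c \<inter> fst d)" and ?V = "snd d ` (fst d \<inter> fst c)"
  have w: "snd c p \<in> ?U" "?\<phi> (snd c p) \<in> ?V" using assms by auto
  have 1: "(?\<phi> has_field_derivative deriv ?\<phi> (snd c p)) (at (snd c p))"
    by (rule holomorphic_derivI[OF transition(2,1)[OF assms(1,2)] w(1)])
  have 2: "(?\<psi> has_field_derivative deriv ?\<psi> (?\<phi> (snd c p))) (at (?\<phi> (snd c p)))"
    by (rule holomorphic_derivI[OF transition(2,1)[OF assms(2,1)] w(2)])
  have "((\<lambda>x. ?\<psi> (?\<phi> x)) has_field_derivative deriv ?\<psi> (?\<phi> (snd c p)) * deriv ?\<phi> (snd c p)) (at (snd c p))"
    by (rule DERIV_chain2[OF 2 1])
  then have "((\<lambda>x. x) has_field_derivative deriv ?\<psi> (?\<phi> (snd c p)) * deriv ?\<phi> (snd c p)) (at (snd c p))"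
    by (rule has_field_derivative_transform_within_open[OF _ transition(1)[OF assms(1,2)] w(1)])
      (use assms in auto)
  from DERIV_unique[OF this DERIV_ident] show ?thesis by auto
qed

text \<open>Applied to the set-valued \<open>horo\<close> and to the truth value
  \<open>perpg u\<close>; only the discreteness of the values matters.\<close>

lemma locally_constant_imp_constant:
  assumes "connected (UNIV :: 'a set)"
    and "\<And>c w. c \<in> A \<Longrightarrow> w \<in> chart_image c \<Longrightarrow>
      \<exists>\<delta>>0. ball w \<delta> \<subseteq> chart_image c \<and> (\<forall>x\<in>ball w \<delta>. F (chart_inv c x) = F (chart_inv c w))"
  shows "F p = F q"
proof (rule connected_local_const[OF assms(1)])
  show "\<forall>a\<in>UNIV. \<forall>\<^sub>F b in at a within UNIV. F a = F b"
  proof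
    fix a :: 'a
    obtain c where c: "c \<in> A" "a \<in> fst c" using ex_chart by blast
    obtain \<delta> where \<delta>: "\<delta> > 0" "\<forall>x\<in>ball (snd c a) \<delta>. F (chart_inv c x) = F a"
      using assms(2)[OF c(1), of "snd c a"] c by auto
    let ?N = "fst c \<inter> snd c -` ball (snd c a) \<delta>"
    have "continuous_on (fst c) (snd c)"
      using chart_homeomorphism[OF c(1)] homeomorphism_cont1 by blast
    then have "open ?N" using continuous_open_preimage open_dom[OF c(1)] open_ball by blast
    moreover have "a \<in> ?N" using c \<delta>(1) by simp
    moreover have "F a = F b" if "b \<in> ?N" for b using \<delta>(2) that c by (metis IntD1 IntD2 chart_inv_chart vimageD)
    ultimately show "\<forall>\<^sub>F b in at a within UNIV. F a = F b"
      unfolding eventually_at_topological by blast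
  qed
qed auto

end

locale surface_with_envelope = riemann_surface_charts A
  for A :: "'a::t2_space chart set" +
  fixes f fhat :: "'a \<Rightarrow> real^'n::finite"
  assumes conn: "connected (UNIV :: 'a set)"
    and imm: "immersion A f" "immersion A fhat" and conformal: "conformal A f" "conformal A fhat"
    and ne: "fhat p \<noteq> f p"
    and env: "envelops A fhat (mean_curvature_space A f)"
begin

abbreviation "loc c \<equiv> f \<circ> chart_inv c"
abbreviation "loch c \<equiv> fhat \<circ> chart_inv c"

lemma conformal_immersion_chart:
  assumes "c \<in> A" "immersion A g" "conformal A g"
  shows "conformal_immersion (chart_image c) (g \<circ> chart_inv c)"
proof -
  have s: "g q \<in> sphere 0 1" for q using assms(2) unfolding immersion_def by blast
  show ?thesis
    using assms open_image
    by unfold_locales (auto simp: immersion_def smooth_map_def conformal_def s[unfolded mem_sphere_0])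
qed

lemma smooth_loc: "c \<in> A \<Longrightarrow> Cinf_on (loc c) (chart_image c)" "c \<in> A \<Longrightarrow> Cinf_on (loch c) (chart_image c)"
  using imm by (auto simp: immersion_def smooth_map_def)

lemma smooth_lightcone:
  assumes "c \<in> A"
  shows "Cinf_on (lightcone (loc c)) (chart_image c)"
  unfolding lightcone_def [abs_def] using assms
  by (intro Cinf_on_linear[OF _ linear_cvec] Cinf_on_null_vec open_image smooth_loc)

lemma CV_chart_independent:
  assumes "c \<in> A" "d \<in> A" "p \<in> fst c" "p \<in> fst d"
  shows "CV (lightcone (loc c)) (snd c p) = CV (lightcone (loc d)) (snd d p)"
proof -
  let ?\<phi> = "snd d \<circ> chart_inv c"
  have "CV (lightcone (loc c)) (snd c p) = CV (lightcone (loc d)) (?\<phi> (snd c p))"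
  proof (rule CV_compose[OF transition(1,2)[OF assms(1,2)] _ open_image[OF assms(2)]])
    show "lightcone (loc c) x = lightcone (loc d) (?\<phi> x)" if "x \<in> snd c ` (fst c \<inter> fst d)" for x
      using transition(4)[OF assms(1,2) that] by (simp add: lightcone_def)
  qed (use assms transition(3)[OF assms(1,2)] smooth_lightcone transition_deriv in auto)
  then show ?thesis using assms by simp
qed

lemma horo_vectors_chart_independent:
  assumes "c \<in> A" "d \<in> A" "p \<in> fst c" "p \<in> fst d"
  shows "horo_vectors (loc c) (loch c) (snd c p) = horo_vectors (loc d) (loch d) (snd d p)"
proof -
  let ?\<phi> = "snd d \<circ> chart_inv c"
  have "horo_vectors (loc c) (loch c) (snd c p) = horo_vectors (loc d) (loch d) (?\<phi> (snd c p))"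
  proof (rule horo_vectors_compose[OF transition(1,2)[OF assms(1,2)] _ open_image[OF assms(2)]])
    show "loc c x = loc d (?\<phi> x)" "loch c x = loch d (?\<phi> x)" if "x \<in> snd c ` (fst c \<inter> fst d)" for x
      using transition(4)[OF assms(1,2) that] by simp_all
  qed (use assms transition(3)[OF assms(1,2)] smooth_loc transition_deriv in auto)
  then show ?thesis using assms by simp
qed

text \<open>Every chart around p and every canonical lift give the same space, described by the
  unnormalised lift, and the lift \<open>Yr\<close> shows existence; so the definite description has
  this value.\<close>

lemma mean_curvature_space_iff:
  assumes c: "c \<in> A" "p \<in> fst c"
  shows "u \<in> mean_curvature_space A f p \<longleftrightarrow> cvec u \<in> CV (lightcone (loc c)) (snd c p)"
    and "subspace (mean_curvature_space A f p)"
proof -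
  have V: "V_space Y (snd d p) = {u. cvec u \<in> CV (lightcone (loc c)) (snd c p)}"
    if d: "d \<in> A" "p \<in> fst d" "canonical_lift (chart_image d) (loc d) Y" for d Y
  proof -
    interpret D: conformal_immersion "chart_image d" "loc d"
      by (rule conformal_immersion_chart[OF d(1) imm(1) conformal(1)])
    have "u \<in> V_space Y (snd d p) \<longleftrightarrow> cvec u \<in> CV (lightcone (loc d)) (snd d p)" for u
      by (rule D.V_space_canonical_lift[OF d(3)]) (use d in simp)
    then show ?thesis using CV_chart_independent[OF c(1) d(1) c(2) d(2)] by auto
  qed
  interpret C: conformal_immersion "chart_image c" "loc c"
    by (rule conformal_immersion_chart[OF c(1) imm(1) conformal(1)])
  have "mean_curvature_space A f p = {u. cvec u \<in> CV (lightcone (loc c)) (snd c p)}"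
    unfolding mean_curvature_space_def
  proof (rule the_equality)
    show "\<exists>d\<in>A. \<exists>Y. p \<in> fst d \<and> canonical_lift (chart_image d) (loc d) Y \<and>
        {u. cvec u \<in> CV (lightcone (loc c)) (snd c p)} = V_space Y (snd d p)"
      using V[OF c C.canonical_lift] c C.canonical_lift by metis
  qed (use V in blast)
  then show "u \<in> mean_curvature_space A f p \<longleftrightarrow> cvec u \<in> CV (lightcone (loc c)) (snd c p)"
    and "subspace (mean_curvature_space A f p)"
    using V[OF c C.canonical_lift, symmetric] by (auto simp: V_space_def subspace_span)
qed

lemma envelope_chart:
  assumes c: "c \<in> A"
  shows "envelope_chart (chart_image c) (loc c) (loch c)"
proof -
  interpret C: conformal_immersion "chart_image c" "loc c"
    by (rule conformal_immersion_chart[OF c imm(1) conformal(1)])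
  interpret H: conformal_immersion "chart_image c" "loch c"
    by (rule conformal_immersion_chart[OF c imm(2) conformal(2)])
  show ?thesis
  proof
    fix w assume w: "w \<in> chart_image c"
    define p where "p = chart_inv c w"
    have p: "p \<in> fst c" "snd c p = w" using c w by (simp_all add: p_def)
    let ?S = "mean_curvature_space A f p"
    note S = mean_curvature_space_iff[OF c p(1), unfolded p(2)]
    show "loc c w \<noteq> loch c w" using ne by (metis comp_apply)
    have "null_vec (fhat p) \<in> ?S"
      using env unfolding envelops_def round_sphere_def by blast
    then show "lightcone (loch c) w \<in> CV (lightcone (loc c)) w"
      unfolding S(1) by (simp add: lightcone_def p_def)
    have "range (frechet_derivative (loch c) (at w)) = tangent_space (round_sphere ?S) (fhat p)"
      using env c p unfolding envelops_def by blast
    \<comment> \<open>By enveloping, the differential of the second envelope takes values in the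
      tangent space of the sphere, which embeds into the subspace.\<close>
    then have "null_vec (frechet_derivative (loch c) (at w) h) - null_vec 0 \<in> ?S" for h
      using tangent_space_round_sphere[OF S(2)] by blast
    then have "null_vec (dx (loch c) w) - null_vec 0 \<in> ?S" "null_vec (dy (loch c) w) - null_vec 0 \<in> ?S"
      by (simp_all only: dx_def dy_def)
    then have "dx (lightcone (loch c)) w \<in> CV (lightcone (loc c)) w" "dy (lightcone (loch c)) w \<in> CV (lightcone (loc c)) w"
      unfolding H.dX[OF w] S(1) .
    then show "dz (lightcone (loch c)) w \<in> CV (lightcone (loc c)) w"
      unfolding dz_def by (intro CV_smult CV_diff)
  qed
qed

definition "chart_at p = (SOME c. c \<in> A \<and> p \<in> fst c)"

lemma chart_at: "chart_at p \<in> A" "p \<in> fst (chart_at p)"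
proof -
  have "chart_at p \<in> A \<and> p \<in> fst (chart_at p)"
    unfolding chart_at_def by (rule someI_ex) (use ex_chart in blast)
  then show "chart_at p \<in> A" "p \<in> fst (chart_at p)" by auto
qed

text \<open>A function of the point alone, as needed for the connectedness argument;
  \<open>horo_eq\<close> frees it from the chosen chart.\<close>

definition "horo p = horo_vectors (loc (chart_at p)) (loch (chart_at p)) (snd (chart_at p) p)"

lemma horo_eq: "c \<in> A \<Longrightarrow> p \<in> fst c \<Longrightarrow> horo p = horo_vectors (loc c) (loch c) (snd c p)"
  unfolding horo_def using horo_vectors_chart_independent chart_at by blast

lemma horo_chart_inv: "c \<in> A \<Longrightarrow> w \<in> chart_image c \<Longrightarrow> horo (chart_inv c w) = horo_vectors (loc c) (loch c) w"
  using horo_eq[of c "chart_inv c w"] by simp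

lemma horo_constant: "horo p = horo q"
proof (rule locally_constant_imp_constant[OF conn])
  fix c w assume c: "c \<in> A" and w: "w \<in> chart_image c"
  interpret E: envelope_chart "chart_image c" "loc c" "loch c" by (rule envelope_chart[OF c])
  obtain \<delta> where "\<delta> > 0" "ball w \<delta> \<subseteq> chart_image c"
    "\<forall>x\<in>ball w \<delta>. horo_vectors (loc c) (loch c) x = horo_vectors (loc c) (loch c) w"
    using E.horo_vectors_locally_constant[OF w] by blast
  then show "\<exists>\<delta>>0. ball w \<delta> \<subseteq> chart_image c \<and> (\<forall>x\<in>ball w \<delta>. horo (chart_inv c x) = horo (chart_inv c w))"
    unfolding horo_chart_inv[OF c w] using horo_chart_inv[OF c] by (metis subsetD)
qed

lemma s_willmore:
  assumes "\<And>p. horo p = {}"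
  shows "s_willmore A f"
proof -
  have "\<exists>Y s \<kappa>. invariants (chart_image c) (loc c) Y s \<kappa> \<and>
      (\<forall>w\<in>chart_image c. D_zbar Y (D_zbar Y \<kappa>) w + (cnj (s w) / 2) *s \<kappa> w = 0) \<and>
      (\<forall>w\<in>chart_image c. \<exists>a b :: complex. (a \<noteq> 0 \<or> b \<noteq> 0) \<and> a *s \<kappa> w + b *s D_zbar Y \<kappa> w = 0)"
    if c: "c \<in> A" for c
    using horo_chart_inv[OF c] assms by (intro envelope_chart.s_willmore_chart[OF envelope_chart[OF c]]) auto
  then show ?thesis unfolding s_willmore_def willmore_def by blast
qed

lemma continuous_surface_map:
  assumes "\<And>c. c \<in> A \<Longrightarrow> Cinf_on (g \<circ> chart_inv c) (chart_image c)"
  shows "continuous_on UNIV g"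
proof (rule continuous_at_imp_continuous_on, rule ballI)
  fix p
  obtain c where c: "c \<in> A" "p \<in> fst c" using ex_chart by blast
  have "continuous_on (chart_image c) (g \<circ> chart_inv c)" by (rule Cinf_on_continuous[OF assms[OF c(1)]])
  then have "continuous_on (fst c) ((g \<circ> chart_inv c) \<circ> snd c)"
    unfolding chart_image_def
    by (rule continuous_on_compose[OF homeomorphism_cont1[OF chart_homeomorphism[OF c(1)]]])
  then have "continuous_on (fst c) g" using c(1) by (simp cong: continuous_on_cong)
  then show "isCont g p" using open_dom[OF c(1)] c(2) continuous_on_eq_continuous_at by blast
qed

context
  fixes Q assumes Q: "\<And>p. Q \<in> horo p"
begin

lemma cmc_chart: "c \<in> A \<Longrightarrow> cmc_chart (chart_image c) (loc c) (loch c) Q"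
  using envelope_chart Q horo_chart_inv by (metis cmc_chart.intro cmc_chart_axioms.intro)

definition "perpg u p \<longleftrightarrow> cmc_chart.perp (loc (chart_at p)) u (snd (chart_at p) p)"

lemma perpg_eq:
  assumes "c \<in> A" "p \<in> fst c"
  shows "perpg u p \<longleftrightarrow> cmc_chart.perp (loc c) u (snd c p)"
  unfolding perpg_def cmc_chart.perp_def[OF cmc_chart[OF assms(1)]] cmc_chart.perp_def[OF cmc_chart[OF chart_at(1)]]
  using CV_chart_independent[OF assms(1) chart_at(1) assms(2) chart_at(2)] by simp

text \<open>This expresses that V + span Q is the same at all points: its orthogonal complement
  consists of the u orthogonal to Q with \<open>perpg u p\<close>, a condition independent of
  p.\<close>

lemma perpg_constant:
  assumes "mink u Q = 0"
  shows "perpg u p = perpg u q"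
proof (rule locally_constant_imp_constant[OF conn])
  fix c w assume c: "c \<in> A" and w: "w \<in> chart_image c"
  interpret C: cmc_chart "chart_image c" "loc c" "loch c" Q by (rule cmc_chart[OF c])
  obtain \<delta> where \<delta>: "\<delta> > 0" "ball w \<delta> \<subseteq> chart_image c" "\<forall>x\<in>ball w \<delta>. C.perp u x \<longleftrightarrow> C.perp u w"
    using C.perp_locally_constant[OF w assms] by blast
  have e: "perpg u (chart_inv c x) = C.perp u x" if "x \<in> chart_image c" for x
    using perpg_eq[OF c chart_inv_dom[OF c that]] c that by simp
  show "\<exists>\<delta>>0. ball w \<delta> \<subseteq> chart_image c \<and> (\<forall>x\<in>ball w \<delta>. perpg u (chart_inv c x) = perpg u (chart_inv c w))"
    unfolding e[OF w] using \<delta> e by (metis subsetD)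
qed

lemma perpg_null_vec:
  assumes "perpg u p"
  shows "mink u (null_vec (f p)) = 0" "mink u (null_vec (fhat p)) = 0"
proof -
  note c = chart_at[of p]
  let ?c = "chart_at p"
  interpret C: cmc_chart "chart_image ?c" "loc ?c" "loch ?c" Q by (rule cmc_chart[OF c(1)])
  have w: "snd ?c p \<in> chart_image ?c" using c by simp
  have "mink (cvec u) (lightcone (loc ?c) (snd ?c p)) = 0" "mink (cvec u) (lightcone (loch ?c) (snd ?c p)) = 0"
    using assms C.XhV[OF w] CV_base(1) unfolding perpg_def C.perp_def by blast+
  then show "mink u (null_vec (f p)) = 0" "mink u (null_vec (fhat p)) = 0"
    using c by (simp_all add: lightcone_def mink_cvec)
qed

lemma moebius_equivalent: "moebius_equivalent_to_hyperbolic_cmc1 A f"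
proof -
  obtain p0 :: 'a where True by simp
  define c0 where "c0 = chart_at p0"
  have c0: "c0 \<in> A" "p0 \<in> fst c0" using chart_at by (simp_all add: c0_def)
  interpret C0: cmc_chart "chart_image c0" "loc c0" "loch c0" Q by (rule cmc_chart[OF c0(1)])
  have w0: "snd c0 p0 \<in> chart_image c0" using c0 by simp
  obtain a b c d e where B: "lorentz_basis a b c d e" "Q \<in> span {a, b, c, d, e}"
    "\<And>u. mink u a = 0 \<Longrightarrow> mink u e = 0 \<Longrightarrow> mink u (null_vec (f p0)) = 0 \<and> mink u (null_vec (fhat p0)) = 0"
    "\<And>u. mink u a = 0 \<Longrightarrow> mink u b = 0 \<Longrightarrow> mink u c = 0 \<Longrightarrow> mink u d = 0 \<Longrightarrow> mink u e = 0
       \<Longrightarrow> mink u Q = 0 \<and> C0.perp u (snd c0 p0)"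
    using C0.lorentz_basis_at[OF w0] c0 by auto
  \<comment> \<open>V + span Q at the base point p0; the subsequent facts show that it contains both
    surfaces entirely.\<close>
  define W where "W = span {a, b, c, d, e}"
  have W: "subspace W" by (simp add: W_def subspace_span)
  have sph: "f p \<in> sphere 0 1" "fhat p \<in> sphere 0 1" for p
    using imm unfolding immersion_def by blast+
  have pos: "u = 0" if "mink u a = 0" "mink u e = 0" "mink u u = 0" for u
    using mink_orthogonal_null_vecs(2)[OF sph(1) sph(2) ne[symmetric, of p0], of u] B(3)[OF that(1,2)] that(3) by blast
  \<comment> \<open>Orthogonality to W means orthogonality to Q and to V at p0; constancy carries
    the latter to every p, where V contains both null vectors.\<close>
  have perp: "mink u (null_vec (f p)) = 0 \<and> mink u (null_vec (fhat p)) = 0"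
    if "mink u a = 0" "mink u b = 0" "mink u c = 0" "mink u d = 0" "mink u e = 0" for u p
  proof -
    have "mink u Q = 0" "perpg u p0" using B(4)[OF that] perpg_eq[OF c0] by auto
    then have "perpg u p" using perpg_constant by metis
    then show ?thesis using perpg_null_vec by blast
  qed
  have fW: "null_vec (f p) \<in> W" "null_vec (fhat p) \<in> W" for p
    unfolding W_def using perp pos by (blast intro: in_span_lorentz_basis[OF B(1)])+
  define k where "k = to_hyperboloid Q \<circ> f"
  \<comment> \<open>The formula of \<open>normal\<close> contains no coordinate, so it defines one
    unit normal on the whole surface.\<close>
  define \<nu> where "\<nu> p = (mink (null_vec (f p)) Q / (1 - f p \<bullet> fhat p)) *\<^sub>R null_vec (fhat p) - to_hyperboloid Q (f p)" for p
  have loc: "mink Q Q = 1 \<and> mink (null_vec (f p)) Q > 0 \<and> f p \<bullet> fhat p < 1 \<and>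
      mink (k p) (k p) = -1 \<and> mink (k p) Q = 0 \<and> k p $ None > 0 \<and>
      mink (\<nu> p) Q = 0 \<and> mink (\<nu> p) (k p) = 0 \<and> mink (\<nu> p) (\<nu> p) = 1 \<and>
      mink (\<nu> p) (dx (k \<circ> chart_inv c) (snd c p)) = 0 \<and>
      mink (\<nu> p) (dy (k \<circ> chart_inv c) (snd c p)) = 0 \<and>
      mean_curvature (k \<circ> chart_inv c) (\<nu> p) (snd c p) = 1"
    if c: "c \<in> A" "p \<in> fst c" for c p
  proof -
    interpret C: cmc_chart "chart_image c" "loc c" "loch c" Q by (rule cmc_chart[OF c(1)])
    have w: "snd c p \<in> chart_image c" using c by simp
    have n: "\<nu> p = C.normal (snd c p)" using c by (simp add: \<nu>_def C.normal_def)
    have kp: "k p = to_hyperboloid Q (loc c (snd c p))" using c by (simp add: k_def)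
    have "(k \<circ> chart_inv c) x = to_hyperboloid Q (loc c x)" for x by (simp add: k_def)
    note m = C.mean_curvature_eq_1[of "snd c p" "k \<circ> chart_inv c", OF w this]
    show ?thesis
      using C.Q_inner[OF w] C.hyperboloid_inner[OF w] m C.separated[OF w] c
      unfolding n[symmetric] kp[symmetric] by auto
  qed
  note loc' = loc[OF chart_at]
  have kW: "k p \<in> W" for p
    unfolding k_def comp_apply to_hyperboloid_def
    using W fW B(2) by (intro subspace_diff subspace_scale) (auto simp: W_def)
  have \<nu>W: "\<nu> p \<in> W" for p
    using W fW kW[of p] unfolding \<nu>_def k_def comp_apply by (intro subspace_diff subspace_scale)
  have cf: "continuous_on UNIV f" "continuous_on UNIV fhat"
    using continuous_surface_map smooth_loc by blast+
  have cn: "continuous_on UNIV (\<lambda>p. null_vec (g p))" if "continuous_on UNIV g" for g :: "'a \<Rightarrow> real^'n"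
  proof -
    have "continuous_on UNIV (\<lambda>p. (null_vec (g p) - null_vec 0) + null_vec 0)"
      by (intro continuous_on_add bounded_linear.continuous_on[OF null_vec_affine that] continuous_on_const)
    then show ?thesis by simp
  qed
  have cm: "continuous_on UNIV (\<lambda>p. mink (null_vec (f p)) Q)"
    by (intro bounded_bilinear.continuous_on[OF bilinear_mink_real] cn cf continuous_on_const)
  have "mink (null_vec (f p)) Q \<noteq> 0" "1 - f p \<bullet> fhat p \<noteq> 0" for p
    using loc'[of p] by auto
  then have "continuous_on UNIV \<nu>"
    unfolding \<nu>_def [abs_def] to_hyperboloid_def
    by (intro continuous_intros cm cn cf) auto
  then have un: "unit_normal A {y \<in> W. mink y Q = 0} k \<nu>"
    unfolding unit_normal_def using loc loc' \<nu>W by auto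
  have "range k \<subseteq> hyperbolic_space {y \<in> W. mink y Q = 0}"
    using loc' kW by (auto simp: hyperbolic_space_def)
  then have "cmc1_in_hyperbolic A {y \<in> W. mink y Q = 0} k"
    unfolding cmc1_in_hyperbolic_def using un loc by blast
  moreover have "range f \<subseteq> round_ball W Q"
    unfolding round_ball_def round_sphere_def using sph fW loc' by auto
  moreover have "has_signature W 4 1" unfolding W_def by (rule lorentz_basis_signature[OF B(1)])
  ultimately show ?thesis
    unfolding moebius_equivalent_to_hyperbolic_cmc1_def k_def using B(2) loc' W_def by blast
qed

end

end

theorem theorem3:
  fixes n :: nat
    and A :: "'a::t2_space chart set"
    and f fhat :: "'a \<Rightarrow> real^'n"
  assumes "n \<ge> 3" and "CARD('n) = n + 1"
    and "riemann_surface A" and "connected (UNIV :: 'a set)"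
    and "immersion A f" and "conformal A f"
    and "immersion A fhat" and "conformal A fhat"
    and "\<And>p. fhat p \<noteq> f p"
    and "envelops A fhat (mean_curvature_space A f)"
  shows "moebius_equivalent_to_hyperbolic_cmc1 A f \<or> s_willmore A f"
proof -
  interpret surface_with_envelope A f fhat
    using assms by unfold_locales
  show ?thesis
  proof (cases "\<exists>p Q. Q \<in> horo p")
    case True
    \<comment> \<open>By \<open>horo_constant\<close>, an element at one point serves at all
      points.\<close>
    then obtain Q where "\<And>p. Q \<in> horo p" using horo_constant by metis
    then show ?thesis using moebius_equivalent by blast
  next
    case False
    then show ?thesis using s_willmore by blast
  qed
qed

end
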